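(* Let $\rho_{A\bar AB\bar BC\bar C}$ be any six-party quantum state. Then $$I(A|\bar A:B|\bar B:C|\bar C)_\rho\;\geq\;D_{\mathsf{ALL}}\Big(\rho_{A\bar AB\bar BC\bar C}\,\Big\|\,\int_{-\infty}^{\infty}\mathrm d\beta_0(t)\,\big(\mathcal R^{[t]}_{\bar A\to A\bar A}\otimes\mathcal R^{[t]}_{\bar B\to B\bar B}\otimes\mathcal R^{[t]}_{\bar C\to C\bar C}\big)(\rho_{\bar A\bar B\bar C})\Big)$$ and $$I(A|\bar A:B|\bar B:C|\bar C)_\rho\;\geq\;-\int_{-\infty}^{\infty}\mathrm d\beta_0(t)\,\log F\Big(\rho_{A\bar AB\bar BC\bar C},\big(\mathcal R^{[t]}_{\bar A\to A\bar A}\otimes\mathcal R^{[t]}_{\bar B\to B\bar B}\otimes\mathcal R^{[t]}_{\bar C\to C\bar C}\big)(\rho_{\bar A\bar B\bar C})\Big),$$ with the local maps $$\mathcal R^{[t]}_{\bar A\to A\bar A}(\cdot):=\rho_{A\bar A}^{\frac{1+it}{2}}\rho_{\bar A}^{-\frac{1+it}{2}}(\cdot)\rho_{\bar A}^{-\frac{1-it}{2}}\rho_{A\bar A}^{\frac{1-it}{2}},$$ $\mathcal R^{[t]}_{\bar B\to B\bar B}$ and $\mathcal R^{[t]}_{\bar C\to C\bar C}$ defined in the same way with $A$ replaced by $B$, respectively $C$, and the probability density $\beta_0(t)=\frac{\pi}{2}(\cosh(\pi t)+1)^{-1}$ on $\mathbb R$.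
   Context: All Hilbert spaces are finite-dimensional; quantum states are positive semidefinite operators of unit trace; marginals are denoted by subscripts and obtained by partial trace; identity operators are omitted, e.g. $X_{\bar A}Y_{A\bar A}$ means $(1_A\otimes X_{\bar A})Y_{A\bar A}$. (Complex) powers and inverses of positive semidefinite operators are taken on the support (generalized inverse). $\log$ is the natural logarithm, and $\mathrm d\beta_0(t)$ means $\beta_0(t)\,\mathrm dt$. $H(A)_\rho=-\operatorname{tr}[\rho_A\log\rho_A]$, $I(A:B:C)_\rho:=H(A)_\rho+H(B)_\rho+H(C)_\rho-H(ABC)_\rho$, and $I(A|\bar A:B|\bar B:C|\bar C)_\rho:=I(A\bar A:B\bar B:C\bar C)_\rho-I(\bar A:\bar B:\bar C)_\rho$. $D_{\mathsf{ALL}}(\rho\|\sigma)=\sup_M\sum_z\operatorname{tr}[\rho M^z]\log\frac{\operatorname{tr}[\rho M^z]}{\operatorname{tr}[\sigma M^z]}$ is the measured relative entropy, the supremum over all POVMs $M=\{M^z\}_z$ (finite families of positive semidefinite operators summing to the identity), with the usual conventions ($0\log\frac0q=0$, value $+\infty$ if $\operatorname{tr}[\rho M^z]>0=\operatorname{tr}[\sigma M^z]$ for some $z$). $F(\rho,\sigma)=\|\sqrt\rho\sqrt\sigma\|_1^2$ is the quantum fidelity, with $\|\cdot\|_1$ the trace norm. *)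

theory Defs
  imports "HOL-Analysis.Analysis"
begin

text \<open>
  Operators on the Hilbert space with orthonormal basis indexed by a finite type are
  represented by their square matrices; the tensor product of spaces with index types
  \<open>'x\<close> and \<open>'y\<close> has index type \<open>'x \<times> 'y\<close>.
\<close>

type_synonym 'n cmat = "((complex, 'n) vec, 'n) vec"

definition adj :: "'n::finite cmat \<Rightarrow> 'n cmat" where
  "adj A = (\<chi> i j. cnj (A $ j $ i))"

definition unitary_mat :: "'n::finite cmat \<Rightarrow> bool" where
  "unitary_mat U \<longleftrightarrow> adj U ** U = mat 1 \<and> U ** adj U = mat 1"

definition diag_mat :: "('n \<Rightarrow> complex) \<Rightarrow> 'n::finite cmat" where
  "diag_mat d = (\<chi> i j. if i = j then d i else 0)"

definition psd :: "'n::finite cmat \<Rightarrow> bool" where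
  "psd A \<longleftrightarrow> adj A = A \<and> (\<forall>x. 0 \<le> Re (\<Sum>i\<in>UNIV. cnj (x $ i) * (A *v x) $ i))"

definition quantum_state :: "'n::finite cmat \<Rightarrow> bool" where
  "quantum_state \<rho> \<longleftrightarrow> psd \<rho> \<and> trace \<rho> = 1"

definition kron :: "'x::finite cmat \<Rightarrow> 'y::finite cmat \<Rightarrow> ('x \<times> 'y) cmat" where
  "kron A B = (\<chi> p q. A $ fst p $ fst q * B $ snd p $ snd q)"

subsection \<open>Functional calculus\<close>

text \<open>
  The operator \<open>f(A)\<close> of a Hermitian matrix \<open>A\<close>, read off from any spectral decomposition of
  \<open>A\<close>; by \<open>fun_calc_eq\<close> the result does not depend on the chosen decomposition.
\<close>

definition fun_calc :: "(real \<Rightarrow> complex) \<Rightarrow> 'n::finite cmat \<Rightarrow> 'n cmat" where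
  "fun_calc f A = (THE B. \<exists>U d. unitary_mat U \<and>
      A = U ** diag_mat (\<lambda>i. complex_of_real (d i)) ** adj U \<and>
      B = U ** diag_mat (\<lambda>i. f (d i)) ** adj U)"

lemma diag_mat_mult: "(A ** diag_mat d) $ i $ j = A $ i $ j * d j"
proof -
  have "(\<Sum>k\<in>UNIV. A $ i $ k * (if k = j then d k else 0)) =
        (\<Sum>k\<in>UNIV. if k = j then A $ i $ k * d k else 0)"
    by (intro sum.cong) auto
  then show ?thesis by (simp add: matrix_matrix_mult_def diag_mat_def)
qed

lemma mult_diag_mat: "(diag_mat d ** A) $ i $ j = d i * A $ i $ j"
proof -
  have "(\<Sum>k\<in>UNIV. (if i = k then d i else 0) * A $ k $ j) =
        (\<Sum>k\<in>UNIV. if k = i then d i * A $ k $ j else 0)"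
    by (intro sum.cong) auto
  then show ?thesis by (simp add: matrix_matrix_mult_def diag_mat_def)
qed

lemma spectral_fun_unique:
  fixes U V :: "'n::finite cmat" and d e :: "'n \<Rightarrow> real"
  assumes U: "unitary_mat U" and V: "unitary_mat V"
    and eq: "U ** diag_mat (\<lambda>i. complex_of_real (d i)) ** adj U
           = V ** diag_mat (\<lambda>i. complex_of_real (e i)) ** adj V"
  shows "U ** diag_mat (\<lambda>i. f (d i)) ** adj U = V ** diag_mat (\<lambda>i. f (e i)) ** adj V"
proof -
  define W where "W = adj V ** U"
  have VV: "adj V ** V = mat 1" "V ** adj V = mat 1"
    and UU: "adj U ** U = mat 1" "U ** adj U = mat 1"
    using U V by (auto simp: unitary_mat_def)
  have "adj V ** (U ** diag_mat (\<lambda>i. complex_of_real (d i)) ** adj U) ** U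
      = adj V ** (V ** diag_mat (\<lambda>i. complex_of_real (e i)) ** adj V) ** U"
    by (simp add: eq)
  then have "W ** diag_mat (\<lambda>i. complex_of_real (d i)) ** (adj U ** U)
      = (adj V ** V) ** diag_mat (\<lambda>i. complex_of_real (e i)) ** W"
    by (simp add: W_def matrix_mul_assoc)
  then have W1: "W ** diag_mat (\<lambda>i. complex_of_real (d i))
      = diag_mat (\<lambda>i. complex_of_real (e i)) ** W"
    by (simp add: VV UU)
  have "W $ i $ j * f (d j) = f (e i) * W $ i $ j" for i j
  proof (cases "W $ i $ j = 0")
    case False
    have "W $ i $ j * complex_of_real (d j) = complex_of_real (e i) * W $ i $ j"
      using arg_cong[OF W1, of "\<lambda>M. M $ i $ j"] by (simp add: diag_mat_mult mult_diag_mat)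
    with False have "d j = e i" by simp
    then show ?thesis by simp
  qed simp
  then have W2: "W ** diag_mat (\<lambda>i. f (d i)) = diag_mat (\<lambda>i. f (e i)) ** W"
    by (simp add: vec_eq_iff diag_mat_mult mult_diag_mat)
  have "U ** diag_mat (\<lambda>i. f (d i)) ** adj U
      = (V ** adj V) ** U ** diag_mat (\<lambda>i. f (d i)) ** adj U"
    by (simp add: VV)
  also have "\<dots> = V ** (W ** diag_mat (\<lambda>i. f (d i))) ** adj U"
    by (simp add: W_def matrix_mul_assoc)
  also have "\<dots> = V ** diag_mat (\<lambda>i. f (e i)) ** adj V ** (U ** adj U)"
    by (simp add: W2) (simp add: W_def matrix_mul_assoc)
  finally show ?thesis by (simp add: UU)
qed

lemma fun_calc_eq:
  fixes A U :: "'n::finite cmat" and d :: "'n \<Rightarrow> real"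
  assumes "unitary_mat U" and "A = U ** diag_mat (\<lambda>i. complex_of_real (d i)) ** adj U"
  shows "fun_calc f A = U ** diag_mat (\<lambda>i. f (d i)) ** adj U"
  unfolding fun_calc_def using assms by (intro the_equality) (auto intro: spectral_fun_unique)

text \<open>
  Complex powers are taken on the support: HOL has \<open>0 powr z = 0\<close> for every \<open>z\<close>,
  including \<open>z = 0\<close>. Likewise \<open>ln 0 = 0\<close>, which implements \<open>0 log 0 = 0\<close> in the entropy.
\<close>

definition mpow :: "'n::finite cmat \<Rightarrow> complex \<Rightarrow> 'n cmat" where
  "mpow A z = fun_calc (\<lambda>x. complex_of_real x powr z) A"

definition mlog :: "'n::finite cmat \<Rightarrow> 'n cmat" where
  "mlog A = fun_calc (\<lambda>x. complex_of_real (ln x)) A"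

definition msqrt :: "'n::finite cmat \<Rightarrow> 'n cmat" where
  "msqrt A = mpow A (1/2)"

subsection \<open>Marginals and information quantities\<close>

text \<open>
  The index map \<open>g\<close> identifies the total system \<open>'n\<close> with the product of the kept
  system \<open>'k\<close> and the discarded system \<open>'d\<close>.
\<close>

definition partial_trace :: "('k \<Rightarrow> 'd::finite \<Rightarrow> 'n) \<Rightarrow> 'n::finite cmat \<Rightarrow> ('k::finite) cmat" where
  "partial_trace g \<rho> = (\<chi> k l. \<Sum>m\<in>UNIV. \<rho> $ g k m $ g l m)"

definition tr_fst :: "('x::finite \<times> 'y::finite) cmat \<Rightarrow> 'y cmat" where
  "tr_fst = partial_trace (\<lambda>y x. (x, y))"

definition marg1 :: "('x::finite \<times> 'y::finite \<times> 'z::finite) cmat \<Rightarrow> 'x cmat" where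
  "marg1 = partial_trace (\<lambda>x (y, z). (x, y, z))"

definition marg2 :: "('x::finite \<times> 'y::finite \<times> 'z::finite) cmat \<Rightarrow> 'y cmat" where
  "marg2 = partial_trace (\<lambda>y (x, z). (x, y, z))"

definition marg3 :: "('x::finite \<times> 'y::finite \<times> 'z::finite) cmat \<Rightarrow> 'z cmat" where
  "marg3 = partial_trace (\<lambda>z (x, y). (x, y, z))"

definition bar_marg ::
  "(('a::finite \<times> 'a'::finite) \<times> ('b::finite \<times> 'b'::finite) \<times> ('c::finite \<times> 'c'::finite)) cmat
    \<Rightarrow> ('a' \<times> 'b' \<times> 'c') cmat" where
  "bar_marg = partial_trace (\<lambda>(a', b', c') (a, b, c). ((a, a'), (b, b'), (c, c')))"

definition vn_entropy :: "'n::finite cmat \<Rightarrow> real" where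
  "vn_entropy \<rho> = - Re (trace (\<rho> ** mlog \<rho>))"

definition mutual_info :: "('x::finite \<times> 'y::finite \<times> 'z::finite) cmat \<Rightarrow> real" where
  "mutual_info \<rho> = vn_entropy (marg1 \<rho>) + vn_entropy (marg2 \<rho>) + vn_entropy (marg3 \<rho>)
     - vn_entropy \<rho>"

definition cond_mutual_info ::
  "(('a::finite \<times> 'a'::finite) \<times> ('b::finite \<times> 'b'::finite) \<times> ('c::finite \<times> 'c'::finite)) cmat
    \<Rightarrow> real" where
  "cond_mutual_info \<rho> = mutual_info \<rho> - mutual_info (bar_marg \<rho>)"

subsection \<open>Measured relative entropy and fidelity\<close>

definition povm :: "nat \<Rightarrow> (nat \<Rightarrow> 'n::finite cmat) \<Rightarrow> bool" where
  "povm n M \<longleftrightarrow> (\<forall>z<n. psd (M z)) \<and> (\<Sum>z<n. M z) = mat 1"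

definition rel_ent_term :: "real \<Rightarrow> real \<Rightarrow> ereal" where
  "rel_ent_term p q = (if p = 0 then 0 else if q = 0 then \<infinity> else ereal (p * ln (p / q)))"

definition D_ALL :: "'n::finite cmat \<Rightarrow> 'n cmat \<Rightarrow> ereal" where
  "D_ALL \<rho> \<sigma> = (SUP (n, M) \<in> {(n, M). povm n M}.
     \<Sum>z<n. rel_ent_term (Re (trace (\<rho> ** M z))) (Re (trace (\<sigma> ** M z))))"

definition trace_norm :: "'n::finite cmat \<Rightarrow> real" where
  "trace_norm X = Re (trace (msqrt (adj X ** X)))"

definition fidelity :: "'n::finite cmat \<Rightarrow> 'n cmat \<Rightarrow> real" where
  "fidelity \<rho> \<sigma> = (trace_norm (msqrt \<rho> ** msqrt \<sigma>))\<^sup>2"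

text \<open>
  The fidelity may vanish and its logarithm need not be integrable a priori, so the logarithm
  and its integral are taken in the extended reals (positive minus negative part).
\<close>

definition elog :: "real \<Rightarrow> ereal" where
  "elog x = (if x = 0 then -\<infinity> else ereal (ln x))"

definition ereal_integral :: "'s measure \<Rightarrow> ('s \<Rightarrow> ereal) \<Rightarrow> ereal" where
  "ereal_integral \<mu> f =
     enn2ereal (\<integral>\<^sup>+t. e2ennreal (f t) \<partial>\<mu>) - enn2ereal (\<integral>\<^sup>+t. e2ennreal (- f t) \<partial>\<mu>)"

subsection \<open>Recovery maps\<close>

definition beta0 :: "real \<Rightarrow> real" where
  "beta0 t = pi / 2 * inverse (cosh (pi * t) + 1)"

text \<open>
  The rotated recovery map of a bipartite state \<open>\<sigma>\<close> on \<open>'x \<times> 'y\<close>, from \<open>'y\<close> to \<open>'x \<times> 'y\<close>.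
  The omitted identity operators on \<open>'x\<close> are made explicit, also the one next to the argument.
\<close>

definition rec_map :: "('x::finite \<times> 'y::finite) cmat \<Rightarrow> real \<Rightarrow> 'y cmat \<Rightarrow> ('x \<times> 'y) cmat" where
  "rec_map \<sigma> t X =
     mpow \<sigma> ((1 + \<i> * complex_of_real t) / 2)
     ** kron (mat 1) (mpow (tr_fst \<sigma>) (- ((1 + \<i> * complex_of_real t) / 2)))
     ** kron (mat 1) X
     ** kron (mat 1) (mpow (tr_fst \<sigma>) (- ((1 - \<i> * complex_of_real t) / 2)))
     ** mpow \<sigma> ((1 - \<i> * complex_of_real t) / 2)"

definition matrix_unit :: "'n \<Rightarrow> 'n \<Rightarrow> 'n::finite cmat" where
  "matrix_unit i j = (\<chi> k l. if k = i \<and> l = j then 1 else 0)"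

text \<open>
  The tensor product of two linear maps on matrices: the linear extension of
  \<open>X \<otimes> Y \<mapsto> \<Phi> X \<otimes> \<Psi> Y\<close> from products of matrix units.
\<close>

definition tensor_map ::
  "('i::finite cmat \<Rightarrow> 'o::finite cmat) \<Rightarrow> ('j::finite cmat \<Rightarrow> 'p::finite cmat)
    \<Rightarrow> ('i \<times> 'j) cmat \<Rightarrow> ('o \<times> 'p) cmat" where
  "tensor_map \<Phi> \<Psi> X = (\<chi> r s. \<Sum>(i, j)\<in>UNIV. \<Sum>(k, l)\<in>UNIV.
     X $ (i, j) $ (k, l) * kron (\<Phi> (matrix_unit i k)) (\<Psi> (matrix_unit j l)) $ r $ s)"

definition recovered ::
  "(('a::finite \<times> 'a'::finite) \<times> ('b::finite \<times> 'b'::finite) \<times> ('c::finite \<times> 'c'::finite)) cmat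
    \<Rightarrow> real \<Rightarrow> (('a \<times> 'a') \<times> ('b \<times> 'b') \<times> ('c \<times> 'c')) cmat" where
  "recovered \<rho> t =
     tensor_map (rec_map (marg1 \<rho>) t) (tensor_map (rec_map (marg2 \<rho>) t) (rec_map (marg3 \<rho>) t))
       (bar_marg \<rho>)"

end

theory Submission
  imports Defs "HOL-Complex_Analysis.Conformal_Mappings"
begin

text \<open>
  Let \<open>G z = \<sigma>\<^bsup>z/2\<^esup> \<tau>\<^bsup>-z/2\<^esup> \<omega>\<^bsup>z/2\<^esup>\<close>, where \<open>\<sigma>\<close> is the tensor product of the three
  two-party marginals, \<open>\<tau>\<close> that of the three barred one-party marginals and \<open>\<omega>\<close> the joint barred
  marginal; the recovered state is \<open>G z (G z)\<^sup>*\<close> at \<open>z = 1 + it\<close>.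
  The function \<open>f z = tr (\<rho>\<^bsup>1-z/2\<^esup> G z)\<close> is an exponential sum with \<open>f 0 = 1\<close>. It is bounded by 1
  on the imaginary axis because imaginary powers are contractions, and \<open>Re (f' 0)\<close> is minus one half of
  the conditional mutual information. Hirschman's strengthening of the three lines theorem, differentiated
  at 0, bounds \<open>Re (f' 0)\<close> by the integral of \<open>\<beta>\<^sub>0(t) log |f(1 + it)|\<close>, and \<open>|f(1 + it)|\<^sup>2\<close> is at
  most the fidelity: this is the second inequality. For the first one insert \<open>\<Sum>\<^sub>k w\<^sub>k\<^bsup>z/2\<^esup> M\<^sub>k\<close> in front of
  \<open>G z\<close>, with \<open>w\<^sub>k\<close> the ratio of the two probabilities of outcome \<open>k\<close>, and estimate \<open>f(1 + it)\<close> by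
  the Cauchy--Schwarz inequality.
\<close>

text \<open>On the left line |f| is at most 1, and f 0 = 1 attains this at a boundary point of the
  strip; so slopes at 0 are compared. If Re g is the Poisson integral of boundary values dominating
  ln |f|, then |f exp (- g)| is at most 1 and Re (f' 0) \<le> Re (g' 0). The density
  \<open>beta0\<close> enters as the derivative of the Poisson kernel in x at x = 0. Two obstacles
  shape the estimates. Zeros of f on Re z = 1 make ln |f| singular, so ln (|f| + e) replaces it. The
  analytic kernel tan (pi z / 2) / 2 has its poles on that line, so the line is approached through
  Re z = x with x tending to 1. The limits in x, in the cut-off T and in e are all taken in the
  inequality for the slope. In the first inequality the average over t stands inside the state,
  while the strip estimate averages a logarithm. Applying ln y \<le> y - 1 under the integral leaves
  an expression linear in the recovered state, so the average can be moved inside. The weights are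
  free positive numbers up to that point; the ratios of the probabilities taken after averaging make
  the remaining linear term vanish.\<close>

subsection \<open>Hirschman's inequality on the strip\<close>

text \<open>The Poisson kernel of the strip \<open>0 < Re z < 1\<close> at the point \<open>x + ir\<close>, for boundary mass at \<open>z = 1\<close>.\<close>

definition strip_kernel :: "real \<Rightarrow> real \<Rightarrow> real" where
  "strip_kernel x r = sin (pi * x) / 2 / (cosh (pi * r) + cos (pi * x))"

lemma cosh_plus_cos_pos:
  fixes a r :: real
  assumes "0 \<le> a" "a < pi"
  shows "cosh r + cos a > 0"
proof -
  have "cos a > cos pi" using assms by (intro cos_monotone_0_pi) auto
  moreover have "cosh r \<ge> 1" by (rule cosh_real_ge_1)
  ultimately show ?thesis by simp
qed

lemma strip_kernel_nonneg: "0 \<le> x \<Longrightarrow> x < 1 \<Longrightarrow> 0 \<le> strip_kernel x r"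
  unfolding strip_kernel_def
  by (intro divide_nonneg_nonneg sin_ge_zero less_imp_le[OF cosh_plus_cos_pos]) auto

text \<open>The analytic completion of the kernel: tan (pi z / 2) is purely imaginary on Re z = 0,
  and the pole of its half at z = 1 carries the unit boundary mass. Multiplying numerator and
  denominator by \<open>cnj (cos w)\<close> makes the denominator real.\<close>

lemma Re_half_tan:
  "Re (tan (of_real (pi / 2) * z) / 2) = strip_kernel (Re z) (Im z)"
proof -
  define w where "w = of_real (pi / 2) * z"
  have wc: "w + cnj w = of_real (pi * Re z)"
    by (simp add: w_def complex_eq_iff)
  have wm: "w - cnj w = \<i> * of_real (pi * Im z)"
    by (simp add: w_def complex_eq_iff)
  have half_cancel: "a / 2 / (b / 2) = a / b" for a b :: complex by simp
  have c: "cos (\<i> * complex_of_real (pi * Im z)) = of_real (cosh (pi * Im z))"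
    by (simp add: complex_eq_iff Re_cos Im_cos cosh_field_def)
  have s: "Re (sin (\<i> * complex_of_real (pi * Im z))) = 0"
    by (simp add: Re_sin)
  have "tan w = sin w * cnj (cos w) / (cos w * cnj (cos w))"
    by (simp add: tan_def)
  also have "sin w * cnj (cos w) = (sin (w + cnj w) + sin (w - cnj w)) / 2"
    by (simp add: sin_times_cos cnj_cos)
  also have "cos w * cnj (cos w) = (cos (w - cnj w) + cos (w + cnj w)) / 2"
    by (simp add: cos_times_cos cnj_cos)
  also have "cos (w - cnj w) + cos (w + cnj w) = of_real (cosh (pi * Im z) + cos (pi * Re z))"
    by (simp only: wm wc c cos_of_real of_real_add)
  also have "(sin (w + cnj w) + sin (w - cnj w)) / 2 / (of_real (cosh (pi * Im z) + cos (pi * Re z)) / 2)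
      = (sin (w + cnj w) + sin (w - cnj w)) / of_real (cosh (pi * Im z) + cos (pi * Re z))"
    by (rule half_cancel)
  finally have "tan w = (sin (w + cnj w) + sin (w - cnj w)) / of_real (cosh (pi * Im z) + cos (pi * Re z))" .
  then have "Re (tan w) = Re (sin (w + cnj w) + sin (w - cnj w)) / (cosh (pi * Im z) + cos (pi * Re z))"
    by (simp only: Re_divide_of_real)
  also have "Re (sin (w + cnj w) + sin (w - cnj w)) = sin (pi * Re z)"
    by (simp only: wm wc s plus_complex.sel sin_of_real Re_complex_of_real)
  finally have "Re (tan w) = sin (pi * Re z) / (cosh (pi * Im z) + cos (pi * Re z))" .
  then show ?thesis
    by (simp add: strip_kernel_def w_def)
qed

text \<open>With sines and hyperbolic sines of the half arguments, the kernel's denominator becomes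
  the one that differentiating the arctangent produces. The point of this explicit form is that it
  is bounded uniformly in x.\<close>

lemma strip_kernel_antiderivative:
  assumes x: "0 < x" "x < 1"
  shows "((\<lambda>r. arctan (tan (pi * x / 2) * tanh (pi * r / 2)) / pi) has_real_derivative strip_kernel x r) (at r)"
proof -
  define s c where "s = sin (pi * x / 2)" and "c = cos (pi * x / 2)"
  define C S where "C = cosh (pi * r / 2)" and "S = sinh (pi * r / 2)"
  have c: "c > 0" unfolding c_def using x by (intro cos_gt_zero_pi) (auto intro: less_trans[of _ 0])
  have C: "C > 0" unfolding C_def by simp
  have sc: "s\<^sup>2 + c\<^sup>2 = 1" by (simp add: s_def c_def)
  have CS: "C\<^sup>2 = 1 + S\<^sup>2" by (simp add: C_def S_def cosh_square_eq)
  have e1: "cosh (pi * r) = C\<^sup>2 + S\<^sup>2"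
    using cosh_double[of "pi * r / 2"] by (simp add: C_def S_def)
  have e2: "cos (pi * x) = c\<^sup>2 - s\<^sup>2"
    using cos_double[of "pi * x / 2"] by (simp add: c_def s_def)
  have e3: "sin (pi * x) = 2 * s * c"
    using sin_double[of "pi * x / 2"] by (simp add: c_def s_def)
  have den: "c\<^sup>2 * C\<^sup>2 + s\<^sup>2 * S\<^sup>2 > 0"
    using c C by (intro add_pos_nonneg) auto
  have "cosh (pi * r) + cos (pi * x) = 2 * (c\<^sup>2 * C\<^sup>2 + s\<^sup>2 * S\<^sup>2)"
    using CS sc unfolding e1 e2 by algebra
  then have k: "strip_kernel x r = s * c / (2 * (c\<^sup>2 * C\<^sup>2 + s\<^sup>2 * S\<^sup>2))"
    by (simp add: strip_kernel_def e3)
  have "((\<lambda>r. pi * r / 2) has_real_derivative pi / 2) (at r)"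
    by (auto intro!: derivative_eq_intros)
  from has_field_derivative_tanh[OF _ this]
  have "((\<lambda>r. tanh (pi * r / 2)) has_real_derivative (1 - (tanh (pi * r / 2))\<^sup>2) * (pi / 2)) (at r)"
    using C by (simp add: C_def)
  from DERIV_cdivide[OF DERIV_chain2[OF DERIV_arctan DERIV_cmult[OF this]], of "tan (pi * x / 2)" pi]
  have "((\<lambda>r. arctan (tan (pi * x / 2) * tanh (pi * r / 2)) / pi) has_real_derivative
     (s / c * (1 - (S / C)\<^sup>2) * (pi / 2)) / (1 + (s / c * (S / C))\<^sup>2) / pi) (at r)"
    by (simp only: s_def c_def S_def C_def tan_def tanh_def divide_inverse mult_ac)
  moreover have "(s / c * (1 - (S / C)\<^sup>2) * (pi / 2)) / (1 + (s / c * (S / C))\<^sup>2) / pi = strip_kernel x r"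
  proof -
    have a: "1 - (S / C)\<^sup>2 = 1 / C\<^sup>2"
    proof -
      have "1 - (S / C)\<^sup>2 = (C\<^sup>2 - S\<^sup>2) / C\<^sup>2"
        using C by (simp add: power_divide diff_divide_distrib)
      also have "C\<^sup>2 - S\<^sup>2 = 1" using CS by simp
      finally show ?thesis .
    qed
    have b: "1 + (s / c * (S / C))\<^sup>2 = (c\<^sup>2 * C\<^sup>2 + s\<^sup>2 * S\<^sup>2) / (c\<^sup>2 * C\<^sup>2)"
      using c C by (simp add: power_divide power_mult_distrib field_simps)
    show ?thesis
      unfolding a b k using c C den by (simp add: power2_eq_square)
  qed
  ultimately show ?thesis by simp
qed

lemma strip_kernel_continuous:
  assumes "0 \<le> x" "x < 1" shows "continuous_on A (\<lambda>s. strip_kernel x (y - s))"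
  unfolding strip_kernel_def
  using cosh_plus_cos_pos[of "pi * x"] assms
  by (intro continuous_intros) (auto simp: less_imp_neq[symmetric] less_imp_le)

text \<open>The mass over the whole line is x. The bound 1, from |arctan| \<le> pi / 2, is enough
  because x tends to 1 in the end.\<close>

lemma strip_kernel_integral_le_1:
  assumes x: "0 < x" "x < 1" and T: "0 \<le> T"
  shows "integral {-T..T} (\<lambda>s. strip_kernel x (y - s)) \<le> 1"
proof -
  define F where "F = (\<lambda>s. - (arctan (tan (pi * x / 2) * tanh (pi * (y - s) / 2)) / pi))"
  have "(F has_real_derivative strip_kernel x (y - s)) (at s)" for s
  proof -
    have "((\<lambda>s. y - s) has_real_derivative -1) (at s)"
      by (auto intro!: derivative_eq_intros)
    from DERIV_minus[OF DERIV_chain2[OF strip_kernel_antiderivative[OF x] this]]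
    show ?thesis by (simp add: F_def)
  qed
  then have "((\<lambda>s. strip_kernel x (y - s)) has_integral F T - F (-T)) {-T..T}"
    using T by (intro fundamental_theorem_of_calculus)
      (auto simp flip: has_real_derivative_iff_has_vector_derivative intro: has_field_derivative_at_within)
  moreover have "\<bar>F s\<bar> \<le> 1 / 2" for s
  proof -
    have "\<bar>arctan (tan (pi * x / 2) * tanh (pi * (y - s) / 2))\<bar> \<le> pi / 2"
      using arctan_lbound[of "tan (pi * x / 2) * tanh (pi * (y - s) / 2)"]
        arctan_ubound[of "tan (pi * x / 2) * tanh (pi * (y - s) / 2)"] by linarith
    then show ?thesis unfolding F_def by (simp add: divide_le_eq)
  qed
  ultimately show ?thesis
    by (smt (verit) integral_unique field_sum_of_halves)
qed

text \<open>This quantifies that the kernel concentrates at r = 0 as x tends to 1, since sin (pi *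
  x) tends to 0. The denominator is at least cosh (pi * r) - 1, hence at least the square of r:
  averaging \<open>1 + u + u\<^sup>2 / 2 \<le> exp u\<close> with
  \<open>1 - u \<le> exp (- u)\<close> gives \<open>1 + u\<^sup>2 / 4 \<le> cosh u\<close>, and pi
  exceeds 2.\<close>

lemma strip_kernel_square_le:
  assumes x: "0 \<le> x" "x < 1"
  shows "strip_kernel x r * r\<^sup>2 \<le> sin (pi * x) / 2"
proof -
  have s: "sin (pi * x) \<ge> 0" using x by (intro sin_ge_zero) auto
  have pos: "cosh (pi * r) + cos (pi * x) > 0" using x by (intro cosh_plus_cos_pos) auto
  have cosh_ge: "1 + u\<^sup>2 / 4 \<le> cosh u" if "u \<ge> 0" for u :: real
  proof -
    have "1 + u + u\<^sup>2 / 2 \<le> exp u" by (rule exp_lower_Taylor_quadratic[OF that])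
    moreover have "1 + (- u) \<le> exp (- u)" by (rule exp_ge_add_one_self)
    ultimately show ?thesis by (simp add: cosh_field_def)
  qed
  have "r\<^sup>2 \<le> (pi * \<bar>r\<bar>)\<^sup>2 / 4"
  proof -
    have "2\<^sup>2 \<le> pi\<^sup>2" using pi_gt3 by (intro power_mono) auto
    then have "4 * r\<^sup>2 \<le> pi\<^sup>2 * r\<^sup>2" by (intro mult_right_mono) auto
    then show ?thesis by (simp add: power_mult_distrib)
  qed
  moreover have "1 + (pi * \<bar>r\<bar>)\<^sup>2 / 4 \<le> cosh (pi * r)"
  proof -
    have "pi * \<bar>r\<bar> \<ge> 0" by simp
    from cosh_ge[OF this] show ?thesis by (cases "r \<ge> 0") simp_all
  qed
  moreover have "cos (pi * x) \<ge> -1" by simp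
  ultimately have "r\<^sup>2 \<le> cosh (pi * r) + cos (pi * x)" by linarith
  then have "r\<^sup>2 / (cosh (pi * r) + cos (pi * x)) \<le> 1" using pos by simp
  then have "sin (pi * x) / 2 * (r\<^sup>2 / (cosh (pi * r) + cos (pi * x))) \<le> sin (pi * x) / 2 * 1"
    using s by (intro mult_left_mono) auto
  then show ?thesis by (simp add: strip_kernel_def)
qed

text \<open>A Phragmen-Lindelof argument. The factor \<open>exp (d * (z\<^sup>2 - 1))\<close> has
  modulus at most 1 on the strip, because x \<le> 1, and decays as |Im z| grows; the maximum
  principle on a large rectangle then applies, and d tends to 0.\<close>

lemma strip_maximum_modulus:
  fixes G :: "complex \<Rightarrow> complex"
  assumes hol: "G holomorphic_on {z. 0 < Re z \<and> Re z < x}"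
    and cont: "continuous_on {z. 0 \<le> Re z \<and> Re z \<le> x} G"
    and bd: "\<And>z. 0 \<le> Re z \<Longrightarrow> Re z \<le> x \<Longrightarrow> norm (G z) \<le> C"
    and left: "\<And>z. Re z = 0 \<Longrightarrow> norm (G z) \<le> 1"
    and right: "\<And>z. Re z = x \<Longrightarrow> norm (G z) \<le> 1"
    and r: "0 < r" "r < x" and x: "x \<le> 1"
  shows "norm (G (of_real r)) \<le> 1"
proof -
  have C: "C \<ge> 0" using bd[of 0] r norm_ge_zero[of "G 0"] by (simp, linarith)
  have key: "norm (G (of_real r)) \<le> exp d" if d: "d > 0" for d :: real
  proof -
    define E where "E z = G z * exp (of_real d * (z\<^sup>2 - 1))" for z
    \<comment> \<open>On the horizontal edges the Gaussian factor is at most exp (- d * Y), because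
      Y is at most its square. The choice makes this at most 1 / (C + 1), which beats the bound C on
      \<open>G\<close>.\<close>
    define Y where "Y = max 1 (ln (C + 1) / d)"
    define S where "S = box (Complex 0 (-Y)) (Complex x Y)"
    have Y: "Y \<ge> 1" "Y * d \<ge> ln (C + 1)"
      unfolding Y_def using d by (auto simp: pos_divide_le_eq[symmetric])
    have nE: "norm (E z) = norm (G z) * exp (d * ((Re z)\<^sup>2 - (Im z)\<^sup>2 - 1))" for z
      by (simp add: E_def norm_mult power2_eq_square)
    have S: "S = {z. 0 < Re z \<and> Re z < x \<and> - Y < Im z \<and> Im z < Y}"
      by (auto simp: S_def in_box_complex_iff)
    have ne: "S \<noteq> {}" using r Y unfolding S by (auto intro!: exI[of _ "of_real r"])
    have cl: "closure S = {z. 0 \<le> Re z \<and> Re z \<le> x \<and> - Y \<le> Im z \<and> Im z \<le> Y}"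
      using ne unfolding S_def by (auto simp: in_cbox_complex_iff)
    have fr: "frontier S = closure S - S"
      unfolding frontier_def S_def by (simp only: interior_open[OF open_box])
    have "norm (E (of_real r)) \<le> 1"
    proof (rule maximum_modulus_frontier[of E S])
      show "E holomorphic_on interior S"
        unfolding E_def S_def interior_open[OF open_box]
        unfolding S_def[symmetric] S
        by (intro holomorphic_intros holomorphic_on_subset[OF hol]) auto
      show "continuous_on (closure S) E"
        unfolding E_def cl
        by (intro continuous_intros continuous_on_subset[OF cont]) auto
      show "bounded S" by (simp add: S_def)
      show "of_real r \<in> S" using r Y by (simp add: S)
    next
      fix z assume z: "z \<in> frontier S"
      then have zr: "0 \<le> Re z" "Re z \<le> x" by (auto simp: fr cl)
      have z1: "(Re z)\<^sup>2 \<le> 1" using zr x by (simp add: power_le_one)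
      from z have "Re z = 0 \<or> Re z = x \<or> \<bar>Im z\<bar> = Y"
        unfolding fr cl unfolding S by (auto simp: abs_if)
      then show "norm (E z) \<le> 1"
      proof
        assume "Re z = 0"
        then have "norm (G z) * exp (d * ((Re z)\<^sup>2 - (Im z)\<^sup>2 - 1)) \<le> 1 * 1"
          using d left by (intro mult_mono) (auto intro!: mult_nonneg_nonpos order_trans[OF _ zero_le_power2])
        then show ?thesis by (simp add: nE)
      next
        assume "Re z = x \<or> \<bar>Im z\<bar> = Y"
        then show ?thesis
        proof
          assume "Re z = x"
          moreover have "(Re z)\<^sup>2 - (Im z)\<^sup>2 - 1 \<le> 0" using z1 zero_le_power2[of "Im z"] by linarith
          ultimately have "norm (G z) * exp (d * ((Re z)\<^sup>2 - (Im z)\<^sup>2 - 1)) \<le> 1 * 1"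
            using d right by (intro mult_mono) (auto intro!: mult_nonneg_nonpos)
          then show ?thesis by (simp add: nE)
        next
          assume "\<bar>Im z\<bar> = Y"
          then have "(Im z)\<^sup>2 = Y\<^sup>2" by (metis power2_abs)
          moreover have "Y \<le> Y\<^sup>2" using Y by (simp add: power2_eq_square)
          ultimately have "d * ((Re z)\<^sup>2 - (Im z)\<^sup>2 - 1) \<le> d * (- Y)"
            using z1 d by (intro mult_left_mono) auto
          also have "\<dots> \<le> - ln (C + 1)" using Y by (simp add: mult.commute)
          finally have "exp (d * ((Re z)\<^sup>2 - (Im z)\<^sup>2 - 1)) \<le> exp (- ln (C + 1))" by simp
          also have "\<dots> = 1 / (C + 1)" using C by (simp add: exp_minus divide_inverse)
          finally have "norm (G z) * exp (d * ((Re z)\<^sup>2 - (Im z)\<^sup>2 - 1)) \<le> C * (1 / (C + 1))"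
            using bd[OF zr] C by (intro mult_mono) auto
          also have "\<dots> \<le> 1" using C by simp
          finally show ?thesis by (simp add: nE)
        qed
      qed
    qed
    then have "norm (G (of_real r)) * exp (d * (r\<^sup>2 - 1)) \<le> 1" by (simp add: nE)
    then have "norm (G (of_real r)) \<le> exp (- (d * (r\<^sup>2 - 1)))"
      unfolding exp_minus inverse_eq_divide by (simp only: pos_le_divide_eq exp_gt_zero)
    also have "\<dots> \<le> exp d" using d by (simp add: algebra_simps)
    finally show ?thesis .
  qed
  have "((\<lambda>d. exp d) \<longlongrightarrow> exp (0::real)) (at_right 0)"
    by (intro tendsto_intros)
  moreover have "eventually (\<lambda>d. norm (G (of_real r)) \<le> exp d) (at_right 0)"
    using key by (auto simp: eventually_at_right_field intro: exI[of _ 1])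
  ultimately show ?thesis
    by (auto intro: tendsto_lowerbound)
qed

section \<open>The analytic completion of the Poisson integral\<close>

text \<open>
  The real part is the Poisson integral of \<open>\<psi>\<close> on the line \<open>Re z = 1\<close>, with value 0 on \<open>Re z = 0\<close>.
  Cutting \<open>\<psi>\<close> off at \<open>T\<close> spares a normalisation of the imaginary part, which need not converge as
  \<open>T \<rightarrow> \<infinity>\<close>.
\<close>

definition strip_potential :: "real \<Rightarrow> (real \<Rightarrow> real) \<Rightarrow> complex \<Rightarrow> complex" where
  "strip_potential T \<psi> z =
     integral {-T..T} (\<lambda>s. of_real (\<psi> s) * (tan (of_real (pi / 2) * (z - \<i> * of_real s)) / 2))"

lemma cos_half_pi_nonzero:
  assumes "\<bar>Re z\<bar> < 1"
  shows "cos (of_real (pi / 2) * z) \<noteq> 0"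
proof
  define w where "w = of_real (pi / 2) * z"
  assume "cos (of_real (pi / 2) * z) = 0"
  then have "cos w * cnj (cos w) = 0" by (simp add: w_def)
  moreover have "cos w * cnj (cos w) = (cos (w - cnj w) + cos (w + cnj w)) / 2"
    by (simp add: cos_times_cos cnj_cos)
  moreover have "w + cnj w = of_real (pi * Re z)" "w - cnj w = \<i> * of_real (pi * Im z)"
    by (simp_all add: w_def complex_eq_iff)
  moreover have "cos (\<i> * complex_of_real (pi * Im z)) = of_real (cosh (pi * Im z))"
    by (simp add: complex_eq_iff Re_cos Im_cos cosh_field_def)
  ultimately have "complex_of_real (cosh (pi * Im z) + cos (pi * Re z)) = 0"
    by (simp only: cos_of_real of_real_add) simp
  then have "cosh (pi * Im z) + cos (pi * Re z) = 0"
    by (simp only: of_real_eq_0_iff)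
  moreover have "cosh (pi * Im z) + cos \<bar>pi * Re z\<bar> > 0"
    using assms by (intro cosh_plus_cos_pos) (auto simp: abs_mult)
  ultimately show False by simp
qed

text \<open>The symmetric strip |Re z| < 1 contains 0 in its interior, so the potential has a
  genuine complex derivative at the boundary point where the slopes are compared.\<close>

lemma strip_potential_derivative:
  assumes \<psi>: "continuous_on {-T..T} \<psi>" and z: "\<bar>Re z\<bar> < 1"
  shows "(strip_potential T \<psi> has_field_derivative
    integral {-T..T} (\<lambda>s. of_real (\<psi> s) * (of_real (pi / 4) / (cos (of_real (pi / 2) * (z - \<i> * of_real s)))\<^sup>2))) (at z)"
proof -
  define U where "U = {z. \<bar>Re z\<bar> < 1}"
  define c :: complex where "c = of_real (pi / 2)"
  have c2: "of_real (pi / 4) = c / 2" by (simp add: c_def)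
  have U: "U = {z. -1 < Re z} \<inter> {z. Re z < 1}" by (auto simp: U_def)
  have oU: "open U" unfolding U by (intro open_Int open_halfspace_Re_gt open_halfspace_Re_lt)
  have cU: "convex U" unfolding U by (intro convex_Int convex_halfspace_Re_gt convex_halfspace_Re_lt)
  have zU: "z \<in> U" using z by (simp add: U_def)
  have nz: "cos (c * (w - \<i> * of_real s)) \<noteq> 0" if "w \<in> U" for w s
    using that unfolding c_def by (intro cos_half_pi_nonzero) (simp add: U_def)
  have "((\<lambda>z. integral (cbox (-T) T) (\<lambda>s. of_real (\<psi> s) * (tan (c * (z - \<i> * of_real s)) / 2)))
     has_field_derivative integral (cbox (-T) T)
       (\<lambda>s. of_real (\<psi> s) * (c / 2 / (cos (c * (z - \<i> * of_real s)))\<^sup>2))) (at z within U)"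
  proof (rule leibniz_rule_field_derivative[OF _ _ _ zU cU])
    fix w s assume w: "w \<in> U"
    have "((\<lambda>z. c * (z - \<i> * of_real s)) has_field_derivative c) (at w)"
      by (auto intro!: derivative_eq_intros)
    from DERIV_chain2[OF DERIV_tan[OF nz[OF w]] this]
    have "((\<lambda>z. tan (c * (z - \<i> * of_real s))) has_field_derivative
       inverse ((cos (c * (w - \<i> * of_real s)))\<^sup>2) * c) (at w)" .
    from DERIV_cmult[OF DERIV_cdivide[OF this, of 2], of "of_real (\<psi> s)"]
    have "((\<lambda>z. of_real (\<psi> s) * (tan (c * (z - \<i> * of_real s)) / 2)) has_field_derivative
       of_real (\<psi> s) * (inverse ((cos (c * (w - \<i> * of_real s)))\<^sup>2) * c / 2)) (at w within U)"
      by (rule has_field_derivative_at_within)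
    moreover have "inverse ((cos (c * (w - \<i> * of_real s)))\<^sup>2) * c / 2 = c / 2 / (cos (c * (w - \<i> * of_real s)))\<^sup>2"
      by (simp add: inverse_eq_divide)
    ultimately show "((\<lambda>z. of_real (\<psi> s) * (tan (c * (z - \<i> * of_real s)) / 2)) has_field_derivative
       of_real (\<psi> s) * (c / 2 / (cos (c * (w - \<i> * of_real s)))\<^sup>2)) (at w within U)"
      by (simp only:)
  next
    fix w assume w: "w \<in> U"
    have "continuous_on (cbox (-T) T) (\<lambda>s. of_real (\<psi> s) * (sin (c * (w - \<i> * of_real s)) / cos (c * (w - \<i> * of_real s)) / 2))"
      using nz[OF w] \<psi> by (intro continuous_intros) simp_all
    then show "(\<lambda>s. of_real (\<psi> s) * (tan (c * (w - \<i> * of_real s)) / 2)) integrable_on cbox (-T) T"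
      unfolding tan_def by (rule integrable_continuous)
  next
    have "continuous_on (U \<times> {-T..T})
      (\<lambda>p. of_real (\<psi> (snd p)) * (c / 2 / (cos (c * (fst p - \<i> * of_real (snd p))))\<^sup>2))"
    proof (intro continuous_intros continuous_on_compose2[OF \<psi>])
      show "snd ` (U \<times> {-T..T}) \<subseteq> {-T..T}" by auto
      show "\<forall>x\<in>U \<times> {-T..T}. (cos (c * (fst x - \<i> * complex_of_real (snd x))))\<^sup>2 \<noteq> 0"
        using nz by simp
    qed
    then show "continuous_on (U \<times> cbox (-T) T)
      (\<lambda>(w, s). of_real (\<psi> s) * (c / 2 / (cos (c * (w - \<i> * of_real s)))\<^sup>2))"
      by (simp add: case_prod_beta)
  qed
  then show ?thesis
    unfolding strip_potential_def[abs_def] at_within_open[OF zU oU] c2 c_def[symmetric] cbox_interval .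
qed

lemma Re_strip_potential:
  assumes \<psi>: "continuous_on {-T..T} \<psi>" and z: "\<bar>Re z\<bar> < 1"
  shows "Re (strip_potential T \<psi> z) = integral {-T..T} (\<lambda>s. \<psi> s * strip_kernel (Re z) (Im z - s))"
proof -
  have nz: "cos (of_real (pi / 2) * (z - \<i> * of_real s)) \<noteq> 0" for s
    using z by (intro cos_half_pi_nonzero) simp
  have "continuous_on {-T..T} (\<lambda>s. of_real (\<psi> s) * (sin (of_real (pi / 2) * (z - \<i> * of_real s))
      / cos (of_real (pi / 2) * (z - \<i> * of_real s)) / 2))"
    using \<psi> by (intro continuous_intros ballI nz) simp_all
  then have i: "(\<lambda>s. of_real (\<psi> s) * (tan (of_real (pi / 2) * (z - \<i> * of_real s)) / 2)) integrable_on {-T..T}"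
    unfolding tan_def by (rule integrable_continuous_real)
  have "Re (strip_potential T \<psi> z) =
     integral {-T..T} (\<lambda>s. Re (of_real (\<psi> s) * (tan (of_real (pi / 2) * (z - \<i> * of_real s)) / 2)))"
    unfolding strip_potential_def
    using integral_linear[OF i bounded_linear_Re] by (simp add: o_def)
  also have "\<dots> = integral {-T..T} (\<lambda>s. \<psi> s * strip_kernel (Re z) (Im z - s))"
  proof (rule integral_cong)
    fix s
    show "Re (of_real (\<psi> s) * (tan (of_real (pi / 2) * (z - \<i> * of_real s)) / 2)) = \<psi> s * strip_kernel (Re z) (Im z - s)"
      using Re_half_tan[of "z - \<i> * of_real s"] by simp
  qed
  finally show ?thesis .
qed

text \<open>The origin of \<open>beta0\<close>: the left side is the derivative at z = 0 of the
  analytic kernel tan (pi * (z - i s) / 2) / 2. On the imaginary axis cos becomes cosh, and doubling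
  the argument gives the stated density.\<close>

lemma beta0_conv_cos:
  "of_real (pi / 4) / (cos (of_real (pi / 2) * (0 - \<i> * of_real s)))\<^sup>2 = complex_of_real (beta0 s)"
proof -
  have "cos (of_real (pi / 2) * (0 - \<i> * of_real s)) = cos (\<i> * complex_of_real (pi * s / 2))"
    by (subst cos_minus[symmetric]) (simp add: algebra_simps)
  also have "\<dots> = of_real (cosh (pi * s / 2))"
    by (simp add: complex_eq_iff Re_cos Im_cos cosh_field_def)
  finally have "of_real (pi / 4) / (cos (of_real (pi / 2) * (0 - \<i> * of_real s)))\<^sup>2
     = complex_of_real (pi / 4 / (cosh (pi * s / 2))\<^sup>2)"
    by simp
  also have "pi / 4 / (cosh (pi * s / 2))\<^sup>2 = beta0 s"
    using cosh_double_cosh[of "pi * s / 2"] by (simp add: beta0_def inverse_eq_divide)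
  finally show ?thesis .
qed

lemma strip_potential_derivative_0:
  assumes \<psi>: "continuous_on {-T..T} \<psi>"
  shows "(strip_potential T \<psi> has_field_derivative of_real (integral {-T..T} (\<lambda>s. beta0 s * \<psi> s))) (at 0)"
proof -
  have c: "continuous_on {-T..T} beta0"
    unfolding beta0_def by (intro continuous_intros) (auto simp: add_pos_pos less_imp_neq[symmetric])
  have i: "(\<lambda>s. beta0 s * \<psi> s) integrable_on {-T..T}"
    by (intro integrable_continuous_real continuous_intros c \<psi>)
  have "integral {-T..T} (\<lambda>s. of_real (\<psi> s) * (of_real (pi / 4) / (cos (of_real (pi / 2) * (0 - \<i> * of_real s)))\<^sup>2))
     = integral {-T..T} (\<lambda>s. complex_of_real (beta0 s * \<psi> s))"
    unfolding beta0_conv_cos by (simp add: mult.commute)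
  also have "\<dots> = of_real (integral {-T..T} (\<lambda>s. beta0 s * \<psi> s))"
    using integral_linear[OF i bounded_linear_of_real] by (simp add: o_def)
  finally have eq: "integral {-T..T} (\<lambda>s. of_real (\<psi> s) * (of_real (pi / 4) / (cos (of_real (pi / 2) * (0 - \<i> * of_real s)))\<^sup>2))
     = complex_of_real (integral {-T..T} (\<lambda>s. beta0 s * \<psi> s))" .
  have "\<bar>Re 0\<bar> < 1" by simp
  from strip_potential_derivative[OF \<psi> this] show ?thesis unfolding eq .
qed

text \<open>The Poisson average of a Lipschitz function near the line exceeds the boundary value by
  an error that vanishes as x tends to 1. The distance |y - s| is split as d +
  \<open>(y - s)\<^sup>2 / d\<close>: the first part meets total mass at most 1, the second the
  bound on the kernel times the squared distance.\<close>

lemma strip_kernel_average_le: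
  assumes x: "0 < x" "x < 1" and T: "0 \<le> T"
    and \<psi>: "continuous_on {-T..T} \<psi>" and L: "0 \<le> L"
    and lip: "\<And>s. \<psi> s \<le> \<psi>y + L * \<bar>y - s\<bar>" and \<psi>y: "0 \<le> \<psi>y"
  shows "integral {-T..T} (\<lambda>s. \<psi> s * strip_kernel x (y - s)) \<le> \<psi>y + L * (1 + T) * sqrt (sin (pi * x))"
proof -
  define S where "S = sin (pi * x)"
  have S: "S > 0" unfolding S_def using x by (intro sin_gt_zero) auto
  \<comment> \<open>This choice balances the two errors, which are of order L * d and L * T * S /
    d.\<close>
  define d where "d = sqrt S"
  have d: "d > 0" "d * d = S" using S by (auto simp: d_def)
  note c = strip_kernel_continuous[of x "{-T..T}" y]
  have ptw: "\<psi> s * strip_kernel x (y - s) \<le> (\<psi>y + L * d) * strip_kernel x (y - s) + L * (d / 2)" for s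
  proof -
    have k: "0 \<le> strip_kernel x (y - s)" using x by (intro strip_kernel_nonneg) auto
    have "0 \<le> (\<bar>y - s\<bar> - d)\<^sup>2 / d + \<bar>y - s\<bar>" using d by (intro add_nonneg_nonneg) auto
    also have "\<dots> = (y - s)\<^sup>2 / d - \<bar>y - s\<bar> + d"
      using d by (simp add: field_simps power2_eq_square)
    finally have "\<bar>y - s\<bar> \<le> d + (y - s)\<^sup>2 / d" by simp
    then have "\<psi> s \<le> \<psi>y + L * (d + (y - s)\<^sup>2 / d)"
      using lip[of s] L by (meson add_left_mono mult_left_mono order_trans)
    then have "\<psi> s * strip_kernel x (y - s) \<le> (\<psi>y + L * (d + (y - s)\<^sup>2 / d)) * strip_kernel x (y - s)"
      using k by (rule mult_right_mono)
    also have "\<dots> = (\<psi>y + L * d) * strip_kernel x (y - s) + L * ((strip_kernel x (y - s) * (y - s)\<^sup>2) / d)"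
      by (simp add: algebra_simps)
    also have "(strip_kernel x (y - s) * (y - s)\<^sup>2) / d \<le> (S / 2) / d"
      using strip_kernel_square_le[of x "y - s"] x d unfolding S_def by (intro divide_right_mono) auto
    also have "(S / 2) / d = d / 2" using d by (simp add: field_simps)
    finally show ?thesis using L by (simp add: mult_left_mono)
  qed
  have "integral {-T..T} (\<lambda>s. \<psi> s * strip_kernel x (y - s))
     \<le> integral {-T..T} (\<lambda>s. (\<psi>y + L * d) * strip_kernel x (y - s) + L * (d / 2))"
    using ptw x by (intro integral_le integrable_continuous_real continuous_intros c \<psi>) auto
  also have "\<dots> = (\<psi>y + L * d) * integral {-T..T} (\<lambda>s. strip_kernel x (y - s)) + 2 * T * (L * (d / 2))"
    using x T by (subst integral_add) (auto intro!: integrable_continuous_real continuous_intros c)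
  also have "\<dots> \<le> (\<psi>y + L * d) * 1 + 2 * T * (L * (d / 2))"
    using strip_kernel_integral_le_1[OF x T, of y] \<psi>y L d
    by (intro add_right_mono mult_left_mono) auto
  also have "\<dots> = \<psi>y + L * (1 + T) * d" by (simp add: algebra_simps)
  finally show ?thesis by (simp add: d_def S_def)
qed

text \<open>The maximum principle is applied to \<open>f z * exp (- g z)\<close>. On Re z = 0 the
  real part of \<open>g\<close> vanishes; on Re z = x it equals the exponent in the hypothesis on
  the right line. The resulting bound |f r| \<le> exp (Re (g r)) on the real axis is an equality at
  r = 0, so it passes to the slopes.\<close>

lemma strip_derivative_bound_step:
  fixes f f' :: "complex \<Rightarrow> complex"
  assumes df: "\<And>z. (f has_field_derivative f' z) (at z)"
    and bd: "\<And>z. 0 \<le> Re z \<Longrightarrow> Re z \<le> 1 \<Longrightarrow> norm (f z) \<le> K"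
    and left: "\<And>z. Re z = 0 \<Longrightarrow> norm (f z) \<le> 1" and f0: "f 0 = 1"
    and \<psi>: "continuous_on {-T..T} \<psi>" and T: "0 \<le> T" and x: "0 < x" "x < 1"
    and \<psi>pos: "\<And>s. 0 \<le> \<psi> s" and \<psi>le: "\<And>s. \<psi> s \<le> M"
    and right: "\<And>z. Re z = x \<Longrightarrow> norm (f z) \<le> exp (H * x - Re (strip_potential T \<psi> z) + \<eta>)"
    and \<eta>: "0 \<le> \<eta>"
  shows "Re (f' 0) \<le> H - integral {-T..T} (\<lambda>s. beta0 s * \<psi> s) + \<eta> / x"
proof -
  \<comment> \<open>The slope \<open>\<eta> / x\<close> makes the linear term pick up exactly
    \<open>\<eta>\<close> on the line Re z = x.\<close>
  define g where "g = (\<lambda>z. of_real (H + \<eta> / x) * z - strip_potential T \<psi> z)"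
  define G where "G = (\<lambda>z. f z * exp (- g z))"
  have Re_g: "Re (g z) = (H + \<eta> / x) * Re z - Re (strip_potential T \<psi> z)" for z
    by (simp add: g_def)
  have nG: "norm (G z) = norm (f z) * exp (- Re (g z))" for z
    by (simp add: G_def norm_mult)
  have dg: "(g has_field_derivative (of_real (H + \<eta> / x) - D)) (at z)"
    if "(strip_potential T \<psi> has_field_derivative D) (at z)" for z D
    unfolding g_def by (intro DERIV_diff DERIV_cmult_Id that)
  have g_diff: "g field_differentiable (at z)" if "\<bar>Re z\<bar> < 1" for z
    using dg[OF strip_potential_derivative[OF \<psi> that]] by (auto simp: field_differentiable_def)
  have G_diff: "G field_differentiable (at z)" if zz: "\<bar>Re z\<bar> < 1" for z
  proof -
    have "f field_differentiable (at z)" using df[of z] by (auto simp: field_differentiable_def)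
    moreover have "(\<lambda>z. exp (- g z)) field_differentiable (at z)"
    proof -
      obtain g' where "(g has_field_derivative g') (at z)"
        using g_diff[OF zz] by (auto simp: field_differentiable_def)
      from DERIV_chain2[OF DERIV_exp DERIV_minus[OF this]] show ?thesis
        by (auto simp: field_differentiable_def)
    qed
    ultimately show ?thesis unfolding G_def by (rule field_differentiable_mult)
  qed
  have pot0: "Re (strip_potential T \<psi> z) = 0" if "Re z = 0" for z
    using Re_strip_potential[OF \<psi>, of z] that by (simp add: strip_kernel_def)
  have pot_le: "Re (strip_potential T \<psi> z) \<le> M" if z: "0 \<le> Re z" "Re z \<le> x" for z
  proof (cases "Re z = 0")
    case True
    then show ?thesis using pot0[OF True] \<psi>pos[of 0] \<psi>le[of 0] by linarith
  next
    case False
    then have z': "0 < Re z" "Re z < 1" using z x by auto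
    have "integral {-T..T} (\<lambda>s. \<psi> s * strip_kernel (Re z) (Im z - s))
       \<le> M + 0 * (1 + T) * sqrt (sin (pi * Re z))"
      using \<psi>le \<psi>pos[of 0] by (intro strip_kernel_average_le[OF z' T \<psi>]) (auto intro: order_trans)
    then show ?thesis using Re_strip_potential[OF \<psi>, of z] z' by simp
  qed
  have bnd: "norm (G (of_real r)) \<le> 1" if r: "0 < r" "r < x" for r
  proof (rule strip_maximum_modulus[OF _ _ _ _ _ r])
    show "G holomorphic_on {z. 0 < Re z \<and> Re z < x}"
      using x by (auto simp: holomorphic_on_def intro!: field_differentiable_at_within G_diff)
    show "continuous_on {z. 0 \<le> Re z \<and> Re z \<le> x} G"
      using x by (intro continuous_at_imp_continuous_on ballI field_differentiable_imp_continuous_at G_diff) auto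
    fix z assume z: "0 \<le> Re z" "Re z \<le> x"
    have "- Re (g z) \<le> M + \<bar>H + \<eta> / x\<bar>"
    proof -
      have "\<bar>(H + \<eta> / x) * Re z\<bar> \<le> \<bar>H + \<eta> / x\<bar> * 1"
        unfolding abs_mult using z x by (intro mult_left_mono) auto
      then show ?thesis using pot_le[OF z] by (simp add: Re_g)
    qed
    then show "norm (G z) \<le> K * exp (M + \<bar>H + \<eta> / x\<bar>)"
      unfolding nG using bd[of z] z x by (intro mult_mono) (auto intro: order_trans[OF norm_ge_zero])
  next
    fix z :: complex assume z: "Re z = 0"
    then show "norm (G z) \<le> 1" using left[OF z] pot0[OF z] by (simp add: nG Re_g)
  next
    fix z :: complex assume z: "Re z = x"
    have "norm (G z) \<le> exp (H * x - Re (strip_potential T \<psi> z) + \<eta>) * exp (- Re (g z))"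
      unfolding nG using right[OF z] by (intro mult_right_mono) auto
    also have "\<dots> = 1" using x z by (simp add: Re_g exp_add[symmetric] algebra_simps)
    finally show "norm (G z) \<le> 1" .
  qed (use x in auto)
  \<comment> \<open>\<open>h\<close> vanishes at 0 and is nonpositive to the right of 0, so its
    derivative there cannot be positive.\<close>
  define h where "h = (\<lambda>r. Re (f (of_real r)) - exp (Re (g (of_real r))))"
  have h0: "h 0 = 0" using pot0[of 0] by (simp add: h_def f0 Re_g)
  have hneg: "h r \<le> 0" if r: "0 < r" "r < x" for r
  proof -
    have "norm (f (of_real r)) \<le> exp (Re (g (of_real r)))"
      using bnd[OF r] by (simp add: nG exp_minus field_simps)
    then show ?thesis using complex_Re_le_cmod[of "f (of_real r)"] by (simp add: h_def)
  qed
  have re: "((\<lambda>r. Re (F (of_real r))) has_real_derivative Re D) (at 0)"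
    if "(F has_field_derivative D) (at 0)" for F :: "complex \<Rightarrow> complex" and D
    using has_field_derivative_Re[OF has_vector_derivative_real_field[of F D 0 UNIV]] that by simp
  have "(h has_real_derivative (Re (f' 0) - exp (Re (g 0)) * (H + \<eta> / x - integral {-T..T} (\<lambda>s. beta0 s * \<psi> s)))) (at 0)"
    unfolding h_def
    using re[OF df[of 0]] DERIV_chain2[OF DERIV_exp re[OF dg[OF strip_potential_derivative_0[OF \<psi>]]]]
    by (intro DERIV_diff) (simp_all add: Re_complex_of_real)
  then have dh: "(h has_real_derivative (Re (f' 0) - (H + \<eta> / x - integral {-T..T} (\<lambda>s. beta0 s * \<psi> s)))) (at 0)"
    using pot0[of 0] by (simp add: Re_g)
  show ?thesis
  proof (rule ccontr)
    assume "\<not> ?thesis"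
    then have "0 < Re (f' 0) - (H + \<eta> / x - integral {-T..T} (\<lambda>s. beta0 s * \<psi> s))" by simp
    from DERIV_pos_inc_right[OF dh this] obtain d where d: "d > 0" "\<forall>h'>0. h' < d \<longrightarrow> h 0 < h (0 + h')" by blast
    define r where "r = min d x / 2"
    have "0 < r" "r < d" "r < x" using d x by (auto simp: r_def min_def)
    then show False using d hneg[of r] h0 by auto
  qed
qed

section \<open>From the cut-off estimate to integrals over the whole line\<close>

lemma beta0_pos: "0 < beta0 t"
  unfolding beta0_def by (intro mult_pos_pos) (auto simp: add_pos_pos)

lemma beta0_continuous: "continuous_on A beta0"
  unfolding beta0_def by (intro continuous_intros) (auto simp: add_pos_pos less_imp_neq[symmetric])

lemma ln_add_lipschitz:
  fixes a b e :: real
  assumes "0 \<le> a" "0 \<le> b" "0 < e"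
  shows "ln (a + e) \<le> ln (b + e) + \<bar>a - b\<bar> / e"
proof -
  have "ln (a + e) - ln (b + e) = ln ((a + e) / (b + e))"
    using assms by (simp add: ln_div)
  also have "\<dots> \<le> (a + e) / (b + e) - 1"
    using assms by (intro ln_le_minus_one) auto
  also have "\<dots> = (a - b) / (b + e)" using assms by (simp add: field_simps)
  also have "\<dots> \<le> \<bar>a - b\<bar> / e" using assms by (intro frac_le) auto
  finally show ?thesis by simp
qed

lemma ln_add_mono:
  fixes a b e :: real
  assumes "0 \<le> a" "a \<le> b" "0 < e"
  shows "ln (a + e) \<le> ln (b + e)"
  using assms by (intro ln_mono) auto

text \<open>Adding e inside the logarithms makes \<open>\<psi>\<close> nonnegative, bounded and
  Lipschitz with constant K / e, whatever zeros f has on Re z = 1. The previous estimate is used on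
  Re z = x, and x tends to 1 with T and e fixed.\<close>

lemma strip_derivative_bound_compact:
  fixes f f' :: "complex \<Rightarrow> complex"
  assumes df: "\<And>z. (f has_field_derivative f' z) (at z)"
    and bd: "\<And>z. 0 \<le> Re z \<Longrightarrow> Re z \<le> 1 \<Longrightarrow> norm (f z) \<le> K"
    and bd': "\<And>z. 0 \<le> Re z \<Longrightarrow> Re z \<le> 1 \<Longrightarrow> norm (f' z) \<le> K"
    and left: "\<And>z. Re z = 0 \<Longrightarrow> norm (f z) \<le> 1" and f0: "f 0 = 1"
    and right: "\<And>z. Re z = 1 \<Longrightarrow> norm (f z) \<le> B" and e: "0 < e" and T: "0 \<le> T"
  shows "Re (f' 0) \<le> ln (B + e) -
    integral {-T..T} (\<lambda>s. beta0 s * (ln (B + e) - ln (norm (f (Complex 1 s)) + e)))"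
proof -
  define H where "H = ln (B + e)"
  define \<psi> where "\<psi> s = H - ln (norm (f (Complex 1 s)) + e)" for s
  define L where "L = K / e"
  \<comment> \<open>The first term pays for replacing H by H * x in the exponent, the second for
    averaging \<open>\<psi>\<close> against the kernel. Both vanish at x = 1.\<close>
  define \<eta> where "\<eta> x = \<bar>H\<bar> * (1 - x) + L * (1 + T) * sqrt (sin (pi * x))" for x
  have K: "K \<ge> 1" using bd[of 0] f0 by simp
  have L: "L \<ge> 0" using K e by (simp add: L_def)
  have lip: "norm (f z - f w) \<le> K * norm (z - w)"
    if "0 \<le> Re z" "Re z \<le> 1" "0 \<le> Re w" "Re w \<le> 1" for z w
  proof (rule field_differentiable_bound[of "{z. 0 \<le> Re z} \<inter> {z. Re z \<le> 1}"])
    show "convex ({z. 0 \<le> Re z} \<inter> {z. Re z \<le> 1})"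
      by (intro convex_Int convex_halfspace_Re_ge convex_halfspace_Re_le)
    show "(f has_field_derivative f' z) (at z within {z. 0 \<le> Re z} \<inter> {z. Re z \<le> 1})" for z
      by (rule has_field_derivative_at_within[OF df])
  qed (use that bd' in auto)
  have fcont: "continuous_on A f" for A
    using df by (meson DERIV_isCont continuous_at_imp_continuous_on)
  have \<psi>c: "continuous_on A \<psi>" for A
    unfolding \<psi>_def Complex_eq using e
    by (intro continuous_intros continuous_on_compose2[OF fcont[of UNIV]])
      (auto simp: add_nonneg_pos less_imp_neq[symmetric])
  have \<psi>0: "0 \<le> \<psi> s" for s
    unfolding \<psi>_def H_def using ln_add_mono[OF norm_ge_zero right e, of "Complex 1 s"] by simp
  have \<psi>M: "\<psi> s \<le> H - ln e" for s
    unfolding \<psi>_def using ln_add_mono[OF order_refl norm_ge_zero e, of "f (Complex 1 s)"] by simp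
  have \<psi>L: "\<psi> s \<le> \<psi> y + L * \<bar>y - s\<bar>" for s y
  proof -
    have "\<bar>norm (f (Complex 1 y)) - norm (f (Complex 1 s))\<bar> \<le> norm (f (Complex 1 y) - f (Complex 1 s))"
      by (rule norm_triangle_ineq3)
    also have "\<dots> \<le> K * norm (Complex 1 y - Complex 1 s)" by (rule lip) auto
    also have "norm (Complex 1 y - Complex 1 s) = \<bar>y - s\<bar>"
      by (simp add: cmod_def)
    finally have "\<bar>norm (f (Complex 1 y)) - norm (f (Complex 1 s))\<bar> / e \<le> L * \<bar>y - s\<bar>"
      using e by (simp add: L_def divide_right_mono)
    then show ?thesis
      using ln_add_lipschitz[of "norm (f (Complex 1 y))" "norm (f (Complex 1 s))" e] e
      by (simp add: \<psi>_def)
  qed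
  have step: "Re (f' 0) \<le> H - integral {-T..T} (\<lambda>s. beta0 s * \<psi> s) + \<eta> x / x"
    if x: "0 < x" "x < 1" "K * (1 - x) \<le> e" for x
  proof (rule strip_derivative_bound_step[OF df bd left f0 \<psi>c T x(1,2) \<psi>0 \<psi>M])
    show \<eta>0: "0 \<le> \<eta> x"
      unfolding \<eta>_def using x L T
      by (intro add_nonneg_nonneg mult_nonneg_nonneg real_sqrt_ge_zero sin_ge_zero) auto
    fix z :: complex assume z: "Re z = x"
    \<comment> \<open>Moving from the line Re z = x to Re z = 1 costs at most K * (1 - x), which is
      absorbed by the e already present in the logarithm.\<close>
    have "norm (f z) \<le> norm (f (Complex 1 (Im z))) + norm (f z - f (Complex 1 (Im z)))"
      by (metis norm_triangle_sub)
    also have "norm (f z - f (Complex 1 (Im z))) \<le> K * norm (z - Complex 1 (Im z))"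
      using x z by (intro lip) auto
    also have "norm (z - Complex 1 (Im z)) = 1 - x"
      using x z by (simp add: cmod_def)
    finally have "norm (f z) \<le> norm (f (Complex 1 (Im z))) + e" using x by linarith
    also have "\<dots> = exp (H - \<psi> (Im z))"
      using e by (simp add: \<psi>_def add_nonneg_pos)
    also have "H - \<psi> (Im z) \<le> H * x - Re (strip_potential T \<psi> z) + \<eta> x"
    proof -
      have "Re (strip_potential T \<psi> z) \<le> \<psi> (Im z) + L * (1 + T) * sqrt (sin (pi * x))"
        using Re_strip_potential[OF \<psi>c, of z T] x z
          strip_kernel_average_le[OF x(1,2) T \<psi>c L \<psi>L \<psi>0, of "Im z"] by simp
      moreover have "H * (1 - x) \<le> \<bar>H\<bar> * (1 - x)" using x by (intro mult_right_mono) auto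
      ultimately show ?thesis unfolding \<eta>_def by (simp add: algebra_simps)
    qed
    finally show "norm (f z) \<le> exp (H * x - Re (strip_potential T \<psi> z) + \<eta> x)" by simp
  qed
  have "((\<lambda>x. H - integral {-T..T} (\<lambda>s. beta0 s * \<psi> s) + \<eta> x / x) \<longlongrightarrow>
     H - integral {-T..T} (\<lambda>s. beta0 s * \<psi> s) + (\<bar>H\<bar> * (1 - 1) + L * (1 + T) * sqrt (sin (pi * 1))) / 1) (at_left 1)"
    unfolding \<eta>_def by (intro tendsto_intros) auto
  moreover have "eventually (\<lambda>x. Re (f' 0) \<le> H - integral {-T..T} (\<lambda>s. beta0 s * \<psi> s) + \<eta> x / x) (at_left 1)"
  proof -
    have "eventually (\<lambda>x. x \<in> {max 0 (1 - e / K)<..<1}) (at_left (1::real))"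
      using e K by (intro eventually_at_left_real) auto
    then show ?thesis
    proof (rule eventually_mono)
      fix x assume x: "x \<in> {max 0 (1 - e / K)<..<1}"
      then have "1 - x \<le> e / K" by auto
      then have "K * (1 - x) \<le> e" using K by (simp add: field_simps)
      then show "Re (f' 0) \<le> H - integral {-T..T} (\<lambda>s. beta0 s * \<psi> s) + \<eta> x / x"
        using x by (intro step) auto
    qed
  qed
  ultimately have "Re (f' 0) \<le> H - integral {-T..T} (\<lambda>s. beta0 s * \<psi> s) + (\<bar>H\<bar> * (1 - 1) + L * (1 + T) * sqrt (sin (pi * 1))) / 1"
    by (rule tendsto_lowerbound) simp
  then show ?thesis by (simp add: \<psi>_def H_def)
qed

text \<open>The bound B makes the integrand nonnegative, so the cut-off is removed by monotone
  convergence over the intervals from - n to n.\<close>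

lemma strip_derivative_bound_eps:
  fixes f f' :: "complex \<Rightarrow> complex"
  assumes df: "\<And>z. (f has_field_derivative f' z) (at z)"
    and bd: "\<And>z. 0 \<le> Re z \<Longrightarrow> Re z \<le> 1 \<Longrightarrow> norm (f z) \<le> K"
    and bd': "\<And>z. 0 \<le> Re z \<Longrightarrow> Re z \<le> 1 \<Longrightarrow> norm (f' z) \<le> K"
    and left: "\<And>z. Re z = 0 \<Longrightarrow> norm (f z) \<le> 1" and f0: "f 0 = 1"
    and right: "\<And>z. Re z = 1 \<Longrightarrow> norm (f z) \<le> B" and e: "0 < e"
  shows "(\<integral>\<^sup>+s. ennreal (beta0 s * (ln (B + e) - ln (norm (f (Complex 1 s)) + e))) \<partial>lborel)
     \<le> ennreal (ln (B + e) - Re (f' 0))"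
proof -
  define h where "h s = beta0 s * (ln (B + e) - ln (norm (f (Complex 1 s)) + e))" for s
  have fcont: "continuous_on A f" for A
    using df by (meson DERIV_isCont continuous_at_imp_continuous_on)
  have hc: "continuous_on A h" for A
    unfolding h_def Complex_eq using e
    by (intro continuous_intros continuous_on_compose2[OF fcont[of UNIV]] beta0_continuous)
      (auto simp: add_nonneg_pos less_imp_neq[symmetric])
  have [measurable]: "h \<in> borel_measurable borel"
    by (rule borel_measurable_continuous_onI[OF hc])
  have h0: "0 \<le> h s" for s
    unfolding h_def using ln_add_mono[OF norm_ge_zero right e, of "Complex 1 s"] beta0_pos[of s]
    by (intro mult_nonneg_nonneg) auto
  have part: "(\<integral>\<^sup>+s. ennreal (h s) * indicator {-real n..real n} s \<partial>lborel) \<le> ennreal (ln (B + e) - Re (f' 0))" for n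
  proof -
    have "(h has_integral integral {-real n..real n} h) {-real n..real n}"
      by (intro integrable_integral integrable_continuous_real hc)
    from nn_integral_has_integral_lebesgue'[OF h0 this]
    have "(\<integral>\<^sup>+s. ennreal (h s) * indicator {-real n..real n} s \<partial>lborel) = ennreal (integral {-real n..real n} h)" .
    also have "\<dots> \<le> ennreal (ln (B + e) - Re (f' 0))"
      using strip_derivative_bound_compact[OF df bd bd' left f0 right e, of "real n"]
      by (intro ennreal_leI) (simp add: h_def[abs_def])
    finally show ?thesis .
  qed
  have mono: "incseq (\<lambda>n s. ennreal (h s) * indicator {-real n..real n} s)"
    by (intro incseq_SucI le_funI mult_left_mono) (auto simp: indicator_def)
  have sup: "(SUP n. ennreal (h s) * indicator {-real n..real n} s) = ennreal (h s)" for s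
  proof (rule antisym)
    show "(SUP n. ennreal (h s) * indicator {-real n..real n} s) \<le> ennreal (h s)"
      by (intro SUP_least) (auto simp: indicator_def)
    obtain n where "\<bar>s\<bar> \<le> real n" using real_arch_simple by blast
    then have "ennreal (h s) = ennreal (h s) * indicator {-real n..real n} s" by (auto simp: indicator_def abs_le_iff)
    then show "ennreal (h s) \<le> (SUP n. ennreal (h s) * indicator {-real n..real n} s)"
      by (metis (lifting) SUP_upper UNIV_I)
  qed
  have "(\<integral>\<^sup>+s. ennreal (h s) \<partial>lborel) = (\<integral>\<^sup>+s. (SUP n. ennreal (h s) * indicator {-real n..real n} s) \<partial>lborel)"
    by (simp only: sup)
  also have "\<dots> = (SUP n. \<integral>\<^sup>+s. ennreal (h s) * indicator {-real n..real n} s \<partial>lborel)"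
    using mono by (intro nn_integral_monotone_convergence_SUP) auto
  also have "\<dots> \<le> ennreal (ln (B + e) - Re (f' 0))"
    by (intro SUP_least part)
  finally show ?thesis by (simp add: h_def)
qed

lemma beta0_has_integral_1: "integrable lborel beta0" "(\<integral>t. beta0 t \<partial>lborel) = 1"
proof -
  have d: "((\<lambda>t. tanh (pi * t / 2) / 2) has_real_derivative beta0 t) (at t)" for t
  proof -
    have "((\<lambda>r. pi * r / 2) has_real_derivative pi / 2) (at t)"
      by (auto intro!: derivative_eq_intros)
    from DERIV_cdivide[OF has_field_derivative_tanh[OF _ this], of 2]
    have *: "((\<lambda>t. tanh (pi * t / 2) / 2) has_real_derivative (1 - (tanh (pi * t / 2))\<^sup>2) * (pi / 2) / 2) (at t)"
      by simp
    have "cosh (pi * t) + 1 = 2 * (cosh (pi * t / 2))\<^sup>2"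
      using cosh_double_cosh[of "pi * t / 2"] by simp
    moreover have "1 - (tanh (pi * t / 2))\<^sup>2 = 1 / (cosh (pi * t / 2))\<^sup>2"
    proof -
      have "1 - (tanh (pi * t / 2))\<^sup>2
        = ((cosh (pi * t / 2))\<^sup>2 - (sinh (pi * t / 2))\<^sup>2) / (cosh (pi * t / 2))\<^sup>2"
        by (simp add: tanh_def power_divide diff_divide_distrib)
      also have "(cosh (pi * t / 2))\<^sup>2 - (sinh (pi * t / 2))\<^sup>2 = 1"
        by (simp add: cosh_square_eq)
      finally show ?thesis .
    qed
    ultimately have "(1 - (tanh (pi * t / 2))\<^sup>2) * (pi / 2) / 2 = beta0 t"
      by (simp add: beta0_def inverse_eq_divide)
    with * show ?thesis by simp
  qed
  have top: "((\<lambda>t. tanh (pi * t / 2) / 2) \<longlongrightarrow> 1 / 2) at_top"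
  proof -
    have "filterlim (\<lambda>t. pi / 2 * t) at_top at_top"
      by (rule filterlim_tendsto_pos_mult_at_top[OF tendsto_const _ filterlim_ident]) simp
    then have "filterlim (\<lambda>t. pi * t / 2) at_top at_top" by simp
    from filterlim_compose[OF tanh_real_at_top this] show ?thesis
      by (intro tendsto_divide tendsto_const) auto
  qed
  have bot: "((\<lambda>t. tanh (pi * t / 2) / 2) \<longlongrightarrow> - 1 / 2) at_bot"
    using tendsto_minus[OF top] unfolding filterlim_at_bot_mirror by simp
  have c: "isCont beta0 t" for t
    using beta0_continuous[of UNIV] by (simp add: continuous_on_eq_continuous_at)
  note FTC = interval_integral_FTC_nonneg[of "-\<infinity>" "\<infinity>" "\<lambda>t. tanh (pi * t / 2) / 2" beta0 "-1/2" "1/2"]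
  have 1: "set_integrable lborel (einterval (-\<infinity>) \<infinity>) beta0"
    using d c beta0_pos top bot
    by (intro FTC) (auto simp: less_imp_le ereal_tendsto_simps1)
  have 2: "(LBINT x=-\<infinity>..\<infinity>. beta0 x) = 1/2 - (-1/2)"
    using d c beta0_pos top bot
    by (intro FTC) (auto simp: less_imp_le ereal_tendsto_simps1)
  show "integrable lborel beta0" using 1 by (simp add: set_integrable_def)
  show "(\<integral>t. beta0 t \<partial>lborel) = 1" using 2 by (simp add: interval_lebesgue_integral_def set_lebesgue_integral_def)
qed

text \<open>The version for a continuous bounded majorant \<open>u\<close> of ln |f|. Boundedness
  makes all integrals finite, so the limit e to 0 can be taken between real numbers.\<close>

lemma strip_derivative_le_integral:
  fixes f f' :: "complex \<Rightarrow> complex" and u :: "real \<Rightarrow> real"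
  assumes df: "\<And>z. (f has_field_derivative f' z) (at z)"
    and bd: "\<And>z. 0 \<le> Re z \<Longrightarrow> Re z \<le> 1 \<Longrightarrow> norm (f z) \<le> K"
    and bd': "\<And>z. 0 \<le> Re z \<Longrightarrow> Re z \<le> 1 \<Longrightarrow> norm (f' z) \<le> K"
    and left: "\<And>z. Re z = 0 \<Longrightarrow> norm (f z) \<le> 1" and f0: "f 0 = 1"
    and u: "continuous_on UNIV u" "\<And>s. \<bar>u s\<bar> \<le> U"
    and right: "\<And>s. norm (f (Complex 1 s)) \<le> exp (u s)"
  shows "Re (f' 0) \<le> (\<integral>t. beta0 t * u t \<partial>lborel)"
proof -
  have fcont: "continuous_on A f" for A
    using df by (meson DERIV_isCont continuous_at_imp_continuous_on)
  have [measurable]: "beta0 \<in> borel_measurable borel" "u \<in> borel_measurable borel"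
    by (auto intro!: borel_measurable_continuous_onI beta0_continuous u)
  have iu: "integrable lborel (\<lambda>t. beta0 t * u t)"
  proof (rule Bochner_Integration.integrable_bound)
    show "integrable lborel (\<lambda>t. U * beta0 t)"
      by (intro integrable_mult_right beta0_has_integral_1)
    show "AE t in lborel. norm (beta0 t * u t) \<le> norm (U * beta0 t)"
    proof (rule AE_I2)
      fix t
      have "beta0 t * \<bar>u t\<bar> \<le> beta0 t * \<bar>U\<bar>"
        using u(2)[of t] beta0_pos[of t] by (intro mult_left_mono) auto
      then show "norm (beta0 t * u t) \<le> norm (U * beta0 t)"
        using beta0_pos[of t] by (simp add: abs_mult mult.commute)
    qed
  qed simp
  have B: "norm (f z) \<le> exp U" if "Re z = 1" for z
  proof -
    have "norm (f z) \<le> exp (u (Im z))" using right[of "Im z"] that by (metis complex_surj)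
    also have "\<dots> \<le> exp U" using u(2)[of "Im z"] by simp
    finally show ?thesis .
  qed
  have key: "Re (f' 0) \<le> (\<integral>t. beta0 t * u t \<partial>lborel) + e * exp U" if e: "0 < e" for e :: real
  proof -
    define H where "H = ln (exp U + e)"
    define h where "h s = beta0 s * (H - ln (norm (f (Complex 1 s)) + e))" for s
    have hc: "continuous_on UNIV h"
      unfolding h_def Complex_eq using e
      by (intro continuous_intros continuous_on_compose2[OF fcont[of UNIV]] beta0_continuous)
        (auto simp: add_nonneg_pos less_imp_neq[symmetric])
    have [measurable]: "h \<in> borel_measurable borel"
      by (rule borel_measurable_continuous_onI[OF hc])
    have h0: "0 \<le> h s" for s
      unfolding h_def H_def using ln_add_mono[OF norm_ge_zero B e, of "Complex 1 s"] beta0_pos[of s]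
      by (intro mult_nonneg_nonneg) auto
    have nn: "(\<integral>\<^sup>+s. ennreal (h s) \<partial>lborel) \<le> ennreal (H - Re (f' 0))"
      using strip_derivative_bound_eps[OF df bd bd' left f0 B e] by (simp add: h_def H_def)
    have ih: "integrable lborel h"
      by (rule integrableI_nonneg) (use h0 nn in \<open>auto intro: le_less_trans\<close>)
    have low: "beta0 s * (H - u s - e * exp U) \<le> h s" for s
    proof -
      have "ln (norm (f (Complex 1 s)) + e) \<le> ln (exp (u s) + e)"
        using right e by (intro ln_add_mono) auto
      also have "exp (u s) + e \<le> exp (u s) * (1 + e * exp U)"
      proof -
        \<comment> \<open>The lower bound - U on \<open>u\<close> turns the additive e into a factor
          1 + e * exp U, and its logarithm is at most e * exp U uniformly in s.\<close>
        have "1 \<le> exp (u s) * exp U" using u(2)[of s] by (simp add: exp_add[symmetric] abs_le_iff)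
        then have "e * 1 \<le> e * (exp (u s) * exp U)" using e by (intro mult_left_mono) auto
        then show ?thesis by (simp add: algebra_simps)
      qed
      then have "ln (exp (u s) + e) \<le> ln (exp (u s) * (1 + e * exp U))"
        using e by (intro ln_mono) (auto intro: add_pos_pos)
      also have "\<dots> = u s + ln (1 + e * exp U)"
        by (subst ln_mult) (use add_pos_pos[OF zero_less_one mult_pos_pos[OF e exp_gt_zero, of U]] in \<open>auto simp del: exp_gt_zero\<close>)
      also have "ln (1 + e * exp U) \<le> e * exp U"
        using e by (intro ln_add_one_self_le_self) auto
      finally have "H - u s - e * exp U \<le> H - ln (norm (f (Complex 1 s)) + e)" by simp
      then show ?thesis unfolding h_def using beta0_pos[of s] by (intro mult_left_mono) auto
    qed
    have eq: "beta0 s * (H - u s - e * exp U) = (H - e * exp U) * beta0 s - beta0 s * u s" for s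
      by (simp add: algebra_simps)
    have "(\<integral>s. beta0 s * (H - u s - e * exp U) \<partial>lborel) \<le> (\<integral>s. h s \<partial>lborel)"
      unfolding eq by (intro integral_mono Bochner_Integration.integrable_diff integrable_mult_right beta0_has_integral_1 iu ih)
        (use low in \<open>simp add: eq\<close>)
    also have "\<dots> \<le> H - Re (f' 0)"
    proof -
      have "0 \<le> H - Re (f' 0)"
        using strip_derivative_bound_compact[OF df bd bd' left f0 B e, of 0] by (simp add: H_def)
      then show ?thesis
        using nn nn_integral_eq_integral[OF ih] h0 by (simp add: ennreal_le_iff)
    qed
    finally show ?thesis
      unfolding eq using beta0_has_integral_1 iu by simp
  qed
  have "((\<lambda>e. (\<integral>t. beta0 t * u t \<partial>lborel) + e * exp U) \<longlongrightarrow> (\<integral>t. beta0 t * u t \<partial>lborel) + 0 * exp U) (at_right 0)"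
    by (intro tendsto_intros)
  moreover have "eventually (\<lambda>e. Re (f' 0) \<le> (\<integral>t. beta0 t * u t \<partial>lborel) + e * exp U) (at_right 0)"
    using key by (auto simp: eventually_at_right_field intro: exI[of _ 1])
  ultimately have "Re (f' 0) \<le> (\<integral>t. beta0 t * u t \<partial>lborel) + 0 * exp U"
    by (rule tendsto_lowerbound) simp
  then show ?thesis by simp
qed

text \<open>The version for a majorant \<open>F\<close> of the squared modulus that may vanish. Here
  e runs through 1 / (n + 1) and Fatou's lemma replaces convergence of the integrals, so nothing has
  to be known about integrability of ln F. The first claim makes the real bound in the second
  nonnegative, so \<open>ennreal\<close> does not truncate it.\<close>

lemma strip_derivative_log_integral:
  fixes f f' :: "complex \<Rightarrow> complex" and F :: "real \<Rightarrow> real"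
  assumes df: "\<And>z. (f has_field_derivative f' z) (at z)"
    and bd: "\<And>z. 0 \<le> Re z \<Longrightarrow> Re z \<le> 1 \<Longrightarrow> norm (f z) \<le> K"
    and bd': "\<And>z. 0 \<le> Re z \<Longrightarrow> Re z \<le> 1 \<Longrightarrow> norm (f' z) \<le> K"
    and left: "\<And>z. Re z = 0 \<Longrightarrow> norm (f z) \<le> 1" and f0: "f 0 = 1"
    and F: "\<And>s. (norm (f (Complex 1 s)))\<^sup>2 \<le> F s" and F1: "\<And>s. F s \<le> 1"
  shows "Re (f' 0) \<le> 0"
    and "(\<integral>\<^sup>+t. e2ennreal (- (ereal (beta0 t) * elog (F t))) \<partial>lborel) \<le> ennreal (- 2 * Re (f' 0))"
proof -
  have F0: "0 \<le> F s" for s using F[of s] by (meson order_trans zero_le_power2)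
  have n1: "norm (f (Complex 1 s)) \<le> 1" for s
    using order_trans[OF F F1, of s] by (simp add: power_le_one_iff abs_square_le_1)
  show "Re (f' 0) \<le> 0"
    using strip_derivative_le_integral[OF df bd bd' left f0, of "\<lambda>_. 0" 0] n1 by simp
  have B: "norm (f z) \<le> 1" if "Re z = 1" for z
    using n1[of "Im z"] that by (metis complex_surj)
  have fcont: "continuous_on A f" for A
    using df by (meson DERIV_isCont continuous_at_imp_continuous_on)
  define e where "e n = inverse (real (Suc n))" for n
  have e: "e n > 0" for n by (simp add: e_def)
  have elim: "e \<longlonglongrightarrow> 0" unfolding e_def[abs_def] by (rule LIMSEQ_inverse_real_of_nat)
  define h where "h n s = beta0 s * (ln (1 + e n) - ln (norm (f (Complex 1 s)) + e n))" for n s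
  have hc: "continuous_on UNIV (h n)" for n
    unfolding h_def Complex_eq using e[of n]
    by (intro continuous_intros continuous_on_compose2[OF fcont[of UNIV]] beta0_continuous)
      (auto simp: add_nonneg_pos less_imp_neq[symmetric])
  have [measurable]: "h n \<in> borel_measurable borel" for n
    by (rule borel_measurable_continuous_onI[OF hc])
  have nn: "(\<integral>\<^sup>+s. ennreal (2 * h n s) \<partial>lborel) \<le> ennreal (2 * (ln (1 + e n) - Re (f' 0)))" for n
  proof -
    have "(\<integral>\<^sup>+s. ennreal (2 * h n s) \<partial>lborel) = 2 * (\<integral>\<^sup>+s. ennreal (h n s) \<partial>lborel)"
      by (subst nn_integral_cmult[symmetric]) (auto simp: ennreal_mult')
    also have "\<dots> \<le> 2 * ennreal (ln (1 + e n) - Re (f' 0))"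
      using strip_derivative_bound_eps[OF df bd bd' left f0 B e[of n]]
      by (intro mult_left_mono) (simp_all add: h_def)
    also have "\<dots> = ennreal (2 * (ln (1 + e n) - Re (f' 0)))"
      by (simp only: ennreal_mult' ennreal_numeral)
    finally show ?thesis .
  qed
  have ptw: "e2ennreal (- (ereal (beta0 t) * elog (F t))) \<le> liminf (\<lambda>n. ennreal (2 * h n t))" for t
  proof -
    \<comment> \<open>A minorant of the regularised integrand with sqrt F in place of |f|. It
      converges to the extended-real integrand at every t, diverging to infinity exactly where F
      vanishes.\<close>
    define w where "w n = beta0 t * (2 * (ln (1 + e n) - ln (sqrt (F t) + e n)))" for n
    have wh: "w n \<le> 2 * h n t" for n
    proof -
      have "norm (f (Complex 1 t)) \<le> sqrt (F t)" using F[of t] by (rule real_le_rsqrt)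
      then have "ln (norm (f (Complex 1 t)) + e n) \<le> ln (sqrt (F t) + e n)"
        using e by (intro ln_add_mono) auto
      then show ?thesis unfolding w_def h_def using beta0_pos[of t] by simp
    qed
    have "(\<lambda>n. ennreal (w n)) \<longlonglongrightarrow> e2ennreal (- (ereal (beta0 t) * elog (F t)))"
    proof (cases "F t = 0")
      case False
      then have Fp: "F t > 0" using F0[of t] by simp
      have "w \<longlonglongrightarrow> beta0 t * (2 * (ln (1 + 0) - ln (sqrt (F t) + 0)))"
        unfolding w_def[abs_def] using Fp by (intro tendsto_intros elim) auto
      also have "beta0 t * (2 * (ln (1 + 0) - ln (sqrt (F t) + 0))) = - (beta0 t * ln (F t))"
        using Fp by (simp add: ln_sqrt)
      finally have "(\<lambda>n. ennreal (w n)) \<longlonglongrightarrow> ennreal (- (beta0 t * ln (F t)))"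
        by (rule tendsto_ennrealI)
      also have "ennreal (- (beta0 t * ln (F t))) = e2ennreal (- (ereal (beta0 t) * elog (F t)))"
        using Fp by (simp add: elog_def e2ennreal_ereal)
      finally show ?thesis .
    next
      case True
      have "filterlim (\<lambda>n. inverse (e n)) at_top sequentially"
        unfolding e_def inverse_inverse_eq
        by (rule filterlim_compose[OF filterlim_real_sequentially filterlim_Suc])
      then have "filterlim (\<lambda>n. ln (inverse (e n))) at_top sequentially"
        by (rule filterlim_compose[OF ln_at_top])
      then have "filterlim (\<lambda>n. 2 * beta0 t * ln (inverse (e n))) at_top sequentially"
        using beta0_pos[of t] by (intro filterlim_tendsto_pos_mult_at_top[OF tendsto_const]) auto
      then have "filterlim w at_top sequentially"
      proof (rule filterlim_at_top_mono, intro always_eventually allI)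
        fix n
        show "2 * beta0 t * ln (inverse (e n)) \<le> w n"
        proof -
          have "0 \<le> beta0 t * ln (1 + e n)"
            using e[of n] beta0_pos[of t] by (intro mult_nonneg_nonneg ln_ge_zero) auto
          then show ?thesis using True e[of n] by (simp add: w_def ln_inverse algebra_simps)
        qed
      qed
      then have "(\<lambda>n. ennreal (w n)) \<longlonglongrightarrow> \<infinity>"
        by (simp add: ennreal_tendsto_top_eq_at_top)
      moreover have "e2ennreal (- (ereal (beta0 t) * elog (F t))) = \<infinity>"
        using True beta0_pos[of t] by (simp add: elog_def)
      ultimately show ?thesis by simp
    qed
    then have "e2ennreal (- (ereal (beta0 t) * elog (F t))) = liminf (\<lambda>n. ennreal (w n))"
      by (intro lim_imp_Liminf[symmetric]) auto
    also have "\<dots> \<le> liminf (\<lambda>n. ennreal (2 * h n t))"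
      using wh by (intro Liminf_mono always_eventually allI ennreal_leI) auto
    finally show ?thesis .
  qed
  have "(\<integral>\<^sup>+t. e2ennreal (- (ereal (beta0 t) * elog (F t))) \<partial>lborel)
     \<le> (\<integral>\<^sup>+t. liminf (\<lambda>n. ennreal (2 * h n t)) \<partial>lborel)"
    by (intro nn_integral_mono ptw)
  also have "\<dots> \<le> liminf (\<lambda>n. \<integral>\<^sup>+t. ennreal (2 * h n t) \<partial>lborel)"
    by (intro nn_integral_liminf) auto
  also have "\<dots> \<le> liminf (\<lambda>n. ennreal (2 * (ln (1 + e n) - Re (f' 0))))"
    by (intro Liminf_mono always_eventually allI nn)
  also have "\<dots> = ennreal (2 * (ln (1 + 0) - Re (f' 0)))"
    by (intro lim_imp_Liminf tendsto_ennrealI tendsto_intros elim) auto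
  finally show "(\<integral>\<^sup>+t. e2ennreal (- (ereal (beta0 t) * elog (F t))) \<partial>lborel) \<le> ennreal (- 2 * Re (f' 0))"
    by simp
qed

subsection \<open>Spectral theorem\<close>

definition cdot :: "complex ^ 'n::finite \<Rightarrow> complex ^ 'n \<Rightarrow> complex" where
  "cdot x y = (\<Sum>i\<in>UNIV. cnj (x $ i) * y $ i)"

lemma Re_cdot: "Re (cdot x y) = x \<bullet> y"
  by (simp add: cdot_def inner_vec_def inner_complex_def)

lemma cdot_self: "cdot x x = of_real ((norm x)\<^sup>2)"
proof -
  have "cdot x x = of_real (\<Sum>i\<in>UNIV. (norm (x $ i))\<^sup>2)"
    unfolding cdot_def of_real_sum by (intro sum.cong refl) (simp add: complex_norm_square[symmetric] mult.commute flip: of_real_power)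
  also have "(\<Sum>i\<in>UNIV. (norm (x $ i))\<^sup>2) = (norm x)\<^sup>2"
    by (simp add: norm_vec_def L2_set_def sum_nonneg)
  finally show ?thesis .
qed

lemma cdot_adj: "cdot x (A *v y) = cdot (adj A *v x) y"
  unfolding cdot_def matrix_vector_mult_def adj_def
  by (simp add: sum_distrib_left sum_distrib_right cnj_sum) (subst sum.swap, simp add: mult_ac)

lemma cdot_add_right: "cdot x (y + z) = cdot x y + cdot x z"
  and cdot_diff_right: "cdot x (y - z) = cdot x y - cdot x z"
  and cdot_scaleR_right: "cdot x (r *\<^sub>R y) = of_real r * cdot x y"
  and cdot_smult_right: "cdot x (c *s y) = c * cdot x y"
  and cdot_smult_left: "cdot (c *s x) y = cnj c * cdot x y"
  and cdot_commute: "cdot y x = cnj (cdot x y)"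
  by (simp_all add: cdot_def algebra_simps sum.distrib sum_subtractf sum_distrib_left cnj_sum scaleR_conv_of_real[where 'a = complex])

lemma cdot_sum_right: "cdot x (\<Sum>k\<in>K. f k) = (\<Sum>k\<in>K. cdot x (f k))"
  by (induction K rule: infinite_finite_induct) (simp_all add: cdot_add_right, simp_all add: cdot_def)

text \<open>Cauchy-Schwarz in its arithmetic-mean form. In the contraction proofs one half of the
  right side is absorbed on the left.\<close>

lemma norm_cdot_le: "2 * norm (cdot x y) \<le> (norm x)\<^sup>2 + (norm y)\<^sup>2"
proof -
  have "norm (cdot x y) \<le> (\<Sum>i\<in>UNIV. norm (x $ i) * norm (y $ i))"
    unfolding cdot_def by (rule order_trans[OF norm_sum]) (simp add: norm_mult)
  also have "2 * \<dots> \<le> (\<Sum>i\<in>UNIV. (norm (x $ i))\<^sup>2 + (norm (y $ i))\<^sup>2)"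
    unfolding sum_distrib_left by (intro sum_mono) (simp add: sum_squares_bound mult.assoc[symmetric])
  also have "\<dots> = (norm x)\<^sup>2 + (norm y)\<^sup>2"
    by (simp add: sum.distrib norm_vec_def L2_set_def sum_nonneg)
  finally show ?thesis by simp
qed

lemma psd_iff: "psd A \<longleftrightarrow> adj A = A \<and> (\<forall>x. 0 \<le> Re (cdot x (A *v x)))"
  by (simp add: psd_def cdot_def)

lemma adj_mult: "adj (A ** B) = adj B ** adj A"
  by (simp add: adj_def matrix_matrix_mult_def vec_eq_iff cnj_sum mult.commute)

lemma adj_adj [simp]: "adj (adj A) = A"
  by (simp add: adj_def vec_eq_iff)

lemma adj_mat_1 [simp]: "adj (mat 1) = mat 1"
  by (simp add: adj_def mat_def vec_eq_iff)

text \<open>The conjugated vectors indexed by K form the rows of a square matrix whose row k is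
  zero. The matrix is singular, and a kernel vector is orthogonal to all of them; no dimension count
  is made.\<close>

lemma ex_orthogonal_vector:
  fixes v :: "'n::finite \<Rightarrow> complex ^ 'n"
  assumes "k \<notin> K"
  shows "\<exists>x. x \<noteq> 0 \<and> (\<forall>i\<in>K. cdot (v i) x = 0)"
proof -
  define M where "M = (\<chi> i j. if i \<in> K then cnj (v i $ j) else 0)"
  have "row k M = 0" using assms by (simp add: row_def M_def vec_eq_iff)
  then have "det M = 0" by (rule det_zero_row)
  then have "\<not> invertible M" by (simp add: invertible_det_nz)
  then have "\<not> (\<exists>B. B ** M = mat 1)" by (simp add: invertible_left_inverse)
  then obtain x where x: "M *v x = 0" "x \<noteq> 0" by (auto simp: matrix_left_invertible_ker)
  have "cdot (v i) x = 0" if "i \<in> K" for i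
  proof -
    have "(M *v x) $ i = cdot (v i) x"
      using that by (simp add: M_def matrix_vector_mult_def cdot_def)
    then show ?thesis using x by simp
  qed
  with x show ?thesis by blast
qed

text \<open>The eigenvector is found where the quadratic form is maximal on the unit sphere of the subspace.\<close>

lemma hermitian_eigenvector_in_complement:
  fixes A :: "'n::finite cmat" and v :: "'n \<Rightarrow> complex ^ 'n"
  assumes A: "adj A = A" and k: "k \<notin> K"
    and eig: "\<And>i. i \<in> K \<Longrightarrow> A *v v i = m i *\<^sub>R v i"
  obtains x r where "norm x = 1" "A *v x = r *\<^sub>R x" "\<And>i. i \<in> K \<Longrightarrow> cdot (v i) x = 0"
proof -
  define S where "S = {x. \<forall>i\<in>K. cdot (v i) x = 0}"
  define q where "q x = x \<bullet> (A *v x)" for x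
  have sa: "x \<bullet> (A *v y) = (A *v x) \<bullet> y" for x y
    using cdot_adj[of x A y] A by (simp flip: Re_cdot)
  have matrix_scaleR: "A *v (c *\<^sub>R y) = c *\<^sub>R (A *v y)" for c y
    by (rule linear_scale[OF matrix_vector_mul_linear])
  have qc: "continuous_on X q" for X
    unfolding q_def by (intro continuous_intros matrix_vector_mul_bounded_linear[THEN linear_continuous_on])
  have S_add: "x + y \<in> S" and S_diff: "x - y \<in> S" if "x \<in> S" "y \<in> S" for x y
    using that by (auto simp: S_def cdot_add_right cdot_diff_right)
  have S_scale: "r *\<^sub>R x \<in> S" if "x \<in> S" for r x
    using that by (auto simp: S_def cdot_scaleR_right)
  have S_A: "A *v x \<in> S" if "x \<in> S" for x
  proof -
    have "cdot (v i) (A *v x) = 0" if i: "i \<in> K" for i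
    proof -
      have "cdot (v i) (A *v x) = cdot (m i *\<^sub>R v i) x" by (simp add: cdot_adj A eig[OF i])
      also have "\<dots> = of_real (m i) * cdot (v i) x"
        by (simp add: cdot_def sum_distrib_left scaleR_conv_of_real[where 'a = complex] mult_ac)
      finally show ?thesis using \<open>x \<in> S\<close> i by (simp add: S_def)
    qed
    then show ?thesis by (simp add: S_def)
  qed
  have "closed S"
  proof -
    have "S = (\<Inter>i\<in>K. {x. cdot (v i) x = 0})" by (auto simp: S_def)
    moreover have "closed {x. cdot (v i) x = 0}" for i
      unfolding cdot_def by (intro closed_Collect_eq continuous_intros)
    ultimately show ?thesis by auto
  qed
  then have comp: "compact (S \<inter> sphere 0 1)" by (intro closed_Int_compact) auto
  obtain x0 where x0: "x0 \<noteq> 0" "x0 \<in> S" using ex_orthogonal_vector[OF k, of v] by (auto simp: S_def)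
  have "(1 / norm x0) *\<^sub>R x0 \<in> S \<inter> sphere 0 1" using x0 S_scale by auto
  then obtain x where x: "x \<in> S" "norm x = 1" and max: "\<And>y. y \<in> S \<Longrightarrow> norm y = 1 \<Longrightarrow> q y \<le> q x"
    using continuous_attains_sup[OF comp _ qc] by force
  define r where "r = q x"
  have qscale: "q (c *\<^sub>R y) = c\<^sup>2 * q y" for c y
    by (simp add: q_def matrix_scaleR power2_eq_square)
  have qle: "q y \<le> r * (norm y)\<^sup>2" if "y \<in> S" for y
  proof (cases "y = 0")
    case False
    have "q ((1 / norm y) *\<^sub>R y) \<le> r"
      unfolding r_def using that False by (intro max S_scale) auto
    then show ?thesis using False by (simp add: qscale power_divide field_simps)
  qed (simp add: q_def)
  define w where "w = A *v x - r *\<^sub>R x"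
  have wS: "w \<in> S" unfolding w_def using x by (intro S_diff S_A S_scale)
  define b where "b = q w - r * (norm w)\<^sup>2"
  \<comment> \<open>The maximum of the Rayleigh quotient is tested along the residual
    \<open>w\<close>: the coefficient linear in t is twice the squared length of
    \<open>w\<close>.\<close>
  have poly: "2 * t * (norm w)\<^sup>2 + t\<^sup>2 * b \<le> 0" for t
  proof -
    have "q (x + t *\<^sub>R w) \<le> r * (norm (x + t *\<^sub>R w))\<^sup>2"
      using x wS by (intro qle S_add S_scale)
    moreover have "q (x + t *\<^sub>R w) = r + 2 * t * (w \<bullet> (A *v x)) + t\<^sup>2 * q w"
      using sa[of x w]
      by (simp add: q_def r_def matrix_vector_right_distrib matrix_scaleR inner_add_left inner_add_right
          power2_eq_square algebra_simps inner_commute)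
    moreover have "(norm (x + t *\<^sub>R w))\<^sup>2 = 1 + 2 * t * (w \<bullet> x) + t\<^sup>2 * (norm w)\<^sup>2"
      unfolding power2_norm_eq_inner using x by (simp add: inner_add_left inner_add_right power2_eq_square
          algebra_simps inner_commute norm_eq_1)
    ultimately have "2 * t * (w \<bullet> (A *v x) - r * (w \<bullet> x)) + t\<^sup>2 * b \<le> 0"
      by (simp add: b_def algebra_simps)
    moreover have "w \<bullet> (A *v x) - r * (w \<bullet> x) = (norm w)\<^sup>2"
      by (simp add: power2_norm_eq_inner w_def inner_diff_right inner_diff_left algebra_simps)
    ultimately show ?thesis by simp
  qed
  have "(norm w)\<^sup>2 = 0"
  proof (rule ccontr)
    define a where "a = (norm w)\<^sup>2"
    assume "(norm w)\<^sup>2 \<noteq> 0"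
    then have a: "a > 0" by (simp add: a_def)
    \<comment> \<open>Small enough that the quadratic term, at most t * |b| \<le> a per unit of t,
      cannot outweigh the linear coefficient 2 * a.\<close>
    define t where "t = a / (\<bar>b\<bar> + 1)"
    have t: "t > 0" using a by (simp add: t_def)
    have "t * (2 * a + t * b) \<le> 0" using poly[of t] by (simp add: a_def algebra_simps power2_eq_square)
    then have "2 * a + t * b \<le> 0" using t by (simp add: mult_le_0_iff)
    moreover have "t * b \<ge> - (t * \<bar>b\<bar>)" using t by (simp add: abs_if)
    moreover have "t * \<bar>b\<bar> \<le> a" using a by (simp add: t_def field_simps)
    ultimately show False using a by linarith
  qed
  then have "A *v x = r *\<^sub>R x" by (simp add: w_def)
  with x that show ?thesis by (auto simp: S_def)
qed

lemma hermitian_spectral: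
  fixes A :: "'n::finite cmat"
  assumes A: "adj A = A"
  obtains U d where "unitary_mat U" "A = U ** diag_mat (\<lambda>i. complex_of_real (d i)) ** adj U"
proof -
  have "\<exists>v m. (\<forall>i\<in>K. A *v v i = m i *\<^sub>R v i) \<and> (\<forall>i\<in>K. \<forall>j\<in>K. cdot (v i) (v j) = (if i = j then 1 else 0))"
    if "finite K" for K :: "'n set"
    using that
  proof (induction K)
    case (insert k K)
    then obtain v m where vm: "\<And>i. i \<in> K \<Longrightarrow> A *v v i = m i *\<^sub>R v i"
      "\<And>i j. i \<in> K \<Longrightarrow> j \<in> K \<Longrightarrow> cdot (v i) (v j) = (if i = j then 1 else 0)" by blast
    obtain x r where x: "norm x = 1" "A *v x = r *\<^sub>R x" "\<And>i. i \<in> K \<Longrightarrow> cdot (v i) x = 0"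
      using hermitian_eigenvector_in_complement[where v = v and m = m, OF A insert.hyps(2) vm(1)] by blast
    have x': "cdot x (v i) = 0" if "i \<in> K" for i
      using x(3)[OF that] by (subst cdot_commute) simp
    have "cdot x x = 1" by (simp add: cdot_self x)
    then show ?case
      using vm x x' insert.hyps(2) by (intro exI[of _ "v(k := x)"] exI[of _ "m(k := r)"]) auto
  qed simp
  from this[OF finite_class.finite_UNIV] obtain v m where
    "(\<forall>i\<in>UNIV. A *v v i = m i *\<^sub>R v i) \<and> (\<forall>i::'n\<in>UNIV. \<forall>j\<in>UNIV. cdot (v i) (v j) = (if i = j then 1 else 0))"
    by (elim exE)
  then have v: "A *v v i = m i *\<^sub>R v i" "cdot (v i) (v j) = (if i = j then 1 else 0)" for i j
    by auto
  define U where "U = (\<chi> i j. v j $ i)"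
  have "adj U ** U = mat 1"
    using v(2) by (simp add: U_def adj_def matrix_matrix_mult_def mat_def vec_eq_iff cdot_def)
  then have U: "unitary_mat U" unfolding unitary_mat_def by (metis matrix_left_right_inverse)
  have "A ** U = U ** diag_mat (\<lambda>i. complex_of_real (m i))"
  proof -
    have "(A ** U) $ i $ j = (A *v v j) $ i" for i j
      by (simp add: U_def matrix_matrix_mult_def matrix_vector_mult_def)
    then show ?thesis
      by (simp add: vec_eq_iff diag_mat_mult v U_def scaleR_conv_of_real[where 'a = complex] mult.commute)
  qed
  then have "A ** (U ** adj U) = U ** diag_mat (\<lambda>i. complex_of_real (m i)) ** adj U"
    by (simp add: matrix_mul_assoc)
  with U that show ?thesis by (simp add: unitary_mat_def)
qed

lemma psd_spectral:
  fixes A :: "'n::finite cmat"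
  assumes A: "psd A"
  obtains U d where "unitary_mat U" "A = U ** diag_mat (\<lambda>i. complex_of_real (d i)) ** adj U" "\<And>i. 0 \<le> d i"
proof -
  obtain U d where U: "unitary_mat U" and eq: "A = U ** diag_mat (\<lambda>i. complex_of_real (d i)) ** adj U"
    using hermitian_spectral[of A] A by (auto simp: psd_def)
  have "0 \<le> d i" for i
  proof -
    have "adj U ** A ** U = (adj U ** U) ** diag_mat (\<lambda>i. complex_of_real (d i)) ** (adj U ** U)"
      unfolding eq by (simp add: matrix_mul_assoc)
    then have "adj U ** A ** U = diag_mat (\<lambda>i. complex_of_real (d i))"
      using U by (simp add: unitary_mat_def)
    then have "d i = Re ((adj U ** (A ** U)) $ i $ i)" by (simp add: diag_mat_def matrix_mul_assoc)
    also have "(adj U ** (A ** U)) $ i $ i = cdot (column i U) (A *v column i U)"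
      by (simp add: matrix_matrix_mult_def cdot_def column_def adj_def matrix_vector_mult_def)
    finally show ?thesis using A by (simp add: psd_iff)
  qed
  with U eq that show ?thesis by blast
qed

subsection \<open>Contractions, functional calculus and fidelity\<close>

definition contraction :: "'n::finite cmat \<Rightarrow> bool" where
  "contraction C \<longleftrightarrow> (\<forall>x. norm (C *v x) \<le> norm x)"

lemma contraction_mult: "contraction A \<Longrightarrow> contraction B \<Longrightarrow> contraction (A ** B)"
  unfolding contraction_def by (metis matrix_vector_mul_assoc order_trans)

lemma contraction_mat_1: "contraction (mat 1)"
  by (simp add: contraction_def)

lemma norm_cdot_contraction_le:
  assumes "contraction C"
  shows "norm (cdot x (C *v y)) \<le> ((norm x)\<^sup>2 + (norm y)\<^sup>2) / 2"
proof -
  have "(norm (C *v y))\<^sup>2 \<le> (norm y)\<^sup>2"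
    using assms unfolding contraction_def by (intro power_mono norm_ge_zero) blast
  moreover have "2 * norm (cdot x (C *v y)) \<le> (norm x)\<^sup>2 + (norm (C *v y))\<^sup>2"
    by (rule norm_cdot_le)
  ultimately have "2 * norm (cdot x (C *v y)) \<le> (norm x)\<^sup>2 + (norm y)\<^sup>2"
    by linarith
  then show ?thesis by simp
qed

lemma norm_power2_eq_cdot: "complex_of_real ((norm (A *v x))\<^sup>2) = cdot x ((adj A ** A) *v x)"
  by (metis adj_adj cdot_adj cdot_self matrix_vector_mul_assoc)

lemma contraction_adj:
  assumes "contraction C"
  shows "contraction (adj C)"
  unfolding contraction_def
proof
  fix x
  define y where "y = adj C *v x"
  have "complex_of_real ((norm y)\<^sup>2) = cdot x (C *v y)"
    unfolding y_def norm_power2_eq_cdot by (simp add: matrix_vector_mul_assoc)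
  then have "(norm y)\<^sup>2 = norm (cdot x (C *v y))"
    by (metis abs_power2 norm_of_real real_norm_def)
  also have "\<dots> \<le> ((norm x)\<^sup>2 + (norm y)\<^sup>2) / 2"
    by (rule norm_cdot_contraction_le[OF assms])
  finally have "(norm y)\<^sup>2 \<le> (norm x)\<^sup>2" by simp
  then show "norm (adj C *v x) \<le> norm x" by (simp add: y_def)
qed

lemma contraction_if_adj_mult:
  assumes "contraction (adj W ** W)"
  shows "contraction W"
  unfolding contraction_def
proof
  fix x
  have "(norm (W *v x))\<^sup>2 = norm (cdot x ((adj W ** W) *v x))"
    by (metis abs_power2 norm_of_real norm_power2_eq_cdot real_norm_def)
  also have "\<dots> \<le> ((norm x)\<^sup>2 + (norm x)\<^sup>2) / 2"
    by (rule norm_cdot_contraction_le[OF assms])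
  finally show "norm (W *v x) \<le> norm x" by simp
qed

lemma contraction_unitary: "unitary_mat U \<Longrightarrow> contraction U"
  by (rule contraction_if_adj_mult) (simp add: unitary_mat_def contraction_mat_1)

lemma unitary_adj: "unitary_mat U \<Longrightarrow> unitary_mat (adj U)"
  by (simp add: unitary_mat_def)

lemma diag_mat_mult_diag_mat: "diag_mat d ** diag_mat e = diag_mat (\<lambda>i. d i * e i)"
  by (simp add: vec_eq_iff diag_mat_mult) (simp add: diag_mat_def)

lemma adj_diag_mat: "adj (diag_mat d) = diag_mat (\<lambda>i. cnj (d i))"
  by (simp add: adj_def diag_mat_def vec_eq_iff)

lemma contraction_diag_mat:
  assumes "\<And>i. norm (d i) \<le> 1"
  shows "contraction (diag_mat d)"
  unfolding contraction_def
proof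
  fix x :: "complex ^ 'a"
  have "(\<Sum>k\<in>UNIV. (if i = k then d i else 0) * x $ k) = d i * x $ i" for i
  proof -
    have "(\<Sum>k\<in>UNIV. (if i = k then d i else 0) * x $ k) = (\<Sum>k\<in>UNIV. if k = i then d i * x $ i else 0)"
      by (intro sum.cong) auto
    then show ?thesis by simp
  qed
  then have "(diag_mat d *v x) $ i = d i * x $ i" for i
    by (simp add: diag_mat_def matrix_vector_mult_def)
  then show "norm (diag_mat d *v x) \<le> norm x"
    using assms by (intro norm_le_componentwise_cart) (simp add: norm_mult mult_left_le_one_le)
qed

lemma spectral_mult:
  assumes "unitary_mat U"
  shows "(U ** diag_mat d ** adj U) ** (U ** diag_mat e ** adj U) = U ** diag_mat (\<lambda>i. d i * e i) ** adj U"
proof -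
  have "(U ** diag_mat d ** adj U) ** (U ** diag_mat e ** adj U) = U ** diag_mat d ** (adj U ** U) ** diag_mat e ** adj U"
    by (simp add: matrix_mul_assoc)
  also have "\<dots> = U ** (diag_mat d ** diag_mat e) ** adj U"
    using assms by (simp add: unitary_mat_def matrix_mul_assoc)
  finally show ?thesis by (simp add: diag_mat_mult_diag_mat)
qed

lemma adj_spectral: "adj (U ** diag_mat d ** adj U) = U ** diag_mat (\<lambda>i. cnj (d i)) ** adj U"
  by (simp add: adj_mult adj_diag_mat matrix_mul_assoc)

lemma spectral_entry:
  fixes U :: "'n::finite cmat"
  shows "(U ** diag_mat d ** adj U) $ i $ j = (\<Sum>k\<in>UNIV. U $ i $ k * d k * cnj (U $ j $ k))"
proof -
  have "(U ** diag_mat d ** adj U) $ i $ j = (\<Sum>k\<in>UNIV. (U ** diag_mat d) $ i $ k * adj U $ k $ j)"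
    by (simp add: matrix_matrix_mult_def)
  then show ?thesis by (simp add: diag_mat_mult adj_def)
qed

lemma contraction_spectral:
  "unitary_mat U \<Longrightarrow> (\<And>i. norm (d i) \<le> 1) \<Longrightarrow> contraction (U ** diag_mat d ** adj U)"
  by (intro contraction_mult contraction_diag_mat contraction_unitary unitary_adj)

lemma psd_adj_mult: "psd (adj X ** X)"
proof -
  have "0 \<le> Re (cdot x ((adj X ** X) *v x))" for x
    unfolding norm_power2_eq_cdot[symmetric] by simp
  then show ?thesis by (simp add: psd_iff adj_mult)
qed

lemma of_real_powr_eq:
  "0 \<le> x \<Longrightarrow> complex_of_real x powr z = (if x = 0 then 0 else exp (of_real (ln x) * z))"
  by (auto simp: powr_def Ln_of_real mult.commute)

lemma mpow_spectral:
  assumes "unitary_mat U" "A = U ** diag_mat (\<lambda>i. complex_of_real (d i)) ** adj U"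
  shows "mpow A z = U ** diag_mat (\<lambda>i. complex_of_real (d i) powr z) ** adj U"
  unfolding mpow_def by (rule fun_calc_eq[OF assms])

lemma mlog_spectral:
  assumes "unitary_mat U" "A = U ** diag_mat (\<lambda>i. complex_of_real (d i)) ** adj U"
  shows "mlog A = U ** diag_mat (\<lambda>i. complex_of_real (ln (d i))) ** adj U"
  unfolding mlog_def by (rule fun_calc_eq[OF assms])

lemma mpow_mult:
  assumes "psd A"
  shows "mpow A z ** mpow A w = mpow A (z + w)"
proof -
  obtain U d where U: "unitary_mat U" "A = U ** diag_mat (\<lambda>i. complex_of_real (d i)) ** adj U" "\<And>i. 0 \<le> d i"
    using psd_spectral[OF assms] by blast
  show ?thesis
    unfolding mpow_spectral[OF U(1,2)] spectral_mult[OF U(1)] powr_add ..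
qed

lemma mpow_1:
  assumes "psd A"
  shows "mpow A 1 = A"
proof -
  obtain U d where U: "unitary_mat U" "A = U ** diag_mat (\<lambda>i. complex_of_real (d i)) ** adj U" "\<And>i. 0 \<le> d i"
    using psd_spectral[OF assms] by blast
  have "complex_of_real (d i) powr 1 = of_real (d i)" for i
    using U(3)[of i] by (simp add: of_real_powr_eq exp_of_real)
  then show ?thesis using mpow_spectral[OF U(1,2), of 1] U(2) by simp
qed

lemma adj_mpow:
  assumes "psd A"
  shows "adj (mpow A z) = mpow A (cnj z)"
proof -
  obtain U d where U: "unitary_mat U" "A = U ** diag_mat (\<lambda>i. complex_of_real (d i)) ** adj U" "\<And>i. 0 \<le> d i"
    using psd_spectral[OF assms] by blast
  have "cnj (complex_of_real (d i) powr z) = of_real (d i) powr cnj z" for i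
    using U(3)[of i] by (simp add: of_real_powr_eq exp_cnj)
  then show ?thesis by (simp add: mpow_spectral[OF U(1,2)] adj_spectral)
qed

lemma contraction_mpow:
  assumes "psd A" "Re z = 0"
  shows "contraction (mpow A z)"
proof -
  obtain U d where U: "unitary_mat U" "A = U ** diag_mat (\<lambda>i. complex_of_real (d i)) ** adj U" "\<And>i. 0 \<le> d i"
    using psd_spectral[OF assms(1)] by blast
  show ?thesis
    unfolding mpow_spectral[OF U(1,2)] using U(3) assms(2)
    by (intro contraction_spectral U(1)) (simp add: of_real_powr_eq)
qed

lemma msqrt_mult_msqrt: "psd A \<Longrightarrow> msqrt A ** msqrt A = A"
  by (simp add: msqrt_def mpow_mult mpow_1)

lemma adj_msqrt: "psd A \<Longrightarrow> adj (msqrt A) = msqrt A"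
  by (simp add: msqrt_def adj_mpow)

lemma psd_msqrt:
  assumes "psd A"
  shows "psd (msqrt A)"
proof -
  have "psd (adj (mpow A (1/4)) ** mpow A (1/4))" by (rule psd_adj_mult)
  also have "adj (mpow A (1/4)) ** mpow A (1/4) = msqrt A"
    by (simp add: adj_mpow[OF assms] mpow_mult[OF assms] msqrt_def)
  finally show ?thesis .
qed

lemma mult_mpow_0: "psd A \<Longrightarrow> A ** mpow A 0 = A"
  using mpow_mult[of A 1 0] by (simp add: mpow_1)

lemma norm_diagonal_entry_contraction_le:
  fixes M :: "'n::finite cmat"
  assumes "contraction M"
  shows "norm (M $ i $ i) \<le> 1"
proof -
  have "(\<Sum>k\<in>UNIV. M $ j $ k * axis i 1 $ k) = M $ j $ i" for j
    by (simp add: axis_def if_distrib[of "\<lambda>x. _ * x"] cong: if_cong)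
  then have "cdot (axis i 1) (M *v axis i 1) = M $ i $ i"
    by (simp add: cdot_def matrix_vector_mult_def)
      (simp add: axis_def if_distrib[of cnj] if_distrib[of "\<lambda>x. x * _"] cong: if_cong)
  then show ?thesis using norm_cdot_contraction_le[OF assms, of "axis i 1" "axis i 1"] by simp
qed

text \<open>In an eigenbasis of \<open>S\<close> the trace is the sum of the eigenvalues weighted by
  diagonal entries of a contraction, and these have modulus at most 1.\<close>

lemma norm_trace_psd_mult_contraction_le:
  assumes S: "psd S" and C: "contraction C"
  shows "norm (trace (S ** C)) \<le> Re (trace S)"
proof -
  obtain U d where U: "unitary_mat U" "S = U ** diag_mat (\<lambda>i. complex_of_real (d i)) ** adj U" "\<And>i. 0 \<le> d i"
    using psd_spectral[OF S] by blast
  define D where "D = diag_mat (\<lambda>i. complex_of_real (d i))"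
  have tr: "trace (S ** X) = (\<Sum>i\<in>UNIV. of_real (d i) * (adj U ** X ** U) $ i $ i)" for X
  proof -
    have "trace (S ** X) = trace (U ** (D ** (adj U ** X)))"
      by (simp add: U(2) D_def matrix_mul_assoc)
    also have "\<dots> = trace (D ** (adj U ** X ** U))"
      by (subst trace_mul_sym) (simp add: matrix_mul_assoc)
    finally show ?thesis by (simp add: trace_def D_def mult_diag_mat)
  qed
  have c: "contraction (adj U ** C ** U)"
    by (rule contraction_mult[OF contraction_mult[OF contraction_unitary[OF unitary_adj[OF U(1)]] C] contraction_unitary[OF U(1)]])
  have "norm (trace (S ** C)) \<le> (\<Sum>i\<in>UNIV. d i)"
    unfolding tr using norm_diagonal_entry_contraction_le[OF c] U(3)
    by (intro order_trans[OF norm_sum] sum_mono) (simp add: norm_mult mult_left_le)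
  also have "\<dots> = Re (trace S)"
  proof -
    have "(adj U ** mat 1 ** U) $ i $ i = 1" for i
      using U(1) by (simp add: unitary_mat_def) (simp add: mat_def)
    then show ?thesis using tr[of "mat 1"] by simp
  qed
  finally show ?thesis .
qed

lemma trace_adj_mult_self:
  fixes X :: "'n::finite cmat"
  shows "trace (adj X ** X) = of_real (\<Sum>(i, j)\<in>UNIV. (norm (X $ i $ j))\<^sup>2)"
proof -
  have "trace (adj X ** X) = (\<Sum>j\<in>UNIV. \<Sum>i\<in>UNIV. cnj (X $ i $ j) * X $ i $ j)"
    by (simp add: trace_def matrix_matrix_mult_def adj_def)
  also have "\<dots> = (\<Sum>i\<in>UNIV. \<Sum>j\<in>UNIV. complex_of_real ((norm (X $ i $ j))\<^sup>2))"
    by (subst sum.swap) (simp add: complex_norm_square mult.commute del: of_real_power)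
  also have "\<dots> = (\<Sum>(i, j)\<in>UNIV \<times> UNIV. complex_of_real ((norm (X $ i $ j))\<^sup>2))"
    by (simp add: sum.cartesian_product)
  finally show ?thesis by (simp add: case_prod_beta)
qed

lemma trace_adj_mult_self_columns: "Re (trace (adj X ** X)) = (\<Sum>j\<in>UNIV. (norm (column j X))\<^sup>2)"
proof -
  have "trace (adj X ** X) = (\<Sum>j\<in>UNIV. cdot (column j X) (column j X))"
    by (simp add: trace_def matrix_matrix_mult_def adj_def cdot_def column_def)
  then show ?thesis by (simp add: cdot_self)
qed

lemma column_matrix_mult: "column j (A ** B) = A *v column j B"
  by (simp add: column_def matrix_matrix_mult_def matrix_vector_mult_def vec_eq_iff)

lemma trace_adj_mult_Cauchy_Schwarz:
  "(norm (trace (adj X ** Y)))\<^sup>2 \<le> Re (trace (adj X ** X)) * Re (trace (adj Y ** Y))"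
proof -
  have "trace (adj X ** Y) = (\<Sum>j\<in>UNIV. \<Sum>i\<in>UNIV. cnj (X $ i $ j) * Y $ i $ j)"
    by (simp add: trace_def matrix_matrix_mult_def adj_def)
  also have "\<dots> = (\<Sum>p\<in>UNIV. cnj (X $ fst p $ snd p) * Y $ fst p $ snd p)"
    by (subst sum.swap) (simp add: sum.cartesian_product case_prod_beta)
  finally have "norm (trace (adj X ** Y)) \<le> (\<Sum>p\<in>UNIV. norm (X $ fst p $ snd p) * norm (Y $ fst p $ snd p))"
    by (auto intro: order_trans[OF norm_sum] simp: norm_mult)
  then have "(norm (trace (adj X ** Y)))\<^sup>2 \<le> (\<Sum>p\<in>UNIV. norm (X $ fst p $ snd p) * norm (Y $ fst p $ snd p))\<^sup>2"
    by (intro power_mono) auto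
  also have "\<dots> \<le> (\<Sum>p\<in>UNIV. (norm (X $ fst p $ snd p))\<^sup>2) * (\<Sum>p\<in>UNIV. (norm (Y $ fst p $ snd p))\<^sup>2)"
    by (rule Cauchy_Schwarz_ineq_sum)
  finally show ?thesis
    unfolding trace_adj_mult_self case_prod_beta Re_complex_of_real .
qed

lemma adj_mult_self_eq_0:
  assumes "adj X ** X = 0"
  shows "X = 0"
proof -
  have "(\<Sum>j\<in>UNIV. (norm (column j X))\<^sup>2) = 0"
    using trace_adj_mult_self_columns[of X] assms by (simp add: trace_def)
  then have "column j X = 0" for j
    by (simp add: sum_nonneg_eq_0_iff)
  then show ?thesis by (simp add: vec_eq_iff column_def)
qed

lemma trace_adj_mult_contraction_le:
  assumes "contraction C"
  shows "Re (trace (adj (C ** X) ** (C ** X))) \<le> Re (trace (adj X ** X))"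
  unfolding trace_adj_mult_self_columns column_matrix_mult
  using assms by (intro sum_mono power_mono) (auto simp: contraction_def)

lemma matrix_diff_ldistrib: "A ** (B - C) = A ** B - A ** (C :: 'a::ring_1 ^ 'n ^ 'm)"
  and matrix_diff_rdistrib: "(B - C) ** D = B ** D - C ** (D :: 'a::ring_1 ^ 'p ^ 'n)"
  by (simp_all add: matrix_matrix_mult_def vec_eq_iff algebra_simps sum_subtractf)

lemma adj_diff: "adj (A - B) = adj A - adj B"
  by (simp add: adj_def vec_eq_iff)

text \<open>With T = adj X ** X the polar factor is \<open>X ** mpow T (- 1/2)\<close>, where the
  power is taken on the support; then adj W ** W is the support projection of T, so W is only a
  contraction in general. Recovering X from W requires that X annihilates the kernel of T.\<close>

lemma polar_decomposition:
  fixes X :: "'n::finite cmat"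
  obtains W where "contraction W" "X = W ** msqrt (adj X ** X)" "adj W ** X = msqrt (adj X ** X)"
proof -
  define T where "T = adj X ** X"
  have T: "psd T" unfolding T_def by (rule psd_adj_mult)
  define P R where "P = mpow T 0" and "R = mpow T (- 1/2)"
  define W where "W = X ** R"
  have adjW: "adj W = R ** adj X"
    by (simp add: W_def R_def adj_mult adj_mpow[OF T])
  have RT: "R ** T = msqrt T"
    using mpow_mult[OF T, of "- 1/2" 1] by (simp add: R_def mpow_1[OF T] msqrt_def)
  have "adj W ** W = R ** (adj X ** X) ** R"
    unfolding adjW unfolding W_def matrix_mul_assoc ..
  also have "\<dots> = P"
    by (simp add: T_def[symmetric] RT) (simp add: R_def P_def msqrt_def mpow_mult[OF T])
  finally have WW: "adj W ** W = P" .
  have "contraction P" unfolding P_def by (rule contraction_mpow[OF T]) simp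
  then have W: "contraction W" unfolding WW[symmetric] by (rule contraction_if_adj_mult)
  have adjP: "adj P = P" by (simp add: P_def adj_mpow[OF T])
  have TP: "T ** P = T" using mult_mpow_0[OF T] by (simp add: P_def)
  have adjD: "adj (X - X ** P) = adj X - P ** adj X"
    unfolding adj_diff adj_mult adjP ..
  \<comment> \<open>\<open>Y\<close> is the adjoint of X - X ** P. Since T ** P = T, it gives the
    same product with X and with X ** P, so \<open>adj (X - X ** P) ** (X - X ** P)\<close> is 0,
    which forces X = X ** P.\<close>
  define Y where "Y = adj X - P ** adj X"
  have YX: "Y ** X = T - P ** T"
    unfolding Y_def T_def matrix_diff_rdistrib by (simp only: matrix_mul_assoc)
  have "Y ** (X ** P) = (Y ** X) ** P" by (rule matrix_mul_assoc)
  also have "\<dots> = T ** P - P ** (T ** P)"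
    unfolding YX matrix_diff_rdistrib by (simp only: matrix_mul_assoc)
  finally have "Y ** (X ** P) = Y ** X" by (simp only: TP YX)
  then have "adj (X - X ** P) ** (X - X ** P) = 0"
    by (simp only: adjD Y_def[symmetric] matrix_diff_ldistrib diff_self)
  then have "X - X ** P = 0" by (rule adj_mult_self_eq_0)
  then have XP: "X ** P = X" by simp
  have "R ** msqrt T = P"
    by (simp add: R_def msqrt_def P_def mpow_mult[OF T])
  then have 1: "W ** msqrt T = X" by (simp only: W_def matrix_mul_assoc[symmetric] XP)
  have "adj W ** X = R ** (adj X ** X)" by (simp only: adjW matrix_mul_assoc)
  then have 2: "adj W ** X = msqrt T" by (simp only: T_def[symmetric] RT)
  show ?thesis using W 1[symmetric] 2 unfolding T_def by (rule that)
qed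

lemma norm_trace_mult_contraction_le_trace_norm:
  assumes "contraction C"
  shows "norm (trace (X ** C)) \<le> trace_norm X"
proof -
  obtain W where W: "contraction W" "X = W ** msqrt (adj X ** X)"
    by (rule polar_decomposition)
  have "trace (X ** C) = trace (W ** (msqrt (adj X ** X) ** C))"
    by (subst W(2)) (simp add: matrix_mul_assoc)
  also have "\<dots> = trace (msqrt (adj X ** X) ** (C ** W))"
    by (subst trace_mul_sym) (simp add: matrix_mul_assoc)
  also have "norm \<dots> \<le> Re (trace (msqrt (adj X ** X)))"
    using assms W(1) by (intro norm_trace_psd_mult_contraction_le psd_msqrt psd_adj_mult contraction_mult)
  finally show ?thesis by (simp add: trace_norm_def)
qed

lemma psd_mult_adj: "psd (G ** adj G)"
  using psd_adj_mult[of "adj G"] by simp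

text \<open>The easy half of Uhlmann's theorem. By the polar decomposition, G is the square root of
  G ** adj G times a contraction; cyclicity merges that contraction with V, and the trace norm
  bounds the result.\<close>

lemma norm_trace_le_fidelity:
  assumes V: "contraction V" and \<rho>: "psd \<rho>"
  shows "(norm (trace (V ** msqrt \<rho> ** G)))\<^sup>2 \<le> fidelity \<rho> (G ** adj G)"
proof -
  obtain W where W: "contraction W" "adj G = W ** msqrt (G ** adj G)"
    using polar_decomposition[of "adj G"] by auto
  have "adj (adj G) = msqrt (G ** adj G) ** adj W"
    by (subst W(2)) (simp add: adj_mult adj_msqrt psd_mult_adj)
  then have G: "G = msqrt (G ** adj G) ** adj W" by simp
  have "trace (V ** msqrt \<rho> ** G) = trace (V ** ((msqrt \<rho> ** msqrt (G ** adj G)) ** adj W))"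
    by (subst G) (simp add: matrix_mul_assoc)
  also have "\<dots> = trace ((msqrt \<rho> ** msqrt (G ** adj G)) ** (adj W ** V))"
    by (subst trace_mul_sym) (simp add: matrix_mul_assoc)
  also have "norm \<dots> \<le> trace_norm (msqrt \<rho> ** msqrt (G ** adj G))"
    using V W(1) by (intro norm_trace_mult_contraction_le_trace_norm contraction_mult contraction_adj)
  finally show ?thesis unfolding fidelity_def by (intro power_mono) auto
qed

text \<open>The polar contraction expresses the trace norm as a trace. Cauchy-Schwarz for the
  Hilbert-Schmidt product separates the two square roots, after the contraction has been grouped
  with the first one.\<close>

lemma fidelity_le_trace_mult_trace:
  assumes \<rho>: "psd \<rho>" and \<sigma>: "psd \<sigma>"
  shows "fidelity \<rho> \<sigma> \<le> Re (trace \<rho>) * Re (trace \<sigma>)"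
proof -
  define X where "X = msqrt \<rho> ** msqrt \<sigma>"
  obtain W where W: "contraction W" "adj W ** X = msqrt (adj X ** X)"
    by (rule polar_decomposition)
  define Y where "Y = adj W ** msqrt \<rho>"
  have "trace_norm X = Re (trace (adj (adj Y) ** msqrt \<sigma>))"
    unfolding trace_norm_def W(2)[symmetric] by (simp add: Y_def X_def matrix_mul_assoc)
  then have "fidelity \<rho> \<sigma> \<le> (norm (trace (adj (adj Y) ** msqrt \<sigma>)))\<^sup>2"
    unfolding fidelity_def X_def[symmetric]
    by (metis abs_Re_le_cmod power2_abs power_mono abs_ge_zero)
  also have "\<dots> \<le> Re (trace (adj (adj Y) ** adj Y)) * Re (trace (adj (msqrt \<sigma>) ** msqrt \<sigma>))"
    by (rule trace_adj_mult_Cauchy_Schwarz)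
  also have "trace (adj (adj Y) ** adj Y) = trace (adj Y ** Y)"
    by (subst trace_mul_sym) simp
  also have "Re \<dots> * Re (trace (adj (msqrt \<sigma>) ** msqrt \<sigma>)) \<le> Re (trace (adj (msqrt \<rho>) ** msqrt \<rho>)) * Re (trace (adj (msqrt \<sigma>) ** msqrt \<sigma>))"
    unfolding Y_def
    by (intro mult_right_mono trace_adj_mult_contraction_le contraction_adj W)
      (simp add: trace_adj_mult_self_columns sum_nonneg)
  finally show ?thesis by (simp add: adj_msqrt msqrt_mult_msqrt \<rho> \<sigma>)
qed

subsection \<open>Ampliations and partial traces\<close>

text \<open>The operator \<open>Y\<close> tensored with the identity of the discarded system; meaningful only for bijective \<open>g\<close>.\<close>

definition ampliate :: "('k \<Rightarrow> 'd \<Rightarrow> 'n) \<Rightarrow> 'k::finite cmat \<Rightarrow> 'n::finite cmat" where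
  "ampliate g Y = (\<chi> p q. let (k, d) = inv (\<lambda>(k, d). g k d) p; (l, e) = inv (\<lambda>(k, d). g k d) q
     in if d = e then Y $ k $ l else 0)"

abbreviation bij2 :: "('k \<Rightarrow> 'd \<Rightarrow> 'n) \<Rightarrow> bool" where
  "bij2 g \<equiv> bij (\<lambda>(k, d). g k d)"

lemma ampliate_entry:
  assumes "bij2 g"
  shows "ampliate g Y $ g k d $ g l e = (if d = e then Y $ k $ l else 0)"
proof -
  have "inv (\<lambda>(k, d). g k d) (g k d) = (k, d)" for k d
    using inv_f_f[OF bij_is_inj[OF assms], of "(k, d)"] by simp
  then show ?thesis by (simp add: ampliate_def)
qed

lemma sum_bij2:
  fixes g :: "'k::finite \<Rightarrow> 'd::finite \<Rightarrow> 'n::finite"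
  assumes "bij2 g"
  shows "(\<Sum>p\<in>UNIV. F p) = (\<Sum>k\<in>UNIV. \<Sum>d\<in>UNIV. F (g k d))"
proof -
  have "(\<Sum>p\<in>UNIV. F p) = (\<Sum>x\<in>UNIV. F ((\<lambda>(k, d). g k d) x))"
    using assms by (intro sum.reindex_bij_betw[symmetric]) auto
  also have "\<dots> = (\<Sum>(k, d)\<in>UNIV \<times> UNIV. F (g k d))" by (simp add: case_prod_beta)
  finally show ?thesis by (simp add: sum.cartesian_product)
qed

lemma bij2_eqI:
  fixes A B :: "'n::finite cmat" and g :: "'k \<Rightarrow> 'd \<Rightarrow> 'n"
  assumes g: "bij2 g" and eq: "\<And>k d l e. A $ g k d $ g l e = B $ g k d $ g l e"
  shows "A = B"
proof -
  have ex: "\<exists>k d. p = g k d" for p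
    using bij_is_surj[OF g] by (metis case_prod_beta surjD)
  have "A $ p $ q = B $ p $ q" for p q
    using ex[of p] ex[of q] eq by auto
  then show ?thesis by (simp add: vec_eq_iff)
qed

lemma ampliate_mult:
  fixes g :: "'k::finite \<Rightarrow> 'd::finite \<Rightarrow> 'n::finite"
  assumes g: "bij2 g"
  shows "ampliate g (A ** B) = ampliate g A ** ampliate g B"
proof (rule bij2_eqI[OF g])
  fix k d l e
  have "(ampliate g A ** ampliate g B) $ g k d $ g l e =
      (\<Sum>m\<in>UNIV. \<Sum>f\<in>UNIV. if f = d then (if d = e then A $ k $ m * B $ m $ l else 0) else 0)"
    unfolding matrix_matrix_mult_def vec_lambda_beta sum_bij2[OF g] ampliate_entry[OF g]
    by (intro sum.cong refl) auto
  then show "ampliate g (A ** B) $ g k d $ g l e = (ampliate g A ** ampliate g B) $ g k d $ g l e"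
    by (simp add: ampliate_entry[OF g] matrix_matrix_mult_def)
qed

lemma ampliate_mat_1:
  assumes g: "bij2 g"
  shows "ampliate g (mat 1) = mat 1"
proof (rule bij2_eqI[OF g])
  fix k d l e
  have "g k d = g l e \<longleftrightarrow> k = l \<and> d = e"
    using bij_is_inj[OF g] by (auto dest: injD[of _ "(k, d)" "(l, e)"])
  then show "ampliate g (mat 1) $ g k d $ g l e = mat 1 $ g k d $ g l e"
    by (simp add: ampliate_entry[OF g] mat_def)
qed

lemma adj_ampliate: "adj (ampliate g Y) = ampliate g (adj Y)"
  by (auto simp: adj_def ampliate_def vec_eq_iff Let_def case_prod_beta)

text \<open>Ampliation is the adjoint of the partial trace under the trace pairing. Positivity of
  marginals, inclusion of supports and the identification of iterated marginals are deduced from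
  this instead of from entries.\<close>

lemma trace_mult_ampliate:
  fixes g :: "'k::finite \<Rightarrow> 'd::finite \<Rightarrow> 'n::finite"
  assumes g: "bij2 g"
  shows "trace (\<rho> ** ampliate g Y) = trace (partial_trace g \<rho> ** Y)"
proof -
  have "trace (\<rho> ** ampliate g Y) =
     (\<Sum>k\<in>UNIV. \<Sum>d\<in>UNIV. \<Sum>l\<in>UNIV. \<Sum>e\<in>UNIV. if e = d then \<rho> $ g k d $ g l d * Y $ l $ k else 0)"
    unfolding trace_def matrix_matrix_mult_def vec_lambda_beta sum_bij2[OF g] ampliate_entry[OF g]
    by (intro sum.cong refl) auto
  also have "\<dots> = (\<Sum>k\<in>UNIV. \<Sum>l\<in>UNIV. \<Sum>d\<in>UNIV. \<rho> $ g k d $ g l d * Y $ l $ k)"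
    by (intro sum.cong refl) (simp, rule sum.swap)
  finally show ?thesis
    by (simp add: trace_def matrix_matrix_mult_def partial_trace_def sum_distrib_right)
qed

lemma trace_partial_trace:
  fixes g :: "'k::finite \<Rightarrow> 'd::finite \<Rightarrow> 'n::finite"
  assumes g: "bij2 g"
  shows "trace (partial_trace g \<rho>) = trace \<rho>"
  using trace_mult_ampliate[OF g, of \<rho> "mat 1"] by (simp add: ampliate_mat_1[OF g])

lemma contraction_ampliate:
  fixes g :: "'k::finite \<Rightarrow> 'd::finite \<Rightarrow> 'n::finite"
  assumes g: "bij2 g" and C: "contraction C"
  shows "contraction (ampliate g C)"
  unfolding contraction_def
proof
  fix x :: "complex ^ 'n"
  define y where "y d = (\<chi> k. x $ g k d)" for d
  have ent: "(ampliate g C *v x) $ g k d = (C *v y d) $ k" for k d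
  proof -
    have "(ampliate g C *v x) $ g k d = (\<Sum>l\<in>UNIV. \<Sum>e\<in>UNIV. if e = d then C $ k $ l * x $ g l d else 0)"
      unfolding matrix_vector_mult_def vec_lambda_beta sum_bij2[OF g] ampliate_entry[OF g]
      by (intro sum.cong refl) auto
    then show ?thesis by (simp add: matrix_vector_mult_def y_def)
  qed
  have sq: "(norm v)\<^sup>2 = (\<Sum>i\<in>UNIV. (norm (v $ i))\<^sup>2)" for v :: "complex ^ 'i::finite"
    by (simp add: norm_vec_def L2_set_def sum_nonneg)
  have "(norm (ampliate g C *v x))\<^sup>2 = (\<Sum>k\<in>UNIV. \<Sum>d\<in>UNIV. (norm ((C *v y d) $ k))\<^sup>2)"
    unfolding sq sum_bij2[OF g] ent ..
  also have "\<dots> = (\<Sum>d\<in>UNIV. (norm (C *v y d))\<^sup>2)"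
    unfolding sq by (rule sum.swap)
  also have "\<dots> \<le> (\<Sum>d\<in>UNIV. (norm (y d))\<^sup>2)"
    using C unfolding contraction_def by (intro sum_mono power_mono norm_ge_zero) blast
  also have "\<dots> = (\<Sum>k\<in>UNIV. \<Sum>d\<in>UNIV. (norm (x $ g k d))\<^sup>2)"
    unfolding sq y_def vec_lambda_beta by (rule sum.swap)
  also have "\<dots> = (norm x)\<^sup>2" unfolding sq sum_bij2[OF g] ..
  finally show "norm (ampliate g C *v x) \<le> norm x" by (rule power2_le_imp_le) simp
qed

lemma psd_partial_trace:
  fixes g :: "'k::finite \<Rightarrow> 'd::finite \<Rightarrow> 'n::finite"
  assumes g: "bij2 g" and \<rho>: "psd \<rho>"
  shows "psd (partial_trace g \<rho>)"
  unfolding psd_iff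
proof (intro conjI allI)
  have "adj \<rho> $ p $ q = \<rho> $ p $ q" for p q
    using \<rho> by (simp add: psd_def)
  then show "adj (partial_trace g \<rho>) = partial_trace g \<rho>"
    by (simp add: adj_def partial_trace_def vec_eq_iff cnj_sum)
  fix x :: "complex ^ 'k"
  \<comment> \<open>A matrix with a single nonzero row, so that \<open>adj B ** B\<close> is the
    rank-one operator of x; \<open>undefined\<close> only names some row. The quadratic form becomes
    a trace against \<open>\<rho>\<close>, and after cyclic rotation a squared Hilbert-Schmidt
    norm.\<close>
  define B :: "'k cmat" where "B = (\<chi> k l. if k = undefined then cnj (x $ l) else 0)"
  define S F where "S = msqrt \<rho>" and "F = ampliate g B"
  have BB: "(adj B ** B) $ k $ l = x $ k * cnj (x $ l)" for k l
  proof -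
    have "(adj B ** B) $ k $ l = (\<Sum>m::'k\<in>UNIV. if m = undefined then x $ k * cnj (x $ l) else 0)"
      unfolding matrix_matrix_mult_def vec_lambda_beta by (intro sum.cong refl) (simp add: B_def adj_def)
    then show ?thesis by simp
  qed
  have "cdot x (partial_trace g \<rho> *v x) = trace (partial_trace g \<rho> ** (adj B ** B))"
    unfolding trace_def matrix_matrix_mult_def[of "partial_trace g \<rho>"] vec_lambda_beta BB
    by (simp add: cdot_def matrix_vector_mult_def sum_distrib_left mult_ac)
  also have "\<dots> = trace (\<rho> ** (adj F ** F))"
    by (simp add: trace_mult_ampliate[OF g, symmetric] ampliate_mult[OF g] F_def adj_ampliate)
  also have "\<rho> ** (adj F ** F) = (S ** (S ** adj F)) ** F"
    by (simp add: S_def matrix_mul_assoc msqrt_mult_msqrt[OF \<rho>])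
  also have "trace \<dots> = trace (adj (S ** adj F) ** (S ** adj F))"
    by (subst trace_mul_sym) (simp add: S_def adj_mult adj_msqrt[OF \<rho>] matrix_mul_assoc)
  finally show "0 \<le> Re (cdot x (partial_trace g \<rho> *v x))"
    by (simp add: trace_adj_mult_self_columns sum_nonneg)
qed

lemma ampliate_diff: "ampliate g (A - B) = ampliate g A - ampliate g B"
  by (simp add: ampliate_def vec_eq_iff Let_def case_prod_beta)

text \<open>The support of a state lies in that of its marginal tensored with the identity. The
  complementary projection \<open>Q\<close> has trace 0 against \<open>\<rho>\<close>, because its
  marginal counterpart annihilates the marginal; hence \<open>msqrt \<rho> ** Q\<close> has zero
  Hilbert-Schmidt norm. This lets powers at exponent 0, which are only projections, act as the
  identity on \<open>\<rho>\<close>.\<close>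

lemma mult_ampliate_support:
  fixes g :: "'k::finite \<Rightarrow> 'd::finite \<Rightarrow> 'n::finite"
  assumes g: "bij2 g" and \<rho>: "psd \<rho>"
  shows "\<rho> ** ampliate g (mpow (partial_trace g \<rho>) 0) = \<rho>"
    and "ampliate g (mpow (partial_trace g \<rho>) 0) ** \<rho> = \<rho>"
proof -
  define \<sigma> where "\<sigma> = partial_trace g \<rho>"
  have \<sigma>: "psd \<sigma>" unfolding \<sigma>_def by (rule psd_partial_trace[OF g \<rho>])
  define Q where "Q = ampliate g (mat 1 - mpow \<sigma> 0)"
  have Q1: "Q = mat 1 - ampliate g (mpow \<sigma> 0)"
    by (simp add: Q_def ampliate_diff ampliate_mat_1[OF g])
  have "adj (mat 1 - mpow \<sigma> 0) = mat 1 - mpow \<sigma> 0"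
    using adj_mpow[OF \<sigma>, of 0] by (simp add: adj_diff)
  then have Qa: "adj Q = Q" by (simp add: Q_def adj_ampliate)
  have "(mat 1 - mpow \<sigma> 0) ** (mat 1 - mpow \<sigma> 0) = mat 1 - mpow \<sigma> 0"
    using mpow_mult[OF \<sigma>, of 0 0] by (simp add: matrix_diff_ldistrib matrix_diff_rdistrib)
  then have Q2: "Q ** Q = Q" by (simp add: Q_def ampliate_mult[OF g, symmetric])
  have "trace (\<rho> ** Q) = trace (\<sigma> ** (mat 1 - mpow \<sigma> 0))"
    unfolding Q_def \<sigma>_def by (rule trace_mult_ampliate[OF g])
  also have "\<dots> = 0" by (simp add: matrix_diff_ldistrib mult_mpow_0[OF \<sigma>] trace_def)
  finally have tr: "trace (\<rho> ** Q) = 0" .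
  have "trace (adj (msqrt \<rho> ** Q) ** (msqrt \<rho> ** Q)) = trace (Q ** ((msqrt \<rho> ** msqrt \<rho>) ** Q))"
    by (simp add: adj_mult Qa adj_msqrt[OF \<rho>] matrix_mul_assoc)
  also have "\<dots> = trace (\<rho> ** (Q ** Q))"
    by (subst trace_mul_sym) (simp add: msqrt_mult_msqrt[OF \<rho>] matrix_mul_assoc)
  finally have "(\<Sum>j\<in>UNIV. (norm (column j (msqrt \<rho> ** Q)))\<^sup>2) = 0"
    using trace_adj_mult_self_columns[of "msqrt \<rho> ** Q"] by (simp add: Q2 tr)
  then have "column j (msqrt \<rho> ** Q) = 0" for j by (simp add: sum_nonneg_eq_0_iff)
  then have "msqrt \<rho> ** Q = 0" by (simp add: vec_eq_iff column_def)
  then have "msqrt \<rho> ** (msqrt \<rho> ** Q) = 0" by (simp add: matrix_matrix_mult_def vec_eq_iff)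
  then have "\<rho> ** Q = 0" by (simp add: matrix_mul_assoc msqrt_mult_msqrt[OF \<rho>])
  then show *: "\<rho> ** ampliate g (mpow (partial_trace g \<rho>) 0) = \<rho>"
    by (simp add: Q1 matrix_diff_ldistrib \<sigma>_def)
  have "adj (\<rho> ** ampliate g (mpow \<sigma> 0)) = adj \<rho>" using * by (simp add: \<sigma>_def)
  then show "ampliate g (mpow (partial_trace g \<rho>) 0) ** \<rho> = \<rho>"
    using \<rho> adj_mpow[OF \<sigma>, of 0] by (simp add: adj_mult adj_ampliate psd_def \<sigma>_def)
qed

subsection \<open>Exponential sums\<close>

text \<open>Real exponents make these functions bounded on vertical strips.\<close>

inductive expsum :: "(complex \<Rightarrow> complex) \<Rightarrow> bool" where
  exp: "expsum (\<lambda>z. c * exp (of_real l * z))"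
| add: "expsum f \<Longrightarrow> expsum g \<Longrightarrow> expsum (\<lambda>z. f z + g z)"

lemma expsum_const: "expsum (\<lambda>z. c)"
  using expsum.exp[of c 0] by simp

lemma expsum_sum: "(\<And>k. k \<in> K \<Longrightarrow> expsum (f k)) \<Longrightarrow> expsum (\<lambda>z. \<Sum>k\<in>K. f k z)"
  by (induction K rule: infinite_finite_induct) (auto intro: expsum_const expsum.add)

lemma expsum_mult:
  assumes "expsum f" "expsum g"
  shows "expsum (\<lambda>z. f z * g z)"
  using assms(1)
proof induction
  case (exp c l)
  from assms(2) show ?case
  proof induction
    case (exp c' l')
    have "(\<lambda>z. c * exp (of_real l * z) * (c' * exp (of_real l' * z))) = (\<lambda>z. (c * c') * exp (of_real (l + l') * z))"
      by (simp add: fun_eq_iff algebra_simps exp_add)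
    then show ?case using expsum.exp[of "c * c'" "l + l'"] by simp
  next
    case (add f g)
    then show ?case using expsum.add[OF add.IH] by (simp add: algebra_simps)
  qed
next
  case (add f h)
  then show ?case using expsum.add[OF add.IH] by (simp add: algebra_simps)
qed

lemma expsum_has_derivative:
  "expsum f \<Longrightarrow> \<exists>f'. expsum f' \<and> (\<forall>z. (f has_field_derivative f' z) (at z))"
proof (induction rule: expsum.induct)
  case (exp c l)
  have "((\<lambda>z. c * exp (of_real l * z)) has_field_derivative c * of_real l * exp (of_real l * z)) (at z)" for z
    by (auto intro!: derivative_eq_intros)
  then show ?case using expsum.exp[of "c * of_real l" l] by blast
next
  case (add f g)
  then obtain f' g' where "expsum f'" "expsum g'" "\<And>z. (f has_field_derivative f' z) (at z)"
    "\<And>z. (g has_field_derivative g' z) (at z)" by blast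
  then show ?case by (intro exI[of _ "\<lambda>z. f' z + g' z"]) (auto intro: expsum.add DERIV_add)
qed

lemma expsum_bounded:
  "expsum f \<Longrightarrow> \<exists>K. \<forall>z. 0 \<le> Re z \<longrightarrow> Re z \<le> 1 \<longrightarrow> norm (f z) \<le> K"
proof (induction rule: expsum.induct)
  case (exp c l)
  have "norm (c * exp (of_real l * z)) \<le> norm c * exp \<bar>l\<bar>" if "0 \<le> Re z" "Re z \<le> 1" for z
  proof -
    have "l * Re z \<le> \<bar>l\<bar> * 1" using that by (intro mult_mono) auto
    then show ?thesis by (simp add: norm_mult mult_left_mono)
  qed
  then show ?case by blast
next
  case (add f g)
  then obtain K L where "\<forall>z. 0 \<le> Re z \<longrightarrow> Re z \<le> 1 \<longrightarrow> norm (f z) \<le> K"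
    "\<forall>z. 0 \<le> Re z \<longrightarrow> Re z \<le> 1 \<longrightarrow> norm (g z) \<le> L" by blast
  then have "\<forall>z. 0 \<le> Re z \<longrightarrow> Re z \<le> 1 \<longrightarrow> norm (f z + g z) \<le> K + L"
    by (meson add_mono norm_triangle_ineq order_trans)
  then show ?case by blast
qed

definition expsum_matrix :: "(complex \<Rightarrow> 'n::finite cmat) \<Rightarrow> bool" where
  "expsum_matrix M \<longleftrightarrow> (\<forall>i j. expsum (\<lambda>z. M z $ i $ j))"

lemma expsum_matrix_mult:
  "expsum_matrix M \<Longrightarrow> expsum_matrix N \<Longrightarrow> expsum_matrix (\<lambda>z. M z ** N z)"
  by (simp add: expsum_matrix_def matrix_matrix_mult_def expsum_sum expsum_mult)

lemma expsum_matrix_const: "expsum_matrix (\<lambda>z. A)"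
  by (simp add: expsum_matrix_def expsum_const)

lemma expsum_trace: "expsum_matrix M \<Longrightarrow> expsum (\<lambda>z. trace (M z))"
  by (simp add: expsum_matrix_def trace_def expsum_sum)

lemma expsum_if: "expsum f \<Longrightarrow> expsum (\<lambda>z. if P then f z else 0)"
  by (cases P) (simp_all add: expsum_const)

lemma expsum_matrix_ampliate:
  "expsum_matrix M \<Longrightarrow> expsum_matrix (\<lambda>z. ampliate g (M z))"
  by (simp add: expsum_matrix_def ampliate_def Let_def case_prod_beta expsum_if)

lemma expsum_matrix_mpow:
  assumes A: "psd A"
  shows "expsum_matrix (\<lambda>z. mpow A (of_real c * z))"
proof -
  obtain U d where U: "unitary_mat U" "A = U ** diag_mat (\<lambda>i. complex_of_real (d i)) ** adj U" "\<And>i. 0 \<le> d i"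
    using psd_spectral[OF A] by blast
  have e: "expsum (\<lambda>z. complex_of_real (d k) powr (of_real c * z))" for k
  proof (cases "d k = 0")
    case False
    have "(\<lambda>z. complex_of_real (d k) powr (of_real c * z)) = (\<lambda>z. 1 * exp (of_real (ln (d k) * c) * z))"
      using False U(3)[of k] by (simp add: of_real_powr_eq fun_eq_iff mult.assoc)
    then show ?thesis using expsum.exp[of 1 "ln (d k) * c"] by simp
  qed (simp add: expsum_const)
  show ?thesis
    unfolding expsum_matrix_def mpow_spectral[OF U(1,2)] spectral_entry
    by (intro allI expsum_sum expsum_mult expsum_const e)
qed

section \<open>Derivatives at 0 and factors\<close>

definition has_matrix_derivative :: "(complex \<Rightarrow> 'n::finite cmat) \<Rightarrow> 'n cmat \<Rightarrow> bool" where
  "has_matrix_derivative M D \<longleftrightarrow> (\<forall>i j. ((\<lambda>z. M z $ i $ j) has_field_derivative D $ i $ j) (at 0))"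

lemma has_matrix_derivative_mult:
  assumes "has_matrix_derivative M D" "has_matrix_derivative N E"
  shows "has_matrix_derivative (\<lambda>z. M z ** N z) (D ** N 0 + M 0 ** E)"
  unfolding has_matrix_derivative_def
proof (intro allI)
  fix i j
  have "((\<lambda>z. \<Sum>k\<in>UNIV. M z $ i $ k * N z $ k $ j) has_field_derivative
      (\<Sum>k\<in>UNIV. D $ i $ k * N 0 $ k $ j + E $ k $ j * M 0 $ i $ k)) (at 0)"
    using assms by (intro DERIV_sum DERIV_mult) (auto simp: has_matrix_derivative_def)
  then show "((\<lambda>z. (M z ** N z) $ i $ j) has_field_derivative (D ** N 0 + M 0 ** E) $ i $ j) (at 0)"
    by (simp add: matrix_matrix_mult_def sum.distrib mult.commute)
qed

lemma has_matrix_derivative_ampliate: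
  "has_matrix_derivative M D \<Longrightarrow> has_matrix_derivative (\<lambda>z. ampliate g (M z)) (ampliate g D)"
  by (simp add: has_matrix_derivative_def ampliate_def Let_def case_prod_beta)

text \<open>A zero eigenvalue contributes the constant function 0, and \<open>ln 0 = 0\<close> gives
  it the matching derivative, so the formula needs no assumption of invertibility.\<close>

lemma has_matrix_derivative_mpow:
  assumes A: "psd A"
  shows "has_matrix_derivative (\<lambda>z. mpow A (of_real c * z)) (\<chi> i j. of_real c * mlog A $ i $ j)"
proof -
  obtain U d where U: "unitary_mat U" "A = U ** diag_mat (\<lambda>i. complex_of_real (d i)) ** adj U" "\<And>i. 0 \<le> d i"
    using psd_spectral[OF A] by blast
  have e: "((\<lambda>z. complex_of_real (d k) powr (of_real c * z)) has_field_derivative of_real (c * ln (d k))) (at 0)" for k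
  proof (cases "d k = 0")
    case False
    have "((\<lambda>z. exp (of_real (ln (d k)) * (of_real c * z))) has_field_derivative of_real (c * ln (d k))) (at 0)"
      by (auto intro!: derivative_eq_intros)
    then show ?thesis using False U(3)[of k] by (simp add: of_real_powr_eq)
  qed simp
  have "((\<lambda>z. \<Sum>k\<in>UNIV. U $ i $ k * complex_of_real (d k) powr (of_real c * z) * cnj (U $ j $ k)) has_field_derivative
      (\<Sum>k\<in>UNIV. U $ i $ k * of_real (c * ln (d k)) * cnj (U $ j $ k))) (at 0)" for i j
    by (intro DERIV_sum DERIV_cmult_right DERIV_cmult e)
  moreover have "(\<Sum>k\<in>UNIV. U $ i $ k * of_real (c * ln (d k)) * cnj (U $ j $ k)) = of_real c * mlog A $ i $ j" for i j
    unfolding mlog_spectral[OF U(1,2)] spectral_entry by (simp add: sum_distrib_left mult_ac)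
  ultimately show ?thesis
    unfolding has_matrix_derivative_def mpow_spectral[OF U(1,2)] spectral_entry by simp
qed

text \<open>A product of factors is again a factor and the slopes add up; for a state \<open>\<rho>\<close> the
  function \<open>trace (\<rho> ** M z)\<close> of a factor satisfies the hypotheses of the strip estimates.\<close>

definition factor :: "'n::finite cmat \<Rightarrow> (complex \<Rightarrow> 'n cmat) \<Rightarrow> real \<Rightarrow> bool" where
  "factor \<rho> M s \<longleftrightarrow> expsum_matrix M \<and> \<rho> ** M 0 = \<rho> \<and> M 0 ** \<rho> = \<rho> \<and>
     (\<forall>z. Re z = 0 \<longrightarrow> contraction (M z)) \<and>
     (\<exists>D. has_matrix_derivative M D \<and> Re (trace (\<rho> ** D)) = s)"

text \<open>Slopes add although the operators do not commute: in the product rule \<open>M 0\<close>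
  is absorbed by \<open>\<rho>\<close> from the right and, after a cyclic rotation,
  \<open>N 0\<close> from the left. This is why \<open>factor\<close> requires both absorption
  identities.\<close>

lemma factor_mult:
  assumes M: "factor \<rho> M s" and N: "factor \<rho> N t"
  shows "factor \<rho> (\<lambda>z. M z ** N z) (s + t)"
proof -
  obtain D E where D: "has_matrix_derivative M D" "Re (trace (\<rho> ** D)) = s"
    and E: "has_matrix_derivative N E" "Re (trace (\<rho> ** E)) = t"
    using M N by (auto simp: factor_def)
  have \<rho>: "\<rho> ** M 0 = \<rho>" "M 0 ** \<rho> = \<rho>" "\<rho> ** N 0 = \<rho>" "N 0 ** \<rho> = \<rho>"
    using M N by (auto simp: factor_def)
  have "\<rho> ** (M 0 ** N 0) = \<rho>" using \<rho> by (metis matrix_mul_assoc)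
  moreover have "(M 0 ** N 0) ** \<rho> = \<rho>" using \<rho> by (metis matrix_mul_assoc)
  moreover have "Re (trace (\<rho> ** (D ** N 0 + M 0 ** E))) = s + t"
  proof -
    have "trace (\<rho> ** (D ** N 0)) = trace (N 0 ** (\<rho> ** D))"
      unfolding matrix_mul_assoc by (subst trace_mul_sym) (simp add: matrix_mul_assoc)
    also have "\<dots> = trace (\<rho> ** D)" using \<rho>(4) by (simp only: matrix_mul_assoc)
    moreover have "\<rho> ** (M 0 ** E) = \<rho> ** E" using \<rho>(1) by (simp only: matrix_mul_assoc)
    ultimately show ?thesis using D E by (simp add: matrix_add_ldistrib trace_add)
  qed
  ultimately show ?thesis
    using M N has_matrix_derivative_mult[OF D(1) E(1)]
    by (auto simp: factor_def intro: expsum_matrix_mult contraction_mult)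
qed

lemma factor_ampliate_mpow:
  fixes g :: "'k::finite \<Rightarrow> 'd::finite \<Rightarrow> 'n::finite"
  assumes g: "bij2 g" and \<rho>: "psd \<rho>"
  shows "factor \<rho> (\<lambda>z. ampliate g (mpow (partial_trace g \<rho>) (of_real c * z))) (- c * vn_entropy (partial_trace g \<rho>))"
proof -
  note \<sigma> = psd_partial_trace[OF g \<rho>]
  have "trace (\<rho> ** ampliate g (\<chi> i j. of_real c * mlog (partial_trace g \<rho>) $ i $ j))
      = of_real c * trace (partial_trace g \<rho> ** mlog (partial_trace g \<rho>))"
    unfolding trace_mult_ampliate[OF g]
    by (simp add: trace_def matrix_matrix_mult_def sum_distrib_left mult_ac)
  moreover have "has_matrix_derivative (\<lambda>z. ampliate g (mpow (partial_trace g \<rho>) (of_real c * z)))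
      (ampliate g (\<chi> i j. of_real c * mlog (partial_trace g \<rho>) $ i $ j))"
    by (intro has_matrix_derivative_ampliate has_matrix_derivative_mpow \<sigma>)
  moreover have "contraction (ampliate g (mpow (partial_trace g \<rho>) (of_real c * z)))" if "Re z = 0" for z
    using that by (intro contraction_ampliate g contraction_mpow \<sigma>) simp
  ultimately show ?thesis
    unfolding factor_def
    using mult_ampliate_support[OF g \<rho>] expsum_matrix_ampliate[OF expsum_matrix_mpow[OF \<sigma>]]
    by (auto simp: vn_entropy_def)
qed

lemma factor_mpow:
  assumes \<rho>: "psd \<rho>"
  shows "factor \<rho> (\<lambda>z. mpow \<rho> (of_real c * z)) (- c * vn_entropy \<rho>)"
proof -
  \<comment> \<open>Discarding the trivial system \<open>unit\<close> changes nothing, so the total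
    state is treated as one of its own marginals.\<close>
  define g where "g = (\<lambda>k (u::unit). k :: 'a)"
  have g: "bij2 g" unfolding g_def by (rule bijI) (auto simp: inj_def surj_def)
  have "partial_trace g \<rho> = \<rho>"
    by (simp add: partial_trace_def g_def vec_eq_iff)
  moreover have "ampliate g Y = Y" for Y
    by (rule bij2_eqI[OF g], subst ampliate_entry[OF g]) (simp add: g_def)
  ultimately show ?thesis using factor_ampliate_mpow[OF g \<rho>, of c] by simp
qed

text \<open>A direct substitute for the Naimark dilation of \<open>M\<close> to a projective measurement.\<close>

lemma norm_povm_combination_le:
  fixes M :: "nat \<Rightarrow> 'n::finite cmat" and c :: "nat \<Rightarrow> complex"
  assumes M: "povm n M"
  shows "(norm ((\<chi> i j. \<Sum>k<n. c k * M k $ i $ j) *v x))\<^sup>2 \<le> (\<Sum>k<n. (norm (c k))\<^sup>2 * Re (cdot x (M k *v x)))"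
proof -
  have psd: "psd (M k)" if "k < n" for k using M that by (simp add: povm_def)
  define y where "y = (\<chi> i j. \<Sum>k<n. c k * M k $ i $ j) *v x"
  define R where "R k = msqrt (M k)" for k
  have RR: "cdot u (M k *v v) = cdot (R k *v u) (R k *v v)" if "k < n" for k u v
    using msqrt_mult_msqrt[OF psd[OF that]] adj_msqrt[OF psd[OF that]] cdot_adj[of u "R k" "R k *v v"]
    by (simp add: R_def matrix_vector_mul_assoc)
  have sq: "(norm (R k *v u))\<^sup>2 = Re (cdot u (M k *v u))" if "k < n" for k u
    using RR[OF that, of u u] by (simp add: cdot_self)
  have y: "y = (\<Sum>k<n. c k *s (M k *v x))"
    by (simp add: y_def vec_eq_iff matrix_vector_mult_def sum_component sum_distrib_right sum_distrib_left mult.assoc)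
      (subst sum.swap, simp)
  \<comment> \<open>Completeness of the measurement is applied to the output vector itself.\<close>
  have one: "y = (\<Sum>k<n. M k *v y)"
  proof -
    have "mat 1 *v y = (\<Sum>k<n. M k) *v y" using M by (simp add: povm_def)
    also have "\<dots> = (\<Sum>k<n. M k *v y)"
      by (induction n) (simp_all add: matrix_vector_mult_add_rdistrib)
    finally show ?thesis by simp
  qed
  \<comment> \<open>The squared norm is written as a sum of products of R_k y with c_k R_k x. The
    arithmetic-mean inequality produces one copy of the squared norm of y, which is subtracted from
    the left.\<close>
  have "2 * (norm y)\<^sup>2 = 2 * norm (cdot y y)" by (simp add: cdot_self norm_power)
  also have "cdot y y = (\<Sum>k<n. cdot (R k *v y) (c k *s (R k *v x)))"
  proof -
    have "cdot y y = (\<Sum>k<n. c k * cdot y (M k *v x))"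
      by (subst (2) y) (simp add: cdot_sum_right cdot_smult_right)
    then show ?thesis by (simp add: RR cdot_smult_right)
  qed
  also have "2 * norm \<dots> \<le> (\<Sum>k<n. 2 * norm (cdot (R k *v y) (c k *s (R k *v x))))"
    unfolding sum_distrib_left[symmetric] by (intro mult_left_mono norm_sum) simp
  also have "\<dots> \<le> (\<Sum>k<n. (norm (R k *v y))\<^sup>2 + (norm (c k *s (R k *v x)))\<^sup>2)"
    by (intro sum_mono norm_cdot_le)
  also have "\<dots> = (\<Sum>k<n. Re (cdot y (M k *v y))) + (\<Sum>k<n. (norm (c k))\<^sup>2 * Re (cdot x (M k *v x)))"
  proof -
    have ns: "(norm (a *s v))\<^sup>2 = (norm a)\<^sup>2 * (norm v)\<^sup>2" for a :: complex and v :: "complex ^ 'n"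
    proof -
      have "complex_of_real ((norm (a *s v))\<^sup>2) = (cnj a * a) * of_real ((norm v)\<^sup>2)"
        unfolding cdot_self[symmetric] by (simp add: cdot_smult_left cdot_smult_right)
      also have "cnj a * a = of_real ((norm a)\<^sup>2)" by (simp add: complex_norm_square mult.commute del: of_real_power)
      finally show ?thesis by (simp only: of_real_mult[symmetric] of_real_eq_iff)
    qed
    show ?thesis unfolding sum.distrib[symmetric] by (intro sum.cong refl) (simp add: sq ns)
  qed
  also have "(\<Sum>k<n. Re (cdot y (M k *v y))) = (norm y)\<^sup>2"
  proof -
    have "(\<Sum>k<n. cdot y (M k *v y)) = cdot y y" unfolding cdot_sum_right[symmetric] one[symmetric] ..
    then have "Re (\<Sum>k<n. cdot y (M k *v y)) = (norm y)\<^sup>2" by (simp add: cdot_self)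
    then show ?thesis by simp
  qed
  finally show ?thesis by (simp add: y_def)
qed

text \<open>On the imaginary axis all coefficients have modulus 1, so the preceding bound sums to
  the squared norm of x; at z = 0 the combination is the identity.\<close>

lemma factor_povm:
  assumes \<rho>: "quantum_state \<rho>" and M: "povm n M"
  shows "factor \<rho> (\<lambda>z. \<chi> i j. \<Sum>k<n. exp (of_real (l k) * z) * M k $ i $ j)
     (\<Sum>k<n. l k * Re (trace (\<rho> ** M k)))"
proof -
  have sum: "(\<chi> i j. \<Sum>k<n. M k $ i $ j) = mat 1"
    using M by (simp add: povm_def vec_eq_iff sum_component)
  have c: "contraction (\<chi> i j. \<Sum>k<n. exp (of_real (l k) * z) * M k $ i $ j)" if z: "Re z = 0" for z
    unfolding contraction_def
  proof
    fix x
    have "(norm ((\<chi> i j. \<Sum>k<n. exp (of_real (l k) * z) * M k $ i $ j) *v x))\<^sup>2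
       \<le> (\<Sum>k<n. (norm (exp (of_real (l k) * z)))\<^sup>2 * Re (cdot x (M k *v x)))"
      by (rule norm_povm_combination_le[OF M])
    also have "\<dots> = Re (cdot x (\<Sum>k<n. M k *v x))" by (simp add: z cdot_sum_right)
    also have "(\<Sum>k<n. M k *v x) = (\<Sum>k<n. M k) *v x"
      by (induction n) (simp_all add: matrix_vector_mult_add_rdistrib)
    also have "Re (cdot x \<dots>) = (norm x)\<^sup>2" using M by (simp add: povm_def cdot_self)
    finally show "norm ((\<chi> i j. \<Sum>k<n. exp (of_real (l k) * z) * M k $ i $ j) *v x) \<le> norm x"
      by (rule power2_le_imp_le) simp
  qed
  have e: "expsum_matrix (\<lambda>z. \<chi> i j. \<Sum>k<n. exp (of_real (l k) * z) * M k $ i $ j)"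
    unfolding expsum_matrix_def using expsum.exp[of 1]
    by (auto intro!: expsum_sum expsum_mult expsum_const)
  have "((\<lambda>z. \<Sum>k<n. exp (of_real (l k) * z) * M k $ i $ j) has_field_derivative
     (\<Sum>k<n. of_real (l k) * M k $ i $ j)) (at 0)" for i j
    by (intro DERIV_sum DERIV_cmult_right) (auto intro!: derivative_eq_intros)
  then have d: "has_matrix_derivative (\<lambda>z. \<chi> i j. \<Sum>k<n. exp (of_real (l k) * z) * M k $ i $ j)
     (\<chi> i j. \<Sum>k<n. of_real (l k) * M k $ i $ j)"
    by (simp add: has_matrix_derivative_def)
  have "trace (\<rho> ** (\<chi> i j. \<Sum>k<n. of_real (l k) * M k $ i $ j)) = (\<Sum>i\<in>UNIV. \<Sum>j\<in>UNIV. \<Sum>k<n. of_real (l k) * (\<rho> $ i $ j * M k $ j $ i))"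
    by (simp add: trace_def matrix_matrix_mult_def sum_distrib_left mult_ac)
  also have "\<dots> = (\<Sum>k<n. of_real (l k) * trace (\<rho> ** M k))"
    by (simp add: trace_def matrix_matrix_mult_def sum_distrib_left sum.swap[of _ "{..<n}"])
  finally have "Re (trace (\<rho> ** (\<chi> i j. \<Sum>k<n. of_real (l k) * M k $ i $ j))) = (\<Sum>k<n. l k * Re (trace (\<rho> ** M k)))"
    by simp
  then show ?thesis unfolding factor_def using e c d sum by auto
qed

subsection \<open>The recovered state\<close>

lemma bij2_compose:
  assumes g: "bij2 g" and h: "bij2 h"
  shows "bij2 (\<lambda>k (e, d). g (h k e) d)"
proof -
  have gi: "g k d = g l e \<longleftrightarrow> k = l \<and> d = e" for k l d e
    using bij_is_inj[OF g] by (auto dest: injD[of _ "(k, d)" "(l, e)"])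
  have hi: "h k d = h l e \<longleftrightarrow> k = l \<and> d = e" for k l d e
    using bij_is_inj[OF h] by (auto dest: injD[of _ "(k, d)" "(l, e)"])
  have "\<exists>k e d. p = g (h k e) d" for p
  proof -
    obtain m d where "p = g m d" using bij_is_surj[OF g] by (metis case_prod_beta surjD)
    moreover obtain k e where "m = h k e" using bij_is_surj[OF h] by (metis case_prod_beta surjD)
    ultimately show ?thesis by blast
  qed
  then have "\<exists>x. p = (\<lambda>(k, x). (\<lambda>(e, d). g (h k e) d) x) x" for p
    by (metis case_prod_conv)
  then show ?thesis
    by (intro bijI) (auto simp: inj_def surj_def gi hi)
qed

lemma partial_trace_compose:
  "partial_trace h (partial_trace g \<rho>) = partial_trace (\<lambda>k (e, d). g (h k e) d) \<rho>"
  by (simp add: partial_trace_def vec_eq_iff sum.cartesian_product case_prod_beta)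

lemma ampliate_compose:
  fixes g :: "'k::finite \<Rightarrow> 'd \<Rightarrow> 'n::finite" and h :: "'l::finite \<Rightarrow> 'e \<Rightarrow> 'k"
  assumes g: "bij2 g" and h: "bij2 h"
  shows "ampliate g (ampliate h Y) = ampliate (\<lambda>k (e, d). g (h k e) d) Y"
proof (rule bij2_eqI[OF bij2_compose[OF g h]])
  fix k :: 'l and l :: 'l and d e :: "'e \<times> 'd"
  obtain d1 d2 e1 e2 where [simp]: "d = (d1, d2)" "e = (e1, e2)" by (metis surj_pair)
  show "ampliate g (ampliate h Y) $ (case d of (e, d) \<Rightarrow> g (h k e) d) $ (case e of (e, d) \<Rightarrow> g (h l e) d) =
    ampliate (\<lambda>k (e, d). g (h k e) d) Y $ (case d of (e, d) \<Rightarrow> g (h k e) d) $ (case e of (e, d) \<Rightarrow> g (h l e) d)"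
    using ampliate_entry[OF bij2_compose[OF g h], of Y k d l e]
    by (simp add: ampliate_entry[OF g] ampliate_entry[OF h])
qed

lemma trace_mult_eqI:
  fixes A B :: "'n::finite cmat"
  assumes "\<And>T. trace (A ** T) = trace (B ** T)"
  shows "A = B"
proof -
  have "trace (C ** matrix_unit j i) = C $ i $ j" for C :: "'n cmat" and i j
  proof -
    have "trace (C ** matrix_unit j i) = (\<Sum>k\<in>UNIV. \<Sum>l\<in>UNIV. if l = j then (if k = i then C $ i $ j else 0) else 0)"
      unfolding trace_def matrix_matrix_mult_def matrix_unit_def vec_lambda_beta
      by (intro sum.cong refl) auto
    then show ?thesis by simp
  qed
  then show ?thesis using assms by (metis vec_eq_iff)
qed

lemma partial_trace_ampliate_mult:
  fixes g :: "'k::finite \<Rightarrow> 'd::finite \<Rightarrow> 'n::finite"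
  assumes g: "bij2 g"
  shows "partial_trace g (ampliate g Y ** A ** ampliate g Z) = Y ** partial_trace g A ** Z"
proof (rule trace_mult_eqI)
  fix T
  have "trace (partial_trace g (ampliate g Y ** A ** ampliate g Z) ** T)
      = trace (ampliate g Y ** (A ** (ampliate g Z ** ampliate g T)))"
    unfolding trace_mult_ampliate[OF g, symmetric] by (simp add: matrix_mul_assoc)
  also have "\<dots> = trace (A ** ampliate g (Z ** T ** Y))"
    by (subst trace_mul_sym) (simp add: ampliate_mult[OF g] matrix_mul_assoc)
  also have "\<dots> = trace ((partial_trace g A ** (Z ** T)) ** Y)"
    by (simp add: trace_mult_ampliate[OF g] matrix_mul_assoc)
  also have "\<dots> = trace (Y ** partial_trace g A ** Z ** T)"
    by (subst trace_mul_sym) (simp add: matrix_mul_assoc)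
  finally show "trace (partial_trace g (ampliate g Y ** A ** ampliate g Z) ** T) = trace (Y ** partial_trace g A ** Z ** T)" .
qed

lemma kron_mult: "kron A B ** kron C D = kron (A ** C) (B ** D)"
  unfolding vec_eq_iff split_paired_All
  by (simp add: kron_def matrix_matrix_mult_def sum_product sum.cartesian_product case_prod_beta mult_ac flip: UNIV_Times_UNIV)

lemma adj_kron: "adj (kron A B) = kron (adj A) (adj B)"
  by (simp add: adj_def kron_def vec_eq_iff)

section \<open>The index maps of the marginals as named bijections\<close>

definition in1 :: "'x \<Rightarrow> 'y \<times> 'z \<Rightarrow> 'x \<times> 'y \<times> 'z" where "in1 = (\<lambda>x (y, z). (x, y, z))"
definition in2 :: "'y \<Rightarrow> 'x \<times> 'z \<Rightarrow> 'x \<times> 'y \<times> 'z" where "in2 = (\<lambda>y (x, z). (x, y, z))"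
definition in3 :: "'z \<Rightarrow> 'x \<times> 'y \<Rightarrow> 'x \<times> 'y \<times> 'z" where "in3 = (\<lambda>z (x, y). (x, y, z))"
definition in_snd :: "'y \<Rightarrow> 'x \<Rightarrow> 'x \<times> 'y" where "in_snd = (\<lambda>y x. (x, y))"
definition in_fst :: "'x \<Rightarrow> 'y \<Rightarrow> 'x \<times> 'y" where "in_fst = (\<lambda>x y. (x, y))"
definition in_bar :: "'a' \<times> 'b' \<times> 'c' \<Rightarrow> 'a \<times> 'b \<times> 'c \<Rightarrow> ('a \<times> 'a') \<times> ('b \<times> 'b') \<times> ('c \<times> 'c')" where
  "in_bar = (\<lambda>(a', b', c') (a, b, c). ((a, a'), (b, b'), (c, c')))"

lemma bij2_in: "bij2 in1" "bij2 in2" "bij2 in3" "bij2 in_snd" "bij2 in_fst" "bij2 in_bar"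
  by (auto simp: bij_def inj_def surj_def in1_def in2_def in3_def in_snd_def in_fst_def in_bar_def)

lemma marginals_conv:
  "marg1 = partial_trace in1" "marg2 = partial_trace in2" "marg3 = partial_trace in3"
  "tr_fst = partial_trace in_snd" "bar_marg = partial_trace in_bar"
  by (simp_all add: marg1_def marg2_def marg3_def tr_fst_def bar_marg_def
      in1_def in2_def in3_def in_snd_def in_bar_def)

lemma ampliate_in_entries:
  "ampliate in1 Y $ (x, y, z) $ (x', y', z') = (if y = y' \<and> z = z' then Y $ x $ x' else 0)"
  "ampliate in2 Z $ (x, y, z) $ (x', y', z') = (if x = x' \<and> z = z' then Z $ y $ y' else 0)"
  "ampliate in3 V $ (x, y, z) $ (x', y', z') = (if x = x' \<and> y = y' then V $ z $ z' else 0)"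
  "ampliate in_snd U $ (u, v) $ (u', v') = (if u = u' then U $ v $ v' else 0)"
  "ampliate in_fst R $ (u, v) $ (u', v') = (if v = v' then R $ u $ u' else 0)"
  "ampliate in_bar T $ ((a, p), (b, q), (c, r)) $ ((a', p'), (b', q'), (c', r')) =
     (if a = a' \<and> b = b' \<and> c = c' then T $ (p, q, r) $ (p', q', r') else 0)"
  using ampliate_entry[OF bij2_in(1), of Y x "(y, z)" x' "(y', z')"]
    ampliate_entry[OF bij2_in(2), of Z y "(x, z)" y' "(x', z')"]
    ampliate_entry[OF bij2_in(3), of V z "(x, y)" z' "(x', y')"]
    ampliate_entry[OF bij2_in(4), of U v u v' u']
    ampliate_entry[OF bij2_in(5), of R u v u' v']
    ampliate_entry[OF bij2_in(6), of T "(p, q, r)" "(a, b, c)" "(p', q', r')" "(a', b', c')"]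
  by (simp_all add: in1_def in2_def in3_def in_snd_def in_fst_def in_bar_def)

lemma ampliate_in_snd: "ampliate in_snd Y = kron (mat 1) Y"
  and ampliate_in_fst: "ampliate in_fst Z = kron Z (mat 1)"
  by (auto simp: vec_eq_iff split_paired_All ampliate_in_entries kron_def mat_def)

lemma kron_conv_ampliate: "kron A B = ampliate in_fst A ** ampliate in_snd B"
  by (simp add: ampliate_in_snd ampliate_in_fst kron_mult)

lemma contraction_kron: "contraction A \<Longrightarrow> contraction B \<Longrightarrow> contraction (kron A B)"
  unfolding kron_conv_ampliate by (intro contraction_mult contraction_ampliate bij2_in)

lemma ampliate_in1: "ampliate in1 A = kron A (mat 1)"
  and ampliate_in2: "ampliate in2 B = kron (mat 1) (kron B (mat 1))"
  and ampliate_in3: "ampliate in3 C = kron (mat 1) (kron (mat 1) C)"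
  by (auto simp: vec_eq_iff split_paired_All ampliate_in_entries kron_def mat_def)

lemma kron3_conv_ampliate: "kron A (kron B C) = ampliate in1 A ** ampliate in2 B ** ampliate in3 C"
  by (simp add: ampliate_in1 ampliate_in2 ampliate_in3 kron_mult)

lemma ampliate_in_bar_commute:
  "ampliate in_bar (ampliate in1 X) = ampliate in1 (ampliate in_snd X)"
  "ampliate in_bar (ampliate in2 Y) = ampliate in2 (ampliate in_snd Y)"
  "ampliate in_bar (ampliate in3 Z) = ampliate in3 (ampliate in_snd Z)"
  by (auto simp: vec_eq_iff split_paired_All ampliate_in_entries)

lemma marginals_of_bar_marg:
  "marg1 (bar_marg \<rho>) = tr_fst (marg1 \<rho>)"
  "marg2 (bar_marg \<rho>) = tr_fst (marg2 \<rho>)"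
  "marg3 (bar_marg \<rho>) = tr_fst (marg3 \<rho>)"
  unfolding marginals_conv
  by (auto intro!: trace_mult_eqI simp: bij2_in ampliate_in_bar_commute simp flip: trace_mult_ampliate)

lemma matrix_unit_entry: "matrix_unit i j $ k $ l = (if k = i \<and> l = j then 1 else 0)"
  by (simp add: matrix_unit_def)

lemma tensor_map_matrix_unit:
  "tensor_map \<Phi> \<Psi> (matrix_unit p q) =
     kron (\<Phi> (matrix_unit (fst p) (fst q))) (\<Psi> (matrix_unit (snd p) (snd q)))"
proof -
  have "tensor_map \<Phi> \<Psi> (matrix_unit p q) $ r $ s =
     (\<Sum>p'\<in>UNIV. \<Sum>q'\<in>UNIV. if q' = q then (if p' = p then
        kron (\<Phi> (matrix_unit (fst p) (fst q))) (\<Psi> (matrix_unit (snd p) (snd q))) $ r $ s else 0) else 0)" for r s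
    unfolding tensor_map_def vec_lambda_beta case_prod_beta
    by (intro sum.cong refl) (auto simp: matrix_unit_entry)
  then show ?thesis by (simp add: vec_eq_iff)
qed

lemma matrix_add_rdistrib: "(B + C) ** D = B ** D + C ** (D :: 'a::semiring_1 ^ 'p ^ 'n)"
  by (simp add: matrix_matrix_mult_def vec_eq_iff algebra_simps sum.distrib)

lemma sum_matrix_conjugation:
  fixes A B :: "'n::finite cmat"
  shows "(\<Sum>x\<in>S. c x * (A ** T x ** B) $ r $ s) = (A ** (\<chi> p q. \<Sum>x\<in>S. c x * T x $ p $ q) ** B) $ r $ s"
proof (induction S rule: infinite_finite_induct)
  case (insert x S)
  have "(A ** (\<chi> p q. \<Sum>x\<in>insert x S. c x * T x $ p $ q) ** B) $ r $ s
     = (A ** ((\<chi> p q. c x * T x $ p $ q) + (\<chi> p q. \<Sum>x\<in>S. c x * T x $ p $ q)) ** B) $ r $ s"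
    using insert by (simp add: plus_vec_def)
  also have "\<dots> = (A ** (\<chi> p q. c x * T x $ p $ q) ** B) $ r $ s + (A ** (\<chi> p q. \<Sum>x\<in>S. c x * T x $ p $ q) ** B) $ r $ s"
    by (simp add: matrix_add_ldistrib matrix_add_rdistrib)
  also have "(A ** (\<chi> p q. c x * T x $ p $ q) ** B) $ r $ s = c x * (A ** T x ** B) $ r $ s"
    by (simp add: matrix_matrix_mult_def sum_distrib_left sum_distrib_right mult_ac)
  finally show ?case using insert by simp
qed (simp_all add: matrix_matrix_mult_def)

text \<open>On matrix units every local map is a conjugation, and Kronecker products multiply
  factorwise; linearity then moves the sum over matrix units between \<open>?K\<close> and its
  adjoint. The reordering of tensor factors in \<open>in_bar\<close> is what turns that sum into a
  single ampliation.\<close>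

lemma tensor_map_conjugation:
  fixes K1 :: "('a::finite \<times> 'a'::finite) cmat" and K2 :: "('b::finite \<times> 'b'::finite) cmat"
    and K3 :: "('c::finite \<times> 'c'::finite) cmat"
  shows "tensor_map (\<lambda>X. K1 ** kron (mat 1) X ** adj K1)
      (tensor_map (\<lambda>X. K2 ** kron (mat 1) X ** adj K2) (\<lambda>X. K3 ** kron (mat 1) X ** adj K3)) X
    = kron K1 (kron K2 K3) ** ampliate in_bar X ** adj (kron K1 (kron K2 K3))"
    (is "?L = ?K ** _ ** _")
proof -
  \<comment> \<open>The image of a triple of matrix units with identities inserted on the unbarred
    systems, in the order of factors used by the total space.\<close>
  define T where "T = (\<lambda>((i :: 'a', j :: 'b', m :: 'c'), (k :: 'a', l :: 'b', n :: 'c')).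
      kron (kron (mat 1 :: 'a cmat) (matrix_unit i k))
        (kron (kron (mat 1 :: 'b cmat) (matrix_unit j l)) (kron (mat 1 :: 'c cmat) (matrix_unit m n))))"
  have "?L $ r $ s = (\<Sum>x\<in>UNIV. X $ fst x $ snd x * (?K ** T x ** adj ?K) $ r $ s)" for r s
  proof -
    have "?L $ r $ s = (\<Sum>p\<in>UNIV. \<Sum>q\<in>UNIV. X $ p $ q * (?K ** T (p, q) ** adj ?K) $ r $ s)"
      unfolding tensor_map_def[of _ "tensor_map _ _"] vec_lambda_beta
      by (intro sum.cong refl) (simp add: case_prod_beta, intro sum.cong refl,
          simp add: T_def case_prod_beta kron_mult adj_kron tensor_map_matrix_unit)
    then show ?thesis by (simp add: sum.cartesian_product case_prod_beta flip: UNIV_Times_UNIV)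
  qed
  moreover have "(\<chi> p q. \<Sum>x\<in>UNIV. X $ fst x $ snd x * T x $ p $ q) = ampliate in_bar X"
  proof -
    have "(\<Sum>x\<in>UNIV. X $ fst x $ snd x * T x $ ((a, p), (b, q), (c, r)) $ ((a', p'), (b', q'), (c', r')))
      = ampliate in_bar X $ ((a, p), (b, q), (c, r)) $ ((a', p'), (b', q'), (c', r'))" for a p b q c r a' p' b' q' c' r'
    proof -
      have "(\<Sum>x\<in>UNIV. X $ fst x $ snd x * T x $ ((a, p), (b, q), (c, r)) $ ((a', p'), (b', q'), (c', r')))
        = (\<Sum>x\<in>UNIV. if x = ((p, q, r), (p', q', r')) then
            (if a = a' \<and> b = b' \<and> c = c' then X $ (p, q, r) $ (p', q', r') else 0) else 0)"
        by (intro sum.cong refl) (auto simp: T_def kron_def mat_def matrix_unit_entry split: if_splits)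
      then show ?thesis by (simp add: ampliate_in_entries)
    qed
    then show ?thesis by (simp add: vec_eq_iff split_paired_All)
  qed
  ultimately show ?thesis
    by (simp add: vec_eq_iff sum_matrix_conjugation)
qed

section \<open>The strip function and the amplitudes\<close>

lemma factor_strip_function:
  assumes \<rho>: "quantum_state \<rho>" and M: "factor \<rho> M s"
  defines "f \<equiv> \<lambda>z. trace (\<rho> ** M z)"
  obtains f' K where "\<And>z. (f has_field_derivative f' z) (at z)"
    "\<And>z. 0 \<le> Re z \<Longrightarrow> Re z \<le> 1 \<Longrightarrow> norm (f z) \<le> K"
    "\<And>z. 0 \<le> Re z \<Longrightarrow> Re z \<le> 1 \<Longrightarrow> norm (f' z) \<le> K"
    "\<And>z. Re z = 0 \<Longrightarrow> norm (f z) \<le> 1" "f 0 = 1" "Re (f' 0) = s"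
proof -
  have psd: "psd \<rho>" and tr: "trace \<rho> = 1" using \<rho> by (auto simp: quantum_state_def)
  have "expsum f"
    unfolding f_def using M
    by (intro expsum_trace expsum_matrix_mult expsum_matrix_const) (simp add: factor_def)
  then obtain f' where f': "expsum f'" "\<And>z. (f has_field_derivative f' z) (at z)"
    using expsum_has_derivative by blast
  obtain K1 K2 where K: "\<And>z. 0 \<le> Re z \<Longrightarrow> Re z \<le> 1 \<Longrightarrow> norm (f z) \<le> K1"
    "\<And>z. 0 \<le> Re z \<Longrightarrow> Re z \<le> 1 \<Longrightarrow> norm (f' z) \<le> K2"
    using expsum_bounded[OF \<open>expsum f\<close>] expsum_bounded[OF f'(1)] by blast
  obtain D where D: "has_matrix_derivative M D" "Re (trace (\<rho> ** D)) = s"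
    using M by (auto simp: factor_def)
  have "((\<lambda>z. \<Sum>i\<in>UNIV. \<Sum>k\<in>UNIV. \<rho> $ i $ k * M z $ k $ i) has_field_derivative
      (\<Sum>i\<in>UNIV. \<Sum>k\<in>UNIV. \<rho> $ i $ k * D $ k $ i)) (at 0)"
    using D(1) by (intro DERIV_sum DERIV_cmult) (simp add: has_matrix_derivative_def)
  then have "(f has_field_derivative trace (\<rho> ** D)) (at 0)"
    by (simp add: f_def trace_def matrix_matrix_mult_def)
  then have "f' 0 = trace (\<rho> ** D)" using f'(2) DERIV_unique by blast
  moreover have "norm (f z) \<le> 1" if "Re z = 0" for z
    using norm_trace_psd_mult_contraction_le[OF psd, of "M z"] M that tr by (simp add: f_def factor_def)
  moreover have "f 0 = 1" using M tr by (simp add: f_def factor_def)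
  ultimately show ?thesis
    using that[of f' "max K1 K2"] f'(2) K D(2) by (auto simp: le_max_iff_disj)
qed

text \<open>The operator to the left of the argument in \<open>rec_map\<close>, with 1 + it replaced
  by a complex variable. The overview's product of powers of tensor products is grouped here by
  site.\<close>

definition site_amplitude :: "('x::finite \<times> 'y::finite) cmat \<Rightarrow> complex \<Rightarrow> ('x \<times> 'y) cmat" where
  "site_amplitude \<sigma> z = mpow \<sigma> (of_real (1/2) * z) ** kron (mat 1) (mpow (tr_fst \<sigma>) (of_real (- 1/2) * z))"

definition amplitude ::
  "(('a::finite \<times> 'a'::finite) \<times> ('b::finite \<times> 'b'::finite) \<times> ('c::finite \<times> 'c'::finite)) cmat
    \<Rightarrow> complex \<Rightarrow> (('a \<times> 'a') \<times> ('b \<times> 'b') \<times> ('c \<times> 'c')) cmat" where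
  "amplitude \<rho> z =
     kron (site_amplitude (marg1 \<rho>) z) (kron (site_amplitude (marg2 \<rho>) z) (site_amplitude (marg3 \<rho>) z))
     ** ampliate in_bar (mpow (bar_marg \<rho>) (of_real (1/2) * z))"

lemma psd_marginals:
  assumes "psd \<rho>"
  shows "psd (marg1 \<rho>)" "psd (marg2 \<rho>)" "psd (marg3 \<rho>)"
  using assms by (simp_all add: marginals_conv psd_partial_trace bij2_in)

lemma psd_tr_fst: "psd \<sigma> \<Longrightarrow> psd (tr_fst \<sigma>)"
  by (simp add: marginals_conv psd_partial_trace bij2_in)

lemma psd_bar_marg: "psd \<rho> \<Longrightarrow> psd (bar_marg \<rho>)"
  by (simp add: marginals_conv psd_partial_trace bij2_in)

lemma adj_ampliate_mpow:
  "psd \<sigma> \<Longrightarrow> adj (ampliate g (mpow \<sigma> z)) = ampliate g (mpow \<sigma> (cnj z))"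
  by (simp add: adj_ampliate adj_mpow)

lemma adj_site_amplitude:
  assumes "psd \<sigma>"
  shows "adj (site_amplitude \<sigma> z) = kron (mat 1) (mpow (tr_fst \<sigma>) (of_real (- 1/2) * cnj z)) ** mpow \<sigma> (of_real (1/2) * cnj z)"
  using assms by (simp add: site_amplitude_def adj_mult adj_kron adj_mpow psd_tr_fst)

lemma rec_map_conv:
  assumes \<sigma>: "psd \<sigma>"
  shows "rec_map \<sigma> t = (\<lambda>X. site_amplitude \<sigma> (Complex 1 t) ** kron (mat 1) X ** adj (site_amplitude \<sigma> (Complex 1 t)))"
proof -
  have z: "(1 + \<i> * complex_of_real t) / 2 = of_real (1/2) * Complex 1 t"
    "- ((1 + \<i> * complex_of_real t) / 2) = of_real (- 1/2) * Complex 1 t"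
    "(1 - \<i> * complex_of_real t) / 2 = of_real (1/2) * cnj (Complex 1 t)"
    "- ((1 - \<i> * complex_of_real t) / 2) = of_real (- 1/2) * cnj (Complex 1 t)"
    by (simp_all add: complex_eq_iff)
  show ?thesis
    \<comment> \<open>The negated exponents are rewritten first, since they contain the other two as
      subterms.\<close>
    unfolding rec_map_def unfolding z(2,4) unfolding z(1,3) unfolding adj_site_amplitude[OF \<sigma>] by (simp only: site_amplitude_def matrix_mul_assoc)
qed

lemma recovered_conv_amplitude:
  fixes \<rho> :: "(('a::finite \<times> 'a'::finite) \<times> ('b::finite \<times> 'b'::finite) \<times> ('c::finite \<times> 'c'::finite)) cmat"
  assumes \<rho>: "psd \<rho>"
  shows "recovered \<rho> t = amplitude \<rho> (Complex 1 t) ** adj (amplitude \<rho> (Complex 1 t))"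
proof -
  define z where "z = Complex 1 t"
  define K where "K = kron (site_amplitude (marg1 \<rho>) z) (kron (site_amplitude (marg2 \<rho>) z) (site_amplitude (marg3 \<rho>) z))"
  define E :: "(('a \<times> 'a') \<times> ('b \<times> 'b') \<times> ('c \<times> 'c')) cmat" where "E = ampliate in_bar (mpow (bar_marg \<rho>) (of_real (1/2) * z))"
  note bar = psd_bar_marg[OF \<rho>]
  have "of_real (1/2) * z + of_real (1/2) * cnj z = 1" by (simp add: z_def complex_eq_iff)
  then have "E ** adj E = ampliate in_bar (bar_marg \<rho>)"
    unfolding E_def adj_ampliate_mpow[OF bar]
    by (simp add: ampliate_mult[OF bij2_in(6), symmetric] mpow_mult[OF bar] mpow_1[OF bar])
  moreover have "recovered \<rho> t = K ** ampliate in_bar (bar_marg \<rho>) ** adj K"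
    unfolding recovered_def rec_map_conv[OF psd_marginals(1)[OF \<rho>]] rec_map_conv[OF psd_marginals(2)[OF \<rho>]]
      rec_map_conv[OF psd_marginals(3)[OF \<rho>]] K_def z_def by (rule tensor_map_conjugation)
  moreover have "(K ** E) ** adj (K ** E) = K ** (E ** adj E) ** adj K"
    by (simp only: adj_mult matrix_mul_assoc)
  ultimately have "recovered \<rho> t = (K ** E) ** adj (K ** E)"
    by (simp only:)
  then show ?thesis by (simp add: amplitude_def K_def E_def z_def)
qed

lemma factor_site:
  fixes g :: "'x::finite \<times> 'y::finite \<Rightarrow> 'd::finite \<Rightarrow> 'n::finite"
  assumes g: "bij2 g" and \<rho>: "psd \<rho>"
  shows "factor \<rho> (\<lambda>z. ampliate g (site_amplitude (partial_trace g \<rho>) z))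
     (- vn_entropy (partial_trace g \<rho>) / 2 + vn_entropy (tr_fst (partial_trace g \<rho>)) / 2)"
proof -
  have "factor \<rho> (\<lambda>z. ampliate g (ampliate in_snd (mpow (tr_fst (partial_trace g \<rho>)) (of_real (- 1/2) * z))))
      (- (- 1/2) * vn_entropy (tr_fst (partial_trace g \<rho>)))"
    unfolding marginals_conv partial_trace_compose ampliate_compose[OF g bij2_in(4)]
    by (rule factor_ampliate_mpow[OF bij2_compose[OF g bij2_in(4)] \<rho>])
  from factor_mult[OF factor_ampliate_mpow[OF g \<rho>, of "1/2"] this]
  show ?thesis
    by (simp add: site_amplitude_def ampliate_mult[OF g] ampliate_in_snd)
qed

text \<open>The six marginal entropies and the joint barred one occur with the signs of the
  conditional information; only the entropy of \<open>\<rho>\<close> itself is missing. The factor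
  \<open>mpow \<rho> (of_real (- 1/2) * z)\<close>, multiplied in front later, supplies it with
  slope \<open>vn_entropy \<rho> / 2\<close>.\<close>

lemma factor_amplitude:
  assumes \<rho>: "psd \<rho>"
  shows "factor \<rho> (amplitude \<rho>) (- (cond_mutual_info \<rho> + vn_entropy \<rho>) / 2)"
proof -
  have "factor \<rho> (amplitude \<rho>)
     ((- vn_entropy (marg1 \<rho>) / 2 + vn_entropy (tr_fst (marg1 \<rho>)) / 2) +
      (- vn_entropy (marg2 \<rho>) / 2 + vn_entropy (tr_fst (marg2 \<rho>)) / 2) +
      (- vn_entropy (marg3 \<rho>) / 2 + vn_entropy (tr_fst (marg3 \<rho>)) / 2) +
      (- (1/2) * vn_entropy (bar_marg \<rho>)))"
    unfolding amplitude_def[abs_def] kron3_conv_ampliate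
    unfolding marginals_conv(1-3,5)
    by (intro factor_mult factor_site factor_ampliate_mpow bij2_in \<rho>)
  then show ?thesis
    by (rule back_subst[of "factor \<rho> (amplitude \<rho>)"])
      (simp add: cond_mutual_info_def mutual_info_def marginals_of_bar_marg)
qed

text \<open>Tracing out the unbarred system leaves the one-party marginal between two of its inverse
  square roots up to imaginary powers. The exponents add up to 0 on Re z = 1, so the result is a
  support projection; thus the local recovery map does not increase the trace.\<close>

lemma contraction_tr_fst_site_amplitude:
  assumes \<sigma>: "psd \<sigma>" and z: "Re z = 1"
  shows "contraction (tr_fst (adj (site_amplitude \<sigma> z) ** site_amplitude \<sigma> z))"
proof -
  define \<tau> where "\<tau> = tr_fst \<sigma>"
  have \<tau>: "psd \<tau>" unfolding \<tau>_def by (rule psd_tr_fst[OF \<sigma>])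
  have half: "of_real (1/2) * cnj z + of_real (1/2) * z = 1"
    and nhalf: "of_real (- 1/2) * cnj z + 1 + of_real (- 1/2) * z = 0"
    using z by (simp_all add: complex_eq_iff)
  have "adj (site_amplitude \<sigma> z) ** site_amplitude \<sigma> z
     = ampliate in_snd (mpow \<tau> (of_real (- 1/2) * cnj z))
       ** (mpow \<sigma> (of_real (1/2) * cnj z) ** mpow \<sigma> (of_real (1/2) * z))
       ** ampliate in_snd (mpow \<tau> (of_real (- 1/2) * z))"
    unfolding adj_site_amplitude[OF \<sigma>] unfolding site_amplitude_def \<tau>_def ampliate_in_snd
    by (simp only: matrix_mul_assoc)
  also have "mpow \<sigma> (of_real (1/2) * cnj z) ** mpow \<sigma> (of_real (1/2) * z) = \<sigma>"
    unfolding mpow_mult[OF \<sigma>] half by (rule mpow_1[OF \<sigma>])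
  finally have "tr_fst (adj (site_amplitude \<sigma> z) ** site_amplitude \<sigma> z)
     = mpow \<tau> (of_real (- 1/2) * cnj z) ** \<tau> ** mpow \<tau> (of_real (- 1/2) * z)"
    unfolding marginals_conv(4) by (simp only: partial_trace_ampliate_mult[OF bij2_in(4)] \<tau>_def marginals_conv(4))
  also have "\<dots> = mpow \<tau> (of_real (- 1/2) * cnj z) ** mpow \<tau> 1 ** mpow \<tau> (of_real (- 1/2) * z)"
    by (simp only: mpow_1[OF \<tau>])
  also have "\<dots> = mpow \<tau> 0"
    unfolding mpow_mult[OF \<tau>] nhalf ..
  finally show ?thesis using contraction_mpow[OF \<tau>, of 0] by simp
qed

lemma partial_trace_in_bar_kron:
  "partial_trace in_bar (kron A (kron B C)) = kron (tr_fst A) (kron (tr_fst B) (tr_fst C))"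
proof -
  have triple: "(\<Sum>p\<in>UNIV. F p) = (\<Sum>a\<in>UNIV. \<Sum>b\<in>UNIV. \<Sum>c\<in>UNIV. F (a, b, c))"
    for F :: "'u::finite \<times> 'v::finite \<times> 'w::finite \<Rightarrow> complex"
    by (simp add: sum.cartesian_product flip: UNIV_Times_UNIV)
  have prod: "(\<Sum>a\<in>UNIV. f a) * ((\<Sum>b\<in>UNIV. g b) * (\<Sum>c\<in>UNIV. h c)) =
      (\<Sum>a\<in>UNIV. \<Sum>b\<in>UNIV. \<Sum>c\<in>UNIV. f a * (g b * h c))"
    for f :: "'u::finite \<Rightarrow> complex" and g :: "'v::finite \<Rightarrow> complex" and h :: "'w::finite \<Rightarrow> complex"
    unfolding sum_product[of g] sum_distrib_right[of f] by (simp only: sum_distrib_left)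
  show ?thesis
    unfolding vec_eq_iff split_paired_All partial_trace_def marginals_conv(4) vec_lambda_beta kron_def triple
    by (simp add: in_bar_def in_snd_def prod)
qed

text \<open>Cyclicity and the duality of ampliation and partial trace reduce the trace to that of
  the joint barred marginal against a tensor product of three contractions.\<close>

lemma trace_recovered_le_1:
  fixes \<rho> :: "(('a::finite \<times> 'a'::finite) \<times> ('b::finite \<times> 'b'::finite) \<times> ('c::finite \<times> 'c'::finite)) cmat"
  assumes \<rho>: "quantum_state \<rho>"
  shows "Re (trace (recovered \<rho> t)) \<le> 1"
proof -
  have psd: "psd \<rho>" and tr: "trace \<rho> = 1" using \<rho> by (auto simp: quantum_state_def)
  define z where "z = Complex 1 t"
  have z: "Re z = 1" by (simp add: z_def)
  note bar = psd_bar_marg[OF psd]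
  define E :: "(('a \<times> 'a') \<times> ('b \<times> 'b') \<times> ('c \<times> 'c')) cmat" where "E = ampliate in_bar (mpow (bar_marg \<rho>) (of_real (1/2) * z))"
  define K where "K = kron (site_amplitude (marg1 \<rho>) z) (kron (site_amplitude (marg2 \<rho>) z) (site_amplitude (marg3 \<rho>) z))"
  have "of_real (1/2) * z + of_real (1/2) * cnj z = 1" by (simp add: z_def complex_eq_iff)
  then have EE: "E ** adj E = ampliate in_bar (bar_marg \<rho>)"
    unfolding E_def adj_ampliate_mpow[OF bar]
    by (simp add: ampliate_mult[OF bij2_in(6), symmetric] mpow_mult[OF bar] mpow_1[OF bar])
  define C where "C = partial_trace in_bar (adj K ** K)"
  have C: "contraction C"
    unfolding C_def K_def adj_kron kron_mult partial_trace_in_bar_kron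
    by (intro contraction_kron contraction_tr_fst_site_amplitude psd_marginals psd z)
  have "trace (recovered \<rho> t) = trace (K ** (E ** adj E ** adj K))"
    by (simp add: recovered_conv_amplitude[OF psd] amplitude_def K_def E_def z_def adj_mult matrix_mul_assoc)
  also have "\<dots> = trace (adj K ** K ** ampliate in_bar (bar_marg \<rho>))"
    by (subst trace_mul_sym, subst (2) trace_mul_sym) (simp add: EE matrix_mul_assoc)
  also have "\<dots> = trace (bar_marg \<rho> ** C)"
    unfolding C_def trace_mult_ampliate[OF bij2_in(6)] by (rule trace_mul_sym)
  finally have "Re (trace (recovered \<rho> t)) \<le> norm (trace (bar_marg \<rho> ** C))"
    by (simp add: complex_Re_le_cmod)
  also have "\<dots> \<le> Re (trace (bar_marg \<rho>))"
    by (rule norm_trace_psd_mult_contraction_le[OF bar C])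
  also have "\<dots> = 1" by (simp add: marginals_conv(5) trace_partial_trace[OF bij2_in(6)] tr)
  finally show ?thesis .
qed

text \<open>On the right line the power 1 - z/2 of the state splits into an imaginary power, which
  is a contraction, and the square root; the fidelity and Cauchy-Schwarz bounds expect exactly this
  form.\<close>

lemma mult_mpow_neg_half:
  assumes "psd \<rho>"
  shows "\<rho> ** mpow \<rho> (of_real (- 1/2) * Complex 1 s) = mpow \<rho> (Complex 0 (- s / 2)) ** msqrt \<rho>"
proof -
  have e: "1 + of_real (- 1/2) * Complex 1 s = Complex 0 (- s / 2) + 1/2"
    by (simp add: complex_eq_iff)
  have "\<rho> ** mpow \<rho> (of_real (- 1/2) * Complex 1 s) = mpow \<rho> 1 ** mpow \<rho> (of_real (- 1/2) * Complex 1 s)"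
    by (simp only: mpow_1[OF assms])
  also have "\<dots> = mpow \<rho> (Complex 0 (- s / 2)) ** msqrt \<rho>"
    unfolding mpow_mult[OF assms] e msqrt_def ..
  finally show ?thesis .
qed

section \<open>The fidelity inequality\<close>

lemma fidelity_bound:
  assumes \<rho>: "quantum_state \<rho>"
  shows "- ereal_integral lborel (\<lambda>t. ereal (beta0 t) * elog (fidelity \<rho> (recovered \<rho> t)))
     \<le> ereal (cond_mutual_info \<rho>)"
proof -
  have psd: "psd \<rho>" and tr: "trace \<rho> = 1" using \<rho> by (auto simp: quantum_state_def)
  define M where "M z = mpow \<rho> (of_real (- 1/2) * z) ** amplitude \<rho> z" for z
  define F where "F t = fidelity \<rho> (recovered \<rho> t)" for t
  have M: "factor \<rho> M (- cond_mutual_info \<rho> / 2)"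
    using factor_mult[OF factor_mpow[OF psd, of "- 1/2"] factor_amplitude[OF psd]]
    by (simp add: M_def[abs_def] add_divide_distrib diff_divide_distrib)
  have F1: "F t \<le> 1" for t
  proof -
    have "psd (recovered \<rho> t)" unfolding recovered_conv_amplitude[OF psd] by (rule psd_mult_adj)
    from fidelity_le_trace_mult_trace[OF psd this] show ?thesis
      using trace_recovered_le_1[OF \<rho>, of t] by (simp add: F_def tr)
  qed
  have fF: "(norm (trace (\<rho> ** M (Complex 1 t))))\<^sup>2 \<le> F t" for t
  proof -
    have "\<rho> ** M (Complex 1 t) = mpow \<rho> (Complex 0 (- t / 2)) ** msqrt \<rho> ** amplitude \<rho> (Complex 1 t)"
      unfolding M_def matrix_mul_assoc mult_mpow_neg_half[OF psd] ..
    moreover have "contraction (mpow \<rho> (Complex 0 (- t / 2)))"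
      by (rule contraction_mpow[OF psd]) simp
    ultimately show ?thesis
      unfolding F_def recovered_conv_amplitude[OF psd] using norm_trace_le_fidelity[OF _ psd] by simp
  qed
  obtain f' K where f': "\<And>z. ((\<lambda>z. trace (\<rho> ** M z)) has_field_derivative f' z) (at z)"
    "\<And>z. 0 \<le> Re z \<Longrightarrow> Re z \<le> 1 \<Longrightarrow> norm (trace (\<rho> ** M z)) \<le> K"
    "\<And>z. 0 \<le> Re z \<Longrightarrow> Re z \<le> 1 \<Longrightarrow> norm (f' z) \<le> K"
    "\<And>z. Re z = 0 \<Longrightarrow> norm (trace (\<rho> ** M z)) \<le> 1" "trace (\<rho> ** M 0) = 1"
    "Re (f' 0) = - cond_mutual_info \<rho> / 2"
    by (rule factor_strip_function[OF \<rho> M]) blast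
  have I: "0 \<le> cond_mutual_info \<rho>"
    using strip_derivative_log_integral(1)[of "\<lambda>z. trace (\<rho> ** M z)", OF f'(1-5) fF F1] f'(6) by simp
  have int: "(\<integral>\<^sup>+t. e2ennreal (- (ereal (beta0 t) * elog (F t))) \<partial>lborel) \<le> ennreal (cond_mutual_info \<rho>)"
    using strip_derivative_log_integral(2)[of "\<lambda>z. trace (\<rho> ** M z)", OF f'(1-5) fF F1] f'(6) by simp
  \<comment> \<open>The integrand is nonpositive, so its positive part integrates to 0 and the
    extended difference never becomes infinity minus infinity.\<close>
  have "ereal (beta0 t) * elog (F t) \<le> 0" for t
  proof -
    have "0 \<le> F t" using order_trans[OF zero_le_power2 fF] .
    then have "elog (F t) \<le> 0" using F1[of t] by (auto simp: elog_def)
    then show ?thesis using beta0_pos[of t] by (simp add: ereal_mult_le_0_iff)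
  qed
  then have "(\<integral>\<^sup>+t. e2ennreal (ereal (beta0 t) * elog (F t)) \<partial>lborel) = 0"
    by (simp add: e2ennreal_neg)
  then have "- ereal_integral lborel (\<lambda>t. ereal (beta0 t) * elog (F t))
     = enn2ereal (\<integral>\<^sup>+t. e2ennreal (- (ereal (beta0 t) * elog (F t))) \<partial>lborel)"
    by (simp add: ereal_integral_def zero_ennreal.rep_eq)
  also have "\<dots> \<le> enn2ereal (ennreal (cond_mutual_info \<rho>))"
    using int by (simp only: less_eq_ennreal.rep_eq)
  also have "\<dots> = ereal (cond_mutual_info \<rho>)" using I by simp
  finally show ?thesis by (simp add: F_def)
qed

section \<open>The measured relative entropy inequality\<close>

lemma expsum_continuous: "expsum f \<Longrightarrow> continuous_on A f"
  using expsum_has_derivative by (meson DERIV_isCont continuous_at_imp_continuous_on)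

lemma norm_matrix_le:
  fixes A :: "'n::finite cmat"
  shows "norm A \<le> (\<Sum>i\<in>UNIV. \<Sum>j\<in>UNIV. norm (A $ i $ j))"
proof -
  have "norm A \<le> (\<Sum>i\<in>UNIV. norm (A $ i))" unfolding norm_vec_def by (rule L2_set_le_sum) simp
  also have "\<dots> \<le> (\<Sum>i\<in>UNIV. \<Sum>j\<in>UNIV. norm (A $ i $ j))"
    unfolding norm_vec_def[of "A $ _"] by (intro sum_mono L2_set_le_sum) simp
  finally show ?thesis .
qed

lemma recovered_continuous_bounded:
  fixes \<rho> :: "(('a::finite \<times> 'a'::finite) \<times> ('b::finite \<times> 'b'::finite) \<times> ('c::finite \<times> 'c'::finite)) cmat"
  assumes \<rho>: "psd \<rho>"
  shows "continuous_on UNIV (recovered \<rho>)" and "\<exists>C. \<forall>t. norm (recovered \<rho> t) \<le> C"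
proof -
  define G where "G = amplitude \<rho>"
  have "expsum_matrix G"
    unfolding G_def amplitude_def[abs_def] kron3_conv_ampliate site_amplitude_def ampliate_in_snd[symmetric]
    by (intro expsum_matrix_mult expsum_matrix_ampliate expsum_matrix_mpow psd_marginals psd_tr_fst psd_bar_marg \<rho>)
  then have G: "expsum (\<lambda>z. G z $ i $ j)" for i j unfolding expsum_matrix_def by blast
  have entry: "recovered \<rho> t $ i $ j = (\<Sum>k\<in>UNIV. G (Complex 1 t) $ i $ k * cnj (G (Complex 1 t) $ j $ k))" for t i j
    unfolding recovered_conv_amplitude[OF \<rho>] by (simp add: G_def matrix_matrix_mult_def adj_def)
  have Gc: "continuous_on UNIV (\<lambda>t. G (Complex 1 t) $ i $ j)" for i j
    unfolding Complex_eq
    by (intro continuous_on_compose2[OF expsum_continuous[OF G[of i j], of UNIV]] continuous_intros) auto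
  have "continuous_on UNIV (\<lambda>t. \<chi> i j. recovered \<rho> t $ i $ j)"
    unfolding entry by (intro continuous_on_vec_lambda continuous_intros Gc)
  then show "continuous_on UNIV (recovered \<rho>)" by simp
  have "\<exists>K. \<forall>t. norm (G (Complex 1 t) $ i $ j) \<le> K" for i j
    using expsum_bounded[OF G[of i j]] by (metis complex.sel(1) order_refl zero_le_one)
  then obtain K where K: "\<And>i j t. norm (G (Complex 1 t) $ i $ j) \<le> K i j" by metis
  have "norm (recovered \<rho> t) \<le> (\<Sum>i\<in>UNIV. \<Sum>j\<in>UNIV. \<Sum>k\<in>UNIV. K i k * K j k)" for t
  proof (rule order_trans[OF norm_matrix_le], intro sum_mono)
    fix i j
    show "norm (recovered \<rho> t $ i $ j) \<le> (\<Sum>k\<in>UNIV. K i k * K j k)"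
      unfolding entry
    proof (rule order_trans[OF norm_sum], intro sum_mono)
      fix k
      show "norm (G (Complex 1 t) $ i $ k * cnj (G (Complex 1 t) $ j $ k)) \<le> K i k * K j k"
        unfolding norm_mult complex_mod_cnj
        by (intro mult_mono K norm_ge_zero order_trans[OF norm_ge_zero K])
    qed
  qed
  then show "\<exists>C. \<forall>t. norm (recovered \<rho> t) \<le> C" by blast
qed

text \<open>This makes the averaged state a genuine Bochner integral instead of the default value 0,
  and allows linear functionals to be exchanged with it.\<close>

lemma recovered_integrable:
  fixes \<rho> :: "(('a::finite \<times> 'a'::finite) \<times> ('b::finite \<times> 'b'::finite) \<times> ('c::finite \<times> 'c'::finite)) cmat"
  assumes \<rho>: "psd \<rho>"
  shows "integrable lborel (\<lambda>t. beta0 t *\<^sub>R recovered \<rho> t)"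
proof -
  obtain C where C: "\<And>t. norm (recovered \<rho> t) \<le> C" using recovered_continuous_bounded(2)[OF \<rho>] by blast
  show ?thesis
  proof (rule Bochner_Integration.integrable_bound)
    show "integrable lborel (\<lambda>t. C * beta0 t)"
      by (intro integrable_mult_right beta0_has_integral_1)
    have "continuous_on UNIV (\<lambda>t. beta0 t *\<^sub>R recovered \<rho> t)"
      by (intro continuous_intros beta0_continuous recovered_continuous_bounded(1)[OF \<rho>])
    then show "(\<lambda>t. beta0 t *\<^sub>R recovered \<rho> t) \<in> borel_measurable lborel"
      by (simp add: borel_measurable_continuous_onI)
    show "AE t in lborel. norm (beta0 t *\<^sub>R recovered \<rho> t) \<le> norm (C * beta0 t)"
    proof (rule AE_I2)
      fix t
      have "beta0 t * norm (recovered \<rho> t) \<le> beta0 t * \<bar>C\<bar>"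
        using C[of t] beta0_pos[of t] by (intro mult_left_mono) auto
      then show "norm (beta0 t *\<^sub>R recovered \<rho> t) \<le> norm (C * beta0 t)"
        using beta0_pos[of t] by (simp add: abs_mult mult.commute)
    qed
  qed
qed

lemma bounded_linear_Re_trace_mult: "bounded_linear (\<lambda>A :: 'n::finite cmat. Re (trace (A ** B)))"
proof -
  have "linear (\<lambda>A :: 'n cmat. Re (trace (A ** B)))"
    by (rule linearI)
      (simp_all add: trace_def matrix_matrix_mult_def sum_distrib_left sum.distrib algebra_simps)
  then show ?thesis by (simp add: linear_conv_bounded_linear)
qed

lemma trace_mult_psd_nonneg:
  assumes M: "psd M"
  shows "Re (trace (G ** adj G ** M)) = (\<Sum>j\<in>UNIV. Re (cdot (column j G) (M *v column j G)))"
    and "0 \<le> Re (trace (G ** adj G ** M))"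
proof -
  have "trace (G ** adj G ** M) = trace (adj G ** (M ** G))"
    by (subst matrix_mul_assoc[symmetric], subst trace_mul_sym) (simp add: matrix_mul_assoc)
  also have "\<dots> = (\<Sum>j\<in>UNIV. cdot (column j G) (M *v column j G))"
    unfolding column_matrix_mult[symmetric]
    by (simp add: trace_def matrix_matrix_mult_def[of "adj G"]) (simp add: adj_def cdot_def column_def)
  finally show *: "Re (trace (G ** adj G ** M)) = (\<Sum>j\<in>UNIV. Re (cdot (column j G) (M *v column j G)))"
    by simp
  show "0 \<le> Re (trace (G ** adj G ** M))"
    unfolding * using M by (intro sum_nonneg) (simp add: psd_iff)
qed

text \<open>The classical variational bound for relative entropy with arbitrary positive weights. On
  Re z = 1 Cauchy-Schwarz bounds the squared modulus by \<open>L (recovered \<rho> s)\<close>, which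
  is linear in the recovered state; y \<le> exp (y - 1) keeps the exponent affine, so integration
  commutes with \<open>L\<close>.\<close>

lemma povm_weight_bound:
  fixes \<rho> :: "(('a::finite \<times> 'a'::finite) \<times> ('b::finite \<times> 'b'::finite) \<times> ('c::finite \<times> 'c'::finite)) cmat"
    and w :: "nat \<Rightarrow> real"
  assumes \<rho>: "quantum_state \<rho>" and M: "povm n M" and w: "\<And>k. 0 < w k"
  shows "(\<Sum>k<n. Re (trace (\<rho> ** M k)) * ln (w k)) - cond_mutual_info \<rho>
     \<le> (\<Sum>k<n. w k * Re (trace ((\<integral>t. beta0 t *\<^sub>R recovered \<rho> t \<partial>lborel) ** M k))) - 1"
proof -
  have psd: "psd \<rho>" and tr: "trace \<rho> = 1" using \<rho> by (auto simp: quantum_state_def)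
  have Mk: "psd (M k)" if "k < n" for k using M that by (simp add: povm_def)
  \<comment> \<open>Half the logarithm of each weight, because the squared modulus of the
    coefficient, which is w k on Re z = 1, enters the estimate.\<close>
  define W :: "complex \<Rightarrow> (('a \<times> 'a') \<times> ('b \<times> 'b') \<times> ('c \<times> 'c')) cmat"
    where "W z = (\<chi> i j. \<Sum>k<n. exp (of_real (ln (w k) / 2) * z) * M k $ i $ j)" for z
  define N where "N z = mpow \<rho> (of_real (- 1/2) * z) ** (W z ** amplitude \<rho> z)" for z
  have N: "factor \<rho> N ((\<Sum>k<n. ln (w k) / 2 * Re (trace (\<rho> ** M k))) - cond_mutual_info \<rho> / 2)"
    using factor_mult[OF factor_mpow[OF psd, of "- 1/2"]
        factor_mult[OF factor_povm[OF \<rho> M, of "\<lambda>k. ln (w k) / 2"] factor_amplitude[OF psd]]]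
    by (simp add: N_def[abs_def] W_def add_divide_distrib diff_divide_distrib)
  obtain f' K where f': "\<And>z. ((\<lambda>z. trace (\<rho> ** N z)) has_field_derivative f' z) (at z)"
    "\<And>z. 0 \<le> Re z \<Longrightarrow> Re z \<le> 1 \<Longrightarrow> norm (trace (\<rho> ** N z)) \<le> K"
    "\<And>z. 0 \<le> Re z \<Longrightarrow> Re z \<le> 1 \<Longrightarrow> norm (f' z) \<le> K"
    "\<And>z. Re z = 0 \<Longrightarrow> norm (trace (\<rho> ** N z)) \<le> 1" "trace (\<rho> ** N 0) = 1"
    "Re (f' 0) = (\<Sum>k<n. ln (w k) / 2 * Re (trace (\<rho> ** M k))) - cond_mutual_info \<rho> / 2"
    by (rule factor_strip_function[OF \<rho> N]) blast
  define L where "L = (\<lambda>A. \<Sum>k<n. w k * Re (trace (A ** M k)))"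
  have L: "bounded_linear L"
    unfolding L_def by (intro bounded_linear_sum bounded_linear_const_mult bounded_linear_Re_trace_mult)
  have Q: "(norm (trace (\<rho> ** N (Complex 1 s))))\<^sup>2 \<le> L (recovered \<rho> s)" for s
  proof -
    define V where "V = mpow \<rho> (Complex 0 (- s / 2))"
    have V: "contraction V" unfolding V_def by (rule contraction_mpow[OF psd]) simp
    define X where "X = adj (V ** msqrt \<rho>)"
    define G where "G = amplitude \<rho> (Complex 1 s)"
    define Y where "Y = W (Complex 1 s) ** G"
    have "\<rho> ** N (Complex 1 s) = adj X ** Y"
      unfolding N_def matrix_mul_assoc mult_mpow_neg_half[OF psd]
      by (simp add: X_def Y_def G_def V_def matrix_mul_assoc)
    then have "(norm (trace (\<rho> ** N (Complex 1 s))))\<^sup>2 \<le> Re (trace (adj X ** X)) * Re (trace (adj Y ** Y))"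
      by (simp only: trace_adj_mult_Cauchy_Schwarz)
    also have "\<dots> \<le> 1 * Re (trace (adj Y ** Y))"
    proof (rule mult_right_mono)
      have "trace (adj X ** X) = trace (adj (V ** msqrt \<rho>) ** (V ** msqrt \<rho>))"
        unfolding X_def adj_adj by (rule trace_mul_sym)
      also have "Re \<dots> \<le> Re (trace (adj (msqrt \<rho>) ** msqrt \<rho>))"
        by (rule trace_adj_mult_contraction_le[OF V])
      finally show "Re (trace (adj X ** X)) \<le> 1"
        by (simp add: adj_msqrt[OF psd] msqrt_mult_msqrt[OF psd] tr)
      show "0 \<le> Re (trace (adj Y ** Y))"
        unfolding trace_adj_mult_self_columns by (simp add: sum_nonneg)
    qed
    also have "1 * Re (trace (adj Y ** Y)) = (\<Sum>j\<in>UNIV. (norm (W (Complex 1 s) *v column j G))\<^sup>2)"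
      unfolding trace_adj_mult_self_columns Y_def column_matrix_mult by simp
    also have "\<dots> \<le> (\<Sum>j\<in>UNIV. \<Sum>k<n. w k * Re (cdot (column j G) (M k *v column j G)))"
    proof (rule sum_mono)
      fix j
      have ew: "(norm (exp (of_real (ln (w k) / 2) * Complex 1 s)))\<^sup>2 = w k" for k
        using w[of k] by (simp add: power2_eq_square exp_add[symmetric])
      show "(norm (W (Complex 1 s) *v column j G))\<^sup>2 \<le> (\<Sum>k<n. w k * Re (cdot (column j G) (M k *v column j G)))"
        unfolding W_def
        using norm_povm_combination_le[OF M, of "\<lambda>k. exp (of_real (ln (w k) / 2) * Complex 1 s)" "column j G"]
        unfolding ew .
    qed
    also have "\<dots> = (\<Sum>k<n. w k * (\<Sum>j\<in>UNIV. Re (cdot (column j G) (M k *v column j G))))"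
      by (subst sum.swap) (simp only: sum_distrib_left)
    also have "\<dots> = L (recovered \<rho> s)"
      unfolding L_def recovered_conv_amplitude[OF psd] G_def[symmetric]
      by (intro sum.cong refl) (simp add: trace_mult_psd_nonneg(1)[OF Mk])
    finally show ?thesis .
  qed
  \<comment> \<open>The half turns the bound on the squared modulus into one on the modulus.\<close>
  define u where "u s = (L (recovered \<rho> s) - 1) / 2" for s
  have right: "norm (trace (\<rho> ** N (Complex 1 s))) \<le> exp (u s)" for s
  proof (rule power2_le_imp_le)
    have "(norm (trace (\<rho> ** N (Complex 1 s))))\<^sup>2 \<le> 1 + (L (recovered \<rho> s) - 1)" using Q[of s] by simp
    also have "\<dots> \<le> exp (L (recovered \<rho> s) - 1)" by (rule exp_ge_add_one_self)
    also have "\<dots> = (exp (u s))\<^sup>2" by (simp add: u_def power2_eq_square exp_add[symmetric])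
    finally show "(norm (trace (\<rho> ** N (Complex 1 s))))\<^sup>2 \<le> (exp (u s))\<^sup>2" .
  qed simp
  have uc: "continuous_on UNIV u"
    unfolding u_def
    by (intro continuous_intros bounded_linear.continuous_on[OF L] recovered_continuous_bounded(1)[OF psd]) simp
  obtain C where C: "\<And>t. norm (recovered \<rho> t) \<le> C" using recovered_continuous_bounded(2)[OF psd] by blast
  obtain B where B: "B \<ge> 0" "\<And>A. norm (L A) \<le> norm A * B" using bounded_linear.nonneg_bounded[OF L] by blast
  have ub: "\<bar>u s\<bar> \<le> (C * B + 1) / 2" for s
  proof -
    have "\<bar>L (recovered \<rho> s)\<bar> \<le> C * B"
      using order_trans[OF B(2) mult_right_mono[OF C B(1)], of s] by simp
    then show ?thesis by (simp add: u_def abs_le_iff)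
  qed
  note ir = recovered_integrable[OF psd]
  have bu: "beta0 t * u t = (L (beta0 t *\<^sub>R recovered \<rho> t) - beta0 t) / 2" for t
    by (simp add: u_def linear_scale[OF bounded_linear.linear[OF L]] algebra_simps)
  have "(\<integral>t. beta0 t * u t \<partial>lborel) = ((\<integral>t. L (beta0 t *\<^sub>R recovered \<rho> t) \<partial>lborel) - (\<integral>t. beta0 t \<partial>lborel)) / 2"
    unfolding bu using integrable_bounded_linear[OF L ir] beta0_has_integral_1(1) by simp
  also have "(\<integral>t. L (beta0 t *\<^sub>R recovered \<rho> t) \<partial>lborel) = L (\<integral>t. beta0 t *\<^sub>R recovered \<rho> t \<partial>lborel)"
    by (rule integral_bounded_linear[OF L ir])
  finally have "(\<Sum>k<n. ln (w k) / 2 * Re (trace (\<rho> ** M k))) - cond_mutual_info \<rho> / 2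
      \<le> (L (\<integral>t. beta0 t *\<^sub>R recovered \<rho> t \<partial>lborel) - 1) / 2"
    using strip_derivative_le_integral[of "\<lambda>z. trace (\<rho> ** N z)", OF f'(1-5) uc ub right] f'(6)
    by (simp add: beta0_has_integral_1(2))
  moreover have "(\<Sum>k<n. ln (w k) / 2 * Re (trace (\<rho> ** M k))) = (\<Sum>k<n. Re (trace (\<rho> ** M k)) * ln (w k)) / 2"
    by (simp add: sum_divide_distrib mult.commute)
  ultimately show ?thesis by (simp add: L_def)
qed

text \<open>For a fixed measurement the optimal weights are the ratios p / q. The variational bound
  needs positive finite weights, so outcomes with q = 0 are first excluded and outcomes with p = 0
  receive a small weight.\<close>

lemma D_ALL_bound:
  fixes \<rho> :: "(('a::finite \<times> 'a'::finite) \<times> ('b::finite \<times> 'b'::finite) \<times> ('c::finite \<times> 'c'::finite)) cmat"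
  assumes \<rho>: "quantum_state \<rho>"
  shows "D_ALL \<rho> (\<integral>t. beta0 t *\<^sub>R recovered \<rho> t \<partial>lborel) \<le> ereal (cond_mutual_info \<rho>)"
proof -
  have psd: "psd \<rho>" and tr: "trace \<rho> = 1" using \<rho> by (auto simp: quantum_state_def)
  define \<sigma> where "\<sigma> = (\<integral>t. beta0 t *\<^sub>R recovered \<rho> t \<partial>lborel)"
  define I where "I = cond_mutual_info \<rho>"
  have "(\<Sum>z<n. rel_ent_term (Re (trace (\<rho> ** M z))) (Re (trace (\<sigma> ** M z)))) \<le> ereal I"
    if M: "povm n M" for n M
  proof -
    have Mk: "psd (M k)" if "k < n" for k using M that by (simp add: povm_def)
    define p q where "p k = Re (trace (\<rho> ** M k))" and "q k = Re (trace (\<sigma> ** M k))" for k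
    have bound: "(\<Sum>k<n. p k * ln (w k)) - I \<le> (\<Sum>k<n. w k * q k) - 1" if "\<And>k. 0 < w k" for w
      unfolding p_def q_def \<sigma>_def I_def by (rule povm_weight_bound[OF \<rho> M that])
    have p0: "0 \<le> p k" if "k < n" for k
      using trace_mult_psd_nonneg(2)[OF Mk[OF that], of "msqrt \<rho>"]
      by (simp add: p_def adj_msqrt[OF psd] msqrt_mult_msqrt[OF psd])
    have q0: "0 \<le> q k" if "k < n" for k
    proof -
      have "q k = (\<integral>t. Re (trace ((beta0 t *\<^sub>R recovered \<rho> t) ** M k)) \<partial>lborel)"
        unfolding q_def \<sigma>_def
        by (rule integral_bounded_linear[OF bounded_linear_Re_trace_mult recovered_integrable[OF psd], symmetric])
      also have "\<dots> \<ge> 0"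
      proof (rule integral_nonneg_AE, rule AE_I2)
        fix t
        have "Re (trace ((beta0 t *\<^sub>R recovered \<rho> t) ** M k)) = beta0 t * Re (trace (recovered \<rho> t ** M k))"
          using linear_scale[OF bounded_linear.linear[OF bounded_linear_Re_trace_mult]] by simp
        moreover have "0 \<le> Re (trace (recovered \<rho> t ** M k))"
          unfolding recovered_conv_amplitude[OF psd] by (rule trace_mult_psd_nonneg(2)[OF Mk[OF that]])
        ultimately show "0 \<le> Re (trace ((beta0 t *\<^sub>R recovered \<rho> t) ** M k))"
          using beta0_pos[of t] by simp
      qed
      finally show ?thesis .
    qed
    have p1: "(\<Sum>k<n. p k) = 1"
    proof -
      have "(\<Sum>k<n. trace (\<rho> ** M k)) = trace (\<rho> ** (\<Sum>k<n. M k))"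
        by (induction n) (simp_all add: matrix_add_ldistrib trace_add, simp add: trace_def matrix_matrix_mult_def)
      also have "\<dots> = 1" using M tr by (simp add: povm_def)
      finally have "Re (\<Sum>k<n. trace (\<rho> ** M k)) = 1" by simp
      then show ?thesis by (simp add: p_def)
    qed
    have ac: "q k \<noteq> 0" if k: "k < n" "p k \<noteq> 0" for k
    proof
      assume qk: "q k = 0"
      \<comment> \<open>With logarithmic weight \<open>x\<close> on outcome \<open>k\<close> alone,
        the left side equals the sum of all q j, while the right side is that sum minus 1; the
        weight itself is invisible there because q k = 0.\<close>
      define x where "x = (I + (\<Sum>j<n. q j)) / p k"
      have pk: "p k > 0" using p0[OF k(1)] k(2) by simp
      have "(\<Sum>j<n. p j * ln (if j = k then exp x else 1)) - I \<le> (\<Sum>j<n. (if j = k then exp x else 1) * q j) - 1"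
        by (rule bound) simp
      moreover have "(\<Sum>j<n. p j * ln (if j = k then exp x else 1)) = (\<Sum>j<n. if j = k then p k * x else 0)"
        by (intro sum.cong refl) auto
      moreover have "(\<Sum>j<n. (if j = k then exp x else 1) * q j) = (\<Sum>j<n. q j)"
        using qk by (intro sum.cong refl) auto
      ultimately have "p k * x - I \<le> (\<Sum>j<n. q j) - 1" using k(1) by simp
      then show False using pk by (simp add: x_def)
    qed
    have "(\<Sum>z<n. rel_ent_term (p z) (q z)) = (\<Sum>z<n. ereal (p z * ln (p z / q z)))"
      using ac by (intro sum.cong refl) (auto simp: rel_ent_term_def)
    also have "\<dots> = ereal (\<Sum>z<n. p z * ln (p z / q z))" by simp
    also have "(\<Sum>z<n. p z * ln (p z / q z)) \<le> I"
    proof (rule field_le_epsilon)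
      fix e :: real assume e: "0 < e"
      \<comment> \<open>Chosen so that the outcomes with p k = 0 add at most e to the weighted sum.
        The 1 in the denominator keeps it defined when all q k vanish.\<close>
      define \<eta> where "\<eta> = e / (1 + (\<Sum>k<n. q k))"
      have Q0: "0 \<le> (\<Sum>k<n. q k)" using q0 by (intro sum_nonneg) auto
      have \<eta>: "\<eta> > 0" unfolding \<eta>_def using e Q0 by (intro divide_pos_pos) auto
      define w where "w k = (if k < n \<and> p k \<noteq> 0 then p k / q k else \<eta>)" for k
      have wpos: "0 < w k" for k
        unfolding w_def using \<eta> p0[of k] q0[of k] ac[of k] by (auto intro!: divide_pos_pos simp: less_le)
      have "(\<Sum>k<n. p k * ln (w k)) = (\<Sum>k<n. p k * ln (p k / q k))"
        by (intro sum.cong refl) (auto simp: w_def)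
      moreover have "(\<Sum>k<n. w k * q k) \<le> (\<Sum>k<n. p k + \<eta> * q k)"
        using \<eta> p0 q0 ac by (intro sum_mono) (auto simp: w_def)
      moreover have "(\<Sum>k<n. p k + \<eta> * q k) = 1 + \<eta> * (\<Sum>k<n. q k)"
        by (simp add: sum.distrib p1 sum_distrib_left)
      moreover have "\<eta> * (\<Sum>k<n. q k) \<le> e"
      proof -
        have "e * (\<Sum>k<n. q k) \<le> e * (1 + (\<Sum>k<n. q k))" using e by (intro mult_left_mono) auto
        then show ?thesis unfolding \<eta>_def using Q0 by (simp add: divide_le_eq)
      qed
      ultimately show "(\<Sum>z<n. p z * ln (p z / q z)) \<le> I + e"
        using bound[of w, OF wpos] by linarith
    qed
    finally show ?thesis by (simp add: p_def q_def)
  qed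
  then show ?thesis
    unfolding D_ALL_def \<sigma>_def[symmetric] I_def[symmetric] by (intro SUP_least) auto
qed

theorem proposition12:
  fixes \<rho> :: "(('a::finite \<times> 'a'::finite) \<times> ('b::finite \<times> 'b'::finite) \<times> ('c::finite \<times> 'c'::finite)) cmat"
  assumes "quantum_state \<rho>"
  shows "ereal (cond_mutual_info \<rho>)
           \<ge> D_ALL \<rho> (\<integral>t. beta0 t *\<^sub>R recovered \<rho> t \<partial>lborel)
       \<and> ereal (cond_mutual_info \<rho>)
           \<ge> - ereal_integral lborel (\<lambda>t. ereal (beta0 t) * elog (fidelity \<rho> (recovered \<rho> t)))"
  using D_ALL_bound[OF assms] fidelity_bound[OF assms] by blast

end
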